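(* Let $\mathsf{H}$ be a separable complex Hilbert space and $p\ge1$. For any normal states $\varphi,\psi\in\mathcal{S}_n(\mathsf{B}(\mathsf{H}))$, $$\mathcal{C}_p(\varphi,\psi)=\inf\Big\{W_p^{\mathsf{P}_c}(\mu_0,\mu_1):\ \mu_0\in\Lambda_\varphi^\perp\cap\mathcal{P}(\mathsf{P}_1),\ \mu_1\in\Lambda_\psi^\perp\cap\mathcal{P}(\mathsf{P}_1)\Big\}.$$
   Context: $\mathsf{P}_c$ is the set of finite rank orthogonal projections of $\mathsf{H}$, with Riemannian metric $g(X,Y)=\operatorname{tr}(XY)$ induced from the self-adjoint Hilbert--Schmidt operators; its connected components are $\mathsf{P}_r=\{P\in\mathsf{P}_c:\dim R(P)=r\}$. $\mathsf{d}$ is the geodesic distance ($+\infty$ between different components); $\mathsf{P}_c$ is Polish. $\mathcal{P}(X)$ denotes Borel probability measures on $X$. $\operatorname{tr}(\cdot)\mu$ is the measure with density $P\mapsto\operatorname{tr}(P)$ with respect to $\mu$. $\mathcal{D}_1^\perp(\mathsf{P}_c)$ is the set of discrete measures $\mu=\sum_i\lambda_i\delta_{P_i}$ (countable sum, $P_i\in\mathsf{P}_c$, $\lambda_i\ge0$) with $\operatorname{tr}(\cdot)\mu\in\mathcal{P}(\mathsf{P}_c)$ and $\operatorname{tr}(PQ)=0$ for all $P\neq Q$ in $\operatorname{supp}(\mu)$. $\mathcal{S}_n(\mathsf{B}(\mathsf{H}))$ is the set of normal states of $\mathsf{B}(\mathsf{H})$; $\rho_\varphi$ is the density matrix of $\varphi$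 ($\varphi(B)=\operatorname{tr}(\rho_\varphi B)$). $\Lambda_\varphi^\perp=\{\sum_i\lambda_i\delta_{P_i}\in\mathcal{D}_1^\perp(\mathsf{P}_c):\sum_i\lambda_iP_i=\rho_\varphi\}$. For $\mu_0,\mu_1\in\mathcal{P}(\mathsf{P}_c)$, $\Pi_{\mathsf{d}}(\mu_0,\mu_1)$ is the set of $\nu\in\mathcal{P}(\mathsf{P}_c\times\mathsf{P}_c)$ with marginals $\mu_0,\mu_1$ such that $\dim R(P)=\dim R(Q)$ for $\nu$-a.e. $(P,Q)$, and $W_p^{\mathsf{P}_c}(\mu_0,\mu_1)=\inf_{\nu\in\Pi_{\mathsf{d}}(\mu_0,\mu_1)}\big(\int\mathsf{d}(P,Q)^p\,\nu(dPdQ)\big)^{1/p}$, equal to $+\infty$ if $\Pi_{\mathsf{d}}(\mu_0,\mu_1)=\emptyset$. The cost is $\mathcal{C}_p(\varphi,\psi)=\inf\{W_p^{\mathsf{P}_c}(\operatorname{tr}(\cdot)\mu_0,\operatorname{tr}(\cdot)\mu_1):\mu_0\in\Lambda_\varphi^\perp,\ \mu_1\in\Lambda_\psi^\perp\}$. *)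

theory Defs
  imports "HOL-Probability.Probability"
begin

section \<open>Complex Hilbert spaces\<close>

text \<open>The inner product is conjugate-linear in the first and linear in the second argument.\<close>

class complex_inner = real_normed_vector +
  fixes scaleC :: "complex \<Rightarrow> 'a \<Rightarrow> 'a"  (infixr \<open>*\<^sub>C\<close> 75)
    and cinner :: "'a \<Rightarrow> 'a \<Rightarrow> complex"
  assumes scaleC_add_right: "c *\<^sub>C (x + y) = c *\<^sub>C x + c *\<^sub>C y"
    and scaleC_add_left: "(c + d) *\<^sub>C x = c *\<^sub>C x + d *\<^sub>C x"
    and scaleC_scaleC: "c *\<^sub>C d *\<^sub>C x = (c * d) *\<^sub>C x"
    and scaleC_one: "1 *\<^sub>C x = x"
    and scaleR_scaleC: "r *\<^sub>R x = complex_of_real r *\<^sub>C x"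
    and cinner_commute: "cinner x y = cnj (cinner y x)"
    and cinner_add_right: "cinner x (y + z) = cinner x y + cinner x z"
    and cinner_scaleC_right: "cinner x (c *\<^sub>C y) = c * cinner x y"
    and cinner_ge_zero: "0 \<le> Re (cinner x x)"
    and cinner_eq_zero_iff: "cinner x x = 0 \<longleftrightarrow> x = 0"
    and norm_eq_sqrt_cinner: "norm x = sqrt (Re (cinner x x))"

class chilbert_space = complex_inner + complete_space

interpretation complex_vector: vector_space "scaleC :: complex \<Rightarrow> 'a \<Rightarrow> 'a::complex_inner"
  by unfold_locales (simp_all add: scaleC_add_right scaleC_add_left scaleC_scaleC scaleC_one)

lemma cinner_add_left: "cinner (x + y) z = cinner x z + cinner y z"
  by (metis cinner_add_right cinner_commute complex_cnj_add)

lemma cinner_scaleC_left: "cinner (c *\<^sub>C x) y = cnj c * cinner x y"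
  by (metis cinner_scaleC_right cinner_commute complex_cnj_mult)

lemma cinner_scaleR_right: "cinner x (r *\<^sub>R y) = of_real r * cinner x y"
  by (simp add: scaleR_scaleC cinner_scaleC_right)

lemma cinner_scaleR_left: "cinner (r *\<^sub>R x) y = of_real r * cinner x y"
  by (simp add: scaleR_scaleC cinner_scaleC_left)

lemma cinner_zero_right [simp]: "cinner x 0 = 0"
  using cinner_add_right[of x 0 0] by simp

lemma cinner_zero_left [simp]: "cinner 0 x = 0"
  using cinner_add_left[of 0 0 x] by simp

lemma Re_cinner_self: "Re (cinner x x) = (norm x)\<^sup>2"
  by (simp add: norm_eq_sqrt_cinner cinner_ge_zero)

lemma cinner_self: "cinner x x = of_real ((norm x)\<^sup>2)"
proof -
  have "Im (cinner x x) = - Im (cinner x x)"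
    by (subst cinner_commute) simp
  then show ?thesis by (simp add: complex_eq_iff Re_cinner_self)
qed

lemma norm_scaleC: "norm (c *\<^sub>C x) = cmod c * norm x"
proof -
  have "cinner (c *\<^sub>C x) (c *\<^sub>C x) = (c * cnj c) * cinner x x"
    by (simp only: cinner_scaleC_right cinner_scaleC_left mult.assoc)
  also have "\<dots> = complex_of_real ((cmod c)\<^sup>2 * (norm x)\<^sup>2)"
    by (simp only: cinner_self complex_norm_square[symmetric] of_real_mult)
  finally have "Re (cinner (c *\<^sub>C x) (c *\<^sub>C x)) = (cmod c * norm x)\<^sup>2"
    by (simp only: Re_complex_of_real power_mult_distrib)
  then have "(norm (c *\<^sub>C x))\<^sup>2 = (cmod c * norm x)\<^sup>2"
    by (simp only: Re_cinner_self)
  then show ?thesis by (rule power2_eq_imp_eq) simp_all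
qed

lemma bounded_linear_scaleC: "bounded_linear (\<lambda>x::'a::complex_inner. c *\<^sub>C x)"
  by (rule bounded_linear_intro[where K="cmod c"])
     (simp_all add: scaleC_add_right scaleR_scaleC scaleC_scaleC norm_scaleC mult.commute)

lemma abs_Re_cinner_le: "\<bar>Re (cinner x y)\<bar> \<le> ((norm x)\<^sup>2 + (norm y)\<^sup>2) / 2"
proof -
  have comm: "Re (cinner y x) = Re (cinner x y)"
    by (subst cinner_commute) simp
  have "0 \<le> Re (cinner (x + s *\<^sub>R y) (x + s *\<^sub>R y))" for s :: real
    by (rule cinner_ge_zero)
  from this[of 1] this[of "-1"] show ?thesis
    by (simp add: cinner_add_left cinner_add_right cinner_scaleR_left cinner_scaleR_right comm
        Re_cinner_self del: scaleR_minus1_left scaleR_one scaleR_minus_left)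
qed

lemma cmod_cinner_le: "cmod (cinner x y) \<le> (norm x)\<^sup>2 + (norm y)\<^sup>2"
proof -
  have "Im (cinner x y) = Re (cinner x ((-\<i>) *\<^sub>C y))"
    by (simp add: cinner_scaleC_right del: complex_vector.scale_minus_left)
  then have "\<bar>Im (cinner x y)\<bar> \<le> ((norm x)\<^sup>2 + (norm y)\<^sup>2) / 2"
    using abs_Re_cinner_le[of x "(-\<i>) *\<^sub>C y"]
    by (simp add: norm_scaleC del: complex_vector.scale_minus_left)
  from add_mono[OF abs_Re_cinner_le[of x y] this] show ?thesis
    using cmod_le[of "cinner x y"] by (simp add: field_simps)
qed

subsection \<open>A fixed orthonormal basis\<close>

text \<open>An orthonormal basis is a maximal orthonormal set.\<close>

definition is_onb :: "'a::complex_inner set \<Rightarrow> bool" where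
  "is_onb E \<longleftrightarrow> (\<forall>e\<in>E. norm e = 1) \<and> (\<forall>e\<in>E. \<forall>f\<in>E. e \<noteq> f \<longrightarrow> cinner e f = 0) \<and>
     (\<forall>x. (\<forall>e\<in>E. cinner e x = 0) \<longrightarrow> x = 0)"

lemma is_onb_exists: "\<exists>E::'a::complex_inner set. is_onb E"
proof -
  define O' where "O' = {E::'a set. (\<forall>e\<in>E. norm e = 1) \<and> (\<forall>e\<in>E. \<forall>f\<in>E. e \<noteq> f \<longrightarrow> cinner e f = 0)}"
  have "\<exists>M\<in>O'. \<forall>X\<in>O'. M \<subseteq> X \<longrightarrow> X = M"
  proof (rule subset_Zorn_nonempty)
    show "O' \<noteq> {}" unfolding O'_def by blast
  next
    fix \<C> assume ne: "\<C> \<noteq> {}" and "subset.chain O' \<C>"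
    then have sub: "\<C> \<subseteq> O'" and ch: "\<And>X Y. X \<in> \<C> \<Longrightarrow> Y \<in> \<C> \<Longrightarrow> X \<subseteq> Y \<or> Y \<subseteq> X"
      by (auto simp: subset_chain_def)
    have "cinner e f = 0" if ef: "e \<in> X" "X \<in> \<C>" "f \<in> Y" "Y \<in> \<C>" "e \<noteq> f" for e f X Y
    proof -
      from ch[OF ef(2) ef(4)] obtain Z where "Z \<in> \<C>" "e \<in> Z" "f \<in> Z" using ef by blast
      then show ?thesis using sub ef(5) unfolding O'_def by blast
    qed
    moreover have "norm e = 1" if "e \<in> X" "X \<in> \<C>" for e X
      using that sub unfolding O'_def by blast
    ultimately show "\<Union>\<C> \<in> O'" unfolding O'_def mem_Collect_eq
      by (intro conjI ballI impI) (elim UnionE, simp)+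
  qed
  then obtain M where M: "M \<in> O'" and max: "\<And>X. X \<in> O' \<Longrightarrow> M \<subseteq> X \<Longrightarrow> X = M" by blast
  have "x = 0" if x: "\<forall>e\<in>M. cinner e x = 0" for x
  proof (rule ccontr)
    assume "x \<noteq> 0"
    define u where "u = (1 / norm x) *\<^sub>R x"
    have nu: "norm u = 1" using \<open>x \<noteq> 0\<close> by (simp add: u_def)
    have ort: "cinner e u = 0" if "e \<in> M" for e
      using x that by (simp add: u_def cinner_scaleR_right)
    then have ort': "cinner u e = 0" if "e \<in> M" for e
      using that by (subst cinner_commute) simp
    have "insert u M \<in> O'" using M nu ort ort' unfolding O'_def by auto
    from max[OF this] have "u \<in> M" by auto
    then have "cinner u u = 0" by (rule ort)
    then show False using nu by (simp add: cinner_eq_zero_iff)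
  qed
  then have "is_onb M" using M by (simp add: O'_def is_onb_def)
  then show ?thesis by (rule exI)
qed

text \<open>Traces and Hilbert--Schmidt norms do not depend on the orthonormal basis used to compute them.\<close>

definition onb :: "'a::complex_inner set" where
  "onb = (SOME E. is_onb E)"

lemma is_onb_onb: "is_onb onb"
  unfolding onb_def by (rule someI_ex) (rule is_onb_exists)


section \<open>Operators\<close>

text \<open>The type \<^typ>\<open>'a \<Rightarrow>\<^sub>L 'a\<close> consists of the bounded real-linear maps; \<open>BH\<close> is $B(H)$.\<close>

definition BH :: "('a::complex_inner \<Rightarrow>\<^sub>L 'a) set" where
  "BH = {A :: 'a \<Rightarrow>\<^sub>L 'a. \<forall>c x. A (c *\<^sub>C x) = c *\<^sub>C A x}"

definition selfadjoint :: "('a::complex_inner \<Rightarrow>\<^sub>L 'a) \<Rightarrow> bool" where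
  "selfadjoint A \<longleftrightarrow> A \<in> BH \<and> (\<forall>x y. cinner (A x) y = cinner x (A y))"

definition positive_op :: "('a::complex_inner \<Rightarrow>\<^sub>L 'a) \<Rightarrow> bool" where
  "positive_op A \<longleftrightarrow> A \<in> BH \<and> (\<forall>x. cinner x (A x) \<in> \<real>\<^sub>\<ge>\<^sub>0)"

definition op_le :: "('a::complex_inner \<Rightarrow>\<^sub>L 'a) \<Rightarrow> ('a \<Rightarrow>\<^sub>L 'a) \<Rightarrow> bool" where
  "op_le A B \<longleftrightarrow> positive_op (B - A)"

text \<open>Only meaningful for trace class operators.\<close>

definition op_trace :: "('a::complex_inner \<Rightarrow>\<^sub>L 'a) \<Rightarrow> complex" where
  "op_trace A = (\<Sum>\<^sub>\<infinity>e\<in>onb. cinner e (A e))"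

definition hilbert_schmidt :: "('a::complex_inner \<Rightarrow>\<^sub>L 'a) \<Rightarrow> bool" where
  "hilbert_schmidt A \<longleftrightarrow> (\<lambda>e. (norm (A e))\<^sup>2) summable_on onb"

subsection \<open>The real Hilbert space of self-adjoint Hilbert--Schmidt operators\<close>

lemma selfadjoint_0: "selfadjoint 0"
  by (auto simp: selfadjoint_def BH_def)

lemma hilbert_schmidt_0: "hilbert_schmidt 0"
  by (simp add: hilbert_schmidt_def)

lemma selfadjoint_add: "selfadjoint A \<Longrightarrow> selfadjoint B \<Longrightarrow> selfadjoint (A + B)"
  by (auto simp: selfadjoint_def BH_def blinfun.add_left scaleC_add_right
      cinner_add_left cinner_add_right)

lemma selfadjoint_scaleR: "selfadjoint A \<Longrightarrow> selfadjoint (r *\<^sub>R A)"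
  by (auto simp: selfadjoint_def BH_def blinfun.scaleR_left scaleR_scaleC scaleC_scaleC mult.commute
      cinner_scaleC_left cinner_scaleC_right)

lemma hilbert_schmidt_add:
  assumes "hilbert_schmidt A" "hilbert_schmidt B"
  shows "hilbert_schmidt (A + B)"
proof -
  have "(\<lambda>e. 2 * (norm (A e))\<^sup>2 + 2 * (norm (B e))\<^sup>2) summable_on onb"
    using assms unfolding hilbert_schmidt_def
    by (intro summable_on_add summable_on_cmult_right)
  moreover have "(norm ((A + B) e))\<^sup>2 \<le> 2 * (norm (A e))\<^sup>2 + 2 * (norm (B e))\<^sup>2" for e
  proof -
    have "(norm ((A + B) e))\<^sup>2 \<le> (norm (A e) + norm (B e))\<^sup>2"
      by (intro power_mono) (simp_all add: blinfun.add_left norm_triangle_ineq)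
    also have "\<dots> \<le> 2 * (norm (A e))\<^sup>2 + 2 * (norm (B e))\<^sup>2"
      using zero_le_power2[of "norm (A e) - norm (B e)"] by (simp add: power2_sum power2_diff)
    finally show ?thesis .
  qed
  ultimately show ?thesis unfolding hilbert_schmidt_def
    by (rule summable_on_comparison_test) simp_all
qed

lemma hilbert_schmidt_scaleR: "hilbert_schmidt A \<Longrightarrow> hilbert_schmidt (r *\<^sub>R A)"
  unfolding hilbert_schmidt_def
  by (simp add: blinfun.scaleR_left power_mult_distrib summable_on_cmult_right)

typedef (overloaded) 'a sa_hs = "{A :: 'a::complex_inner \<Rightarrow>\<^sub>L 'a. selfadjoint A \<and> hilbert_schmidt A}"
  morphisms op_of Abs_sa_hs
  by (rule exI[of _ 0]) (simp add: selfadjoint_0 hilbert_schmidt_0)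

setup_lifting type_definition_sa_hs

lemma hs_summable:
  assumes "hilbert_schmidt A" "hilbert_schmidt B"
  shows "(\<lambda>e. cinner (A e) (B e)) summable_on onb"
proof -
  have "(\<lambda>e. (norm (A e))\<^sup>2 + (norm (B e))\<^sup>2) summable_on onb"
    using assms unfolding hilbert_schmidt_def by (rule summable_on_add)
  then have "(\<lambda>e. norm (cinner (A e) (B e))) summable_on onb"
    by (rule summable_on_comparison_test) (simp_all add: cmod_cinner_le)
  then show ?thesis by (rule abs_summable_summable)
qed

lemma op_trace_mult_selfadjoint:
  "selfadjoint A \<Longrightarrow> op_trace (A o\<^sub>L B) = (\<Sum>\<^sub>\<infinity>e\<in>onb. cinner (A e) (B e))"
  by (simp add: op_trace_def selfadjoint_def)

text \<open>$\mathrm{tr}(XY)$ is real for self-adjoint $X, Y$, so \<^term>\<open>Re\<close> only changes the type.\<close>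

instantiation sa_hs :: (complex_inner) real_inner
begin

lift_definition zero_sa_hs :: "'a sa_hs" is 0
  by (simp add: selfadjoint_0 hilbert_schmidt_0)

lift_definition plus_sa_hs :: "'a sa_hs \<Rightarrow> 'a sa_hs \<Rightarrow> 'a sa_hs" is "(+)"
  by (simp add: selfadjoint_add hilbert_schmidt_add)

lift_definition scaleR_sa_hs :: "real \<Rightarrow> 'a sa_hs \<Rightarrow> 'a sa_hs" is "scaleR"
  by (simp add: selfadjoint_scaleR hilbert_schmidt_scaleR)

lift_definition uminus_sa_hs :: "'a sa_hs \<Rightarrow> 'a sa_hs" is uminus
  by (metis selfadjoint_scaleR hilbert_schmidt_scaleR scaleR_minus1_left)

definition minus_sa_hs :: "'a sa_hs \<Rightarrow> 'a sa_hs \<Rightarrow> 'a sa_hs" where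
  "minus_sa_hs X Y = X + (- Y)"

definition inner_sa_hs :: "'a sa_hs \<Rightarrow> 'a sa_hs \<Rightarrow> real" where
  "inner_sa_hs X Y = Re (op_trace (op_of X o\<^sub>L op_of Y))"

definition norm_sa_hs :: "'a sa_hs \<Rightarrow> real" where
  "norm_sa_hs X = sqrt (inner X X)"

definition sgn_sa_hs :: "'a sa_hs \<Rightarrow> 'a sa_hs" where
  "sgn_sa_hs X = inverse (norm X) *\<^sub>R X"

definition dist_sa_hs :: "'a sa_hs \<Rightarrow> 'a sa_hs \<Rightarrow> real" where
  "dist_sa_hs X Y = norm (X - Y)"

definition uniformity_sa_hs :: "('a sa_hs \<times> 'a sa_hs) filter" where
  "uniformity_sa_hs = (INF e\<in>{0<..}. principal {(x, y). dist x y < e})"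

definition open_sa_hs :: "'a sa_hs set \<Rightarrow> bool" where
  "open_sa_hs U \<longleftrightarrow> (\<forall>x\<in>U. eventually (\<lambda>(x', y). x' = x \<longrightarrow> y \<in> U) uniformity)"

instance
proof
  fix X Y Z :: "'a sa_hs" and r s :: real and U :: "'a sa_hs set"
  have sa: "selfadjoint (op_of W)" and hs: "hilbert_schmidt (op_of W)" for W :: "'a sa_hs"
    using op_of[of W] by simp_all
  have inn: "inner V W = Re (\<Sum>\<^sub>\<infinity>e\<in>onb. cinner (op_of V e) (op_of W e))" for V W :: "'a sa_hs"
    by (simp add: inner_sa_hs_def op_trace_mult_selfadjoint sa)
  have summ: "(\<lambda>e. cinner (op_of V e) (op_of W e)) summable_on onb" for V W :: "'a sa_hs"
    by (intro hs_summable hs)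
  show "X + Y + Z = X + (Y + Z)" by transfer (rule add.assoc)
  show "X + Y = Y + X" by transfer (rule add.commute)
  show "0 + X = X" by transfer simp
  show "- X + X = 0" by transfer simp
  show "X - Y = X + - Y" by (rule minus_sa_hs_def)
  show "r *\<^sub>R (X + Y) = r *\<^sub>R X + r *\<^sub>R Y" by transfer (rule scaleR_add_right)
  show "(r + s) *\<^sub>R X = r *\<^sub>R X + s *\<^sub>R X" by transfer (rule scaleR_add_left)
  show "r *\<^sub>R s *\<^sub>R X = (r * s) *\<^sub>R X" by transfer simp
  show "1 *\<^sub>R X = X" by transfer simp
  show "sgn X = inverse (norm X) *\<^sub>R X" by (rule sgn_sa_hs_def)
  show "dist X Y = norm (X - Y)" by (rule dist_sa_hs_def)
  show "uniformity = (INF e\<in>{0<..}. principal {(x::'a sa_hs, y). dist x y < e})"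
    by (rule uniformity_sa_hs_def)
  show "open U \<longleftrightarrow> (\<forall>x\<in>U. eventually (\<lambda>(x', y). x' = x \<longrightarrow> y \<in> U) uniformity)"
    by (rule open_sa_hs_def)
  show "norm X = sqrt (inner X X)" by (rule norm_sa_hs_def)
  show "inner X Y = inner Y X"
  proof -
    have "(\<Sum>\<^sub>\<infinity>e\<in>onb. cinner (op_of X e) (op_of Y e))
        = (\<Sum>\<^sub>\<infinity>e\<in>onb. cnj (cinner (op_of Y e) (op_of X e)))"
      by (rule infsum_cong) (rule cinner_commute)
    also have "\<dots> = cnj (\<Sum>\<^sub>\<infinity>e\<in>onb. cinner (op_of Y e) (op_of X e))"
      by (rule infsum_cnj)
    finally show ?thesis by (simp add: inn)
  qed
  show "inner (X + Y) Z = inner X Z + inner Y Z"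
    by (simp add: inn plus_sa_hs.rep_eq blinfun.add_left cinner_add_left infsum_add summ)
  show "inner (r *\<^sub>R X) Y = r * inner X Y"
    by (simp add: inn scaleR_sa_hs.rep_eq blinfun.scaleR_left cinner_scaleR_left
        infsum_cmult_right summ)
  have self: "((\<lambda>e. (norm (op_of X e))\<^sup>2) has_sum inner X X) onb"
  proof -
    have "((\<lambda>e. cinner (op_of X e) (op_of X e)) has_sum
        (\<Sum>\<^sub>\<infinity>e\<in>onb. cinner (op_of X e) (op_of X e))) onb"
      using summ has_sum_infsum by blast
    from has_sum_Re[OF this] show ?thesis by (simp add: inn Re_cinner_self)
  qed
  show "0 \<le> inner X X" using self by (rule has_sum_nonneg) simp
  show "inner X X = 0 \<longleftrightarrow> X = 0"
  proof
    assume "inner X X = 0"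
    then have z: "op_of X e = 0" if "e \<in> onb" for e
    proof -
      have "((\<lambda>e. (norm (op_of X e))\<^sup>2) has_sum 0) onb"
        using self \<open>inner X X = 0\<close> by simp
      then have "(norm (op_of X e))\<^sup>2 = 0"
        by (rule nonneg_has_sum_le_0D) (simp_all add: that)
      then show ?thesis by simp
    qed
    have "op_of X v = 0" for v
    proof -
      have "cinner e (op_of X v) = 0" if "e \<in> onb" for e
        using sa[of X] z[OF that] unfolding selfadjoint_def by (metis cinner_zero_left)
      then show ?thesis using is_onb_onb unfolding is_onb_def by blast
    qed
    then show "X = 0" by transfer (simp add: blinfun_eqI)
  next
    assume "X = 0"
    then show "inner X X = 0" by (simp add: inn zero_sa_hs.rep_eq)
  qed
qed

end


section \<open>Normal states and density matrices\<close>

text \<open>Functionals on $B(H)$ are represented by functions on the ambient type; their values outside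
  \<^const>\<open>BH\<close> are irrelevant.\<close>

definition state :: "(('a::complex_inner \<Rightarrow>\<^sub>L 'a) \<Rightarrow> complex) \<Rightarrow> bool" where
  "state \<phi> \<longleftrightarrow>
     (\<forall>A\<in>BH. \<forall>B\<in>BH. \<phi> (A + B) = \<phi> A + \<phi> B) \<and>
     (\<forall>c. \<forall>A\<in>BH. \<phi> (Blinfun (\<lambda>x. c *\<^sub>C blinfun_apply A x)) = c * \<phi> A) \<and>
     (\<forall>A. positive_op A \<longrightarrow> \<phi> A \<in> \<real>\<^sub>\<ge>\<^sub>0) \<and>
     \<phi> id_blinfun = 1"

text \<open>Normality: \<open>\<phi>\<close> preserves least upper bounds of increasing nets (equivalently, of upward directed
  sets) of self-adjoint operators. \<open>\<phi>\<close> is real on self-adjoint operators.\<close>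

definition normal_state :: "(('a::complex_inner \<Rightarrow>\<^sub>L 'a) \<Rightarrow> complex) \<Rightarrow> bool" where
  "normal_state \<phi> \<longleftrightarrow> state \<phi> \<and>
     (\<forall>D A. D \<noteq> {} \<and> D \<subseteq> Collect selfadjoint \<and> selfadjoint A \<and>
        (\<forall>X\<in>D. \<forall>Y\<in>D. \<exists>Z\<in>D. op_le X Z \<and> op_le Y Z) \<and>
        (\<forall>X\<in>D. op_le X A) \<and>
        (\<forall>B. selfadjoint B \<and> (\<forall>X\<in>D. op_le X B) \<longrightarrow> op_le A B)
        \<longrightarrow> Re (\<phi> A) = (SUP X\<in>D. Re (\<phi> X)))"

text \<open>A positive operator is trace class iff its diagonal is summable.\<close>

definition density_operator :: "('a::complex_inner \<Rightarrow>\<^sub>L 'a) \<Rightarrow> bool" where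
  "density_operator \<rho> \<longleftrightarrow> positive_op \<rho> \<and> ((\<lambda>e. cinner e (\<rho> e)) has_sum 1) onb"

definition density_matrix :: "(('a::complex_inner \<Rightarrow>\<^sub>L 'a) \<Rightarrow> complex) \<Rightarrow> ('a \<Rightarrow>\<^sub>L 'a)" where
  "density_matrix \<phi> = (THE \<rho>. density_operator \<rho> \<and> (\<forall>B\<in>BH. \<phi> B = op_trace (\<rho> o\<^sub>L B)))"


section \<open>Finite rank projections\<close>

definition Pc :: "'a::complex_inner sa_hs set" where
  "Pc = {P. op_of P o\<^sub>L op_of P = op_of P \<and>
            (\<exists>B. finite B \<and> range (op_of P) = complex_vector.span B)}"

definition rk :: "'a::complex_inner sa_hs \<Rightarrow> nat" where
  "rk P = complex_vector.dim (range (op_of P))"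

definition Pr :: "nat \<Rightarrow> 'a::complex_inner sa_hs set" where
  "Pr r = {P\<in>Pc. rk P = r}"

text \<open>Infimum of the lengths of $C^1$ curves in \<^const>\<open>Pc\<close>, with velocity \<open>\<gamma>'\<close>; \<open>norm (\<gamma>' t)\<close> is
  $\sqrt{\mathrm{tr}(\gamma'(t)^2)}$. Piecewise $C^1$ curves give the same infimum, since they
  can be reparametrised to have zero velocity at the corners. The infimum is \<open>\<infinity>\<close> if there is no curve.\<close>

definition geod_dist :: "'a::complex_inner sa_hs \<Rightarrow> 'a sa_hs \<Rightarrow> ennreal" where
  "geod_dist P Q =
     (INF (\<gamma>, \<gamma>') \<in> {(\<gamma>, \<gamma>'). \<gamma> ` {0..1} \<subseteq> Pc \<and> \<gamma> 0 = P \<and> \<gamma> 1 = Q \<and>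
            continuous_on {0..1} \<gamma>' \<and>
            (\<forall>t\<in>{0..1}. (\<gamma> has_vector_derivative \<gamma>' t) (at t within {0..1}))}.
        ennreal (integral {0..1::real} (\<lambda>t. norm (\<gamma>' t))))"


section \<open>Measures on the space of projections\<close>

definition borel_prob :: "'b::topological_space set \<Rightarrow> 'b measure set" where
  "borel_prob X = {\<mu>. sets \<mu> = sets (restrict_space borel X) \<and> prob_space \<mu>}"

definition msupport :: "'b::topological_space measure \<Rightarrow> 'b set" where
  "msupport \<mu> = {x\<in>space \<mu>. \<forall>U. open U \<and> x \<in> U \<longrightarrow> emeasure \<mu> (U \<inter> space \<mu>) > 0}"

text \<open>$\mathrm{tr}(\cdot)\mu$\<close>

definition tr_meas :: "'a::complex_inner sa_hs measure \<Rightarrow> 'a sa_hs measure" where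
  "tr_meas \<mu> = density \<mu> (\<lambda>P. ennreal (Re (op_trace (op_of P))))"

text \<open>$\sum_i \lambda_i \delta_{P_i}$ as the image of the weighted counting measure on the index set.
  Finite sums are included, by taking \<open>l i = 0\<close> for all but finitely many \<open>i\<close>.\<close>

definition weighted_diracs :: "(nat \<Rightarrow> real) \<Rightarrow> (nat \<Rightarrow> 'a::complex_inner sa_hs) \<Rightarrow> 'a sa_hs measure" where
  "weighted_diracs l P =
     distr (density (count_space UNIV) (\<lambda>i. ennreal (l i))) (restrict_space borel Pc) P"

definition D1_perp :: "'a::complex_inner sa_hs measure set" where
  "D1_perp = {\<mu>. (\<exists>l P. (\<forall>i. l i \<ge> 0) \<and> (\<forall>i. P i \<in> Pc) \<and> \<mu> = weighted_diracs l P) \<and>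
     tr_meas \<mu> \<in> borel_prob Pc \<and>
     (\<forall>P\<in>msupport \<mu>. \<forall>Q\<in>msupport \<mu>. P \<noteq> Q \<longrightarrow> op_trace (op_of P o\<^sub>L op_of Q) = 0)}"

definition Lambda_perp :: "(('a::complex_inner \<Rightarrow>\<^sub>L 'a) \<Rightarrow> complex) \<Rightarrow> 'a sa_hs measure set" where
  "Lambda_perp \<phi> = {\<mu>\<in>D1_perp. \<exists>l P. (\<forall>i. l i \<ge> 0) \<and> (\<forall>i. P i \<in> Pc) \<and> \<mu> = weighted_diracs l P \<and>
     (\<lambda>i. l i *\<^sub>R op_of (P i)) sums density_matrix \<phi>}"

text \<open>$\mathcal{P}(\mathsf{P}_r)$ inside $\mathcal{P}(\mathsf{P}_c)$\<close>

definition prob_on_Pr :: "nat \<Rightarrow> 'a::complex_inner sa_hs measure set" where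
  "prob_on_Pr r = {\<mu>\<in>borel_prob Pc. AE P in \<mu>. P \<in> Pr r}"


section \<open>Wasserstein distance and transport cost\<close>

definition ennpowr :: "ennreal \<Rightarrow> real \<Rightarrow> ennreal" where
  "ennpowr x a = (if x = \<infinity> then \<infinity> else ennreal (enn2real x powr a))"

definition couplings :: "'a::complex_inner sa_hs measure \<Rightarrow> 'a sa_hs measure \<Rightarrow>
    ('a sa_hs \<times> 'a sa_hs) measure set" where
  "couplings \<mu>0 \<mu>1 = {\<nu>\<in>borel_prob (Pc \<times> Pc).
     distr \<nu> (restrict_space borel Pc) fst = \<mu>0 \<and>
     distr \<nu> (restrict_space borel Pc) snd = \<mu>1 \<and>
     (AE (P, Q) in \<nu>. rk P = rk Q)}"

definition Wass :: "real \<Rightarrow> 'a::complex_inner sa_hs measure \<Rightarrow> 'a sa_hs measure \<Rightarrow> ennreal" where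
  "Wass p \<mu>0 \<mu>1 = (INF \<nu>\<in>couplings \<mu>0 \<mu>1.
     ennpowr (\<integral>\<^sup>+ (P, Q). ennpowr (geod_dist P Q) p \<partial>\<nu>) (1 / p))"

definition transport_cost :: "real \<Rightarrow> (('a::complex_inner \<Rightarrow>\<^sub>L 'a) \<Rightarrow> complex) \<Rightarrow>
    (('a \<Rightarrow>\<^sub>L 'a) \<Rightarrow> complex) \<Rightarrow> ennreal" where
  "transport_cost p \<phi> \<psi> =
     (INF (\<mu>0, \<mu>1) \<in> Lambda_perp \<phi> \<times> Lambda_perp \<psi>. Wass p (tr_meas \<mu>0) (tr_meas \<mu>1))"

end

theory Submission
  imports Defs
begin

text \<open>On projections of rank one the trace is 1, so \<open>tr_meas \<mu> = \<mu>\<close> there and the right-hand side is an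
  infimum over part of the pairs that compete in \<^const>\<open>transport_cost\<close>. The converse splits projections
  into lines: given orthogonal decompositions of the two density matrices and a
  coupling $\nu$ of the associated measures, it provides rank one decompositions and a coupling whose cost is
  larger by an arbitrarily small amount.

  If \<open>e\<close> is an orthonormal basis of \<open>X\<close>, the mass that $\nu$ puts on \<open>(X, Y)\<close> can be
  distributed evenly over the pairs of lines spanned by $e_k$ and $f_k$, where \<open>f\<close> is a basis of \<open>Y\<close>. This
  respects the density matrices for every choice of bases (\<open>split_pmf_decomposition\<close>), and costs no
  more than before if the bases are aligned, that is, if the distance between the $k$-th lines is at most
  the distance between \<open>X\<close> and \<open>Y\<close>. For one pair of equal rank, every basis of \<open>X\<close> has an aligned basis of \<open>Y\<close>
  (\<open>aligned_bases\<close>). Indeed, if a curve of projections from \<open>X\<close> to \<open>Y\<close> has length $L \le \pi/\sqrt 2$, then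
  $\|Ye\| \ge \cos(L/\sqrt 2)$ for every unit vector $e$ of the range of \<open>X\<close>
  (\<open>arccos_le_geod_dist\<close>). Gram--Schmidt applied to the vectors $Ye_k$
  keeps this bound for the overlaps $\langle e_k, f_k\rangle$ (\<open>Gram_Schmidt_overlap\<close>), and the distance of two lines is
  at most $\sqrt 2$ times the angle between them.

  The basis of a projection must serve all its partners at once, and around a cycle
  $X_1, Y_1, X_2, Y_2, \dots, X_1$ of partners the aligned bases need not match up. Therefore the
  coupling is changed as well. On a finite set of pairs the mass can be moved along the cycles, without
  changing the marginals or increasing the cost, until the pairs used form a forest; there the bases can be
  chosen one after the other (\<open>labelled_transport_plan\<close>). All but an arbitrarily small part of $\nu$ lives on
  finitely many pairs. On the remaining pairs the lines are matched without regard to alignment, which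
  costs little because distances between lines are at most $\pi/\sqrt 2$ (\<open>split_plan\<close>).\<close>

section \<open>Parseval's identity\<close>

text \<open>Through this class the bounded operators form a Banach space, in which absolutely summable series of
  operators converge.\<close>

instance chilbert_space \<subseteq> banach ..

lemma cinner_minus_right: "cinner x (- y) = - cinner x (y::'a::complex_inner)"
  using cinner_add_right[of x y "-y"] by (simp add: add_eq_0_iff2)

lemma cinner_minus_left: "cinner (- x) y = - cinner x (y::'a::complex_inner)"
  by (metis cinner_minus_right cinner_commute complex_cnj_minus)

lemma cinner_diff_right: "cinner x (y - z) = cinner x y - cinner x (z::'a::complex_inner)"
  using cinner_add_right[of x y "-z"] by (simp add: cinner_minus_right)

lemma cinner_diff_left: "cinner (x - y) z = cinner x z - cinner y (z::'a::complex_inner)"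
  using cinner_add_left[of x "-y" z] by (simp add: cinner_minus_left)

lemma cinner_sum_right: "cinner x (\<Sum>i\<in>I. f i) = (\<Sum>i\<in>I. cinner x (f i :: 'a::complex_inner))"
  by (induction I rule: infinite_finite_induct) (simp_all add: cinner_add_right)

lemma cinner_sum_left: "cinner (\<Sum>i\<in>I. f i) x = (\<Sum>i\<in>I. cinner (f i :: 'a::complex_inner) x)"
  by (induction I rule: infinite_finite_induct) (simp_all add: cinner_add_left)

lemmas cinner_simps = cinner_add_left cinner_add_right cinner_diff_left cinner_diff_right
  cinner_scaleC_left cinner_scaleC_right cinner_scaleR_left cinner_scaleR_right
  cinner_sum_left cinner_sum_right

lemma norm_add_sq_complex_inner:
  "(norm (x + y :: 'a::complex_inner))\<^sup>2 = (norm x)\<^sup>2 + (norm y)\<^sup>2 + 2 * Re (cinner x y)"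
proof -
  have "Re (cinner y x) = Re (cinner x y)" by (subst cinner_commute) simp
  then show ?thesis by (simp add: Re_cinner_self[symmetric] cinner_simps)
qed

lemma norm_add_sq_orthogonal:
  "cinner x y = 0 \<Longrightarrow> (norm (x + y :: 'a::complex_inner))\<^sup>2 = (norm x)\<^sup>2 + (norm y)\<^sup>2"
  by (simp add: norm_add_sq_complex_inner)

lemma cinner_zero_commute: "cinner x y = 0 \<longleftrightarrow> cinner y (x::'a::complex_inner) = 0"
  by (metis cinner_commute complex_cnj_zero)

lemma norm_diff_component_sq:
  fixes x e :: "'a::complex_inner"
  assumes "norm e = 1"
  shows "(norm (x - cinner e x *\<^sub>C e))\<^sup>2 = (norm x)\<^sup>2 - (cmod (cinner e x))\<^sup>2"
proof -
  have "cinner (x - cinner e x *\<^sub>C e) (cinner e x *\<^sub>C e) = 0"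
  proof -
    have "cinner x e = cnj (cinner e x)" by (rule cinner_commute)
    then show ?thesis using assms by (simp add: cinner_simps cinner_self)
  qed
  from norm_add_sq_orthogonal[OF this] show ?thesis
    using assms by (simp add: norm_scaleC)
qed

lemma cinner_Cauchy_Schwarz: "cmod (cinner x y) \<le> norm x * norm (y::'a::complex_inner)"
proof (cases "x = 0")
  case False
  define e where "e = (1 / norm x) *\<^sub>R x"
  have ne: "norm e = 1" using False by (simp add: e_def)
  have "0 \<le> (norm y)\<^sup>2 - (cmod (cinner e y))\<^sup>2"
    using norm_diff_component_sq[OF ne, of y] zero_le_power2[of "norm (y - cinner e y *\<^sub>C e)"] by linarith
  then have "(cmod (cinner e y))\<^sup>2 \<le> (norm y)\<^sup>2" by linarith
  then have "cmod (cinner e y) \<le> norm y" by (rule power2_le_imp_le) (rule norm_ge_zero)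
  moreover have "cinner e y = cinner x y / norm x" by (simp add: e_def cinner_simps)
  ultimately show ?thesis using False by (simp add: norm_divide field_simps)
qed simp

lemma bounded_linear_cinner_right: "bounded_linear (cinner (x::'a::complex_inner))"
  by (rule bounded_linear_intro[where K = "norm x"])
     (simp_all add: cinner_simps scaleR_conv_of_real,
      metis cinner_Cauchy_Schwarz mult.commute)

context
  fixes E :: "'a::complex_inner set"
  assumes onb: "is_onb E"
begin

lemma onb_cinner: "e \<in> E \<Longrightarrow> f \<in> E \<Longrightarrow> cinner e f = (if e = f then 1 else 0)"
  using onb unfolding is_onb_def by (auto simp: cinner_self)

lemma onb_partial_sum:
  assumes "finite F" "F \<subseteq> E"
  shows "(norm (\<Sum>b\<in>F. c b *\<^sub>C b))\<^sup>2 = (\<Sum>b\<in>F. (cmod (c b))\<^sup>2)"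
    and "b \<in> E \<Longrightarrow> cinner b (\<Sum>b\<in>F. c b *\<^sub>C b) = (if b \<in> F then c b else 0)"
    and "(norm (y - (\<Sum>b\<in>F. cinner b y *\<^sub>C b)))\<^sup>2 = (norm y)\<^sup>2 - (\<Sum>b\<in>F. (cmod (cinner b y))\<^sup>2)"
proof -
  have coeff: "cinner b (\<Sum>b\<in>F. c b *\<^sub>C b) = (if b \<in> F then c b else 0)" if "b \<in> E" for b c
  proof -
    have "cinner b (\<Sum>b\<in>F. c b *\<^sub>C b) = (\<Sum>b'\<in>F. if b' = b then c b' else 0)"
      unfolding cinner_simps using assms that
      by (intro sum.cong) (auto simp: onb_cinner)
    then show ?thesis using assms by (simp add: sum.delta)
  qed
  show "b \<in> E \<Longrightarrow> cinner b (\<Sum>b\<in>F. c b *\<^sub>C b) = (if b \<in> F then c b else 0)"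
    by (rule coeff)
  show nrm: "(norm (\<Sum>b\<in>F. c b *\<^sub>C b))\<^sup>2 = (\<Sum>b\<in>F. (cmod (c b))\<^sup>2)" for c
  proof -
    have "cinner (\<Sum>b\<in>F. c b *\<^sub>C b) (\<Sum>b\<in>F. c b *\<^sub>C b) = (\<Sum>b\<in>F. cnj (c b) * cinner b (\<Sum>b\<in>F. c b *\<^sub>C b))"
      by (simp only: cinner_sum_left cinner_scaleC_left)
    also have "\<dots> = (\<Sum>b\<in>F. cnj (c b) * c b)"
      using assms by (intro sum.cong) (auto simp: coeff)
    finally have eq: "cinner (\<Sum>b\<in>F. c b *\<^sub>C b) (\<Sum>b\<in>F. c b *\<^sub>C b) = (\<Sum>b\<in>F. cnj (c b) * c b)" .
    show ?thesis
      unfolding Re_cinner_self[symmetric] eq Re_sum cmod_power2 by (simp add: power2_eq_square)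
  qed
  let ?s = "\<Sum>b\<in>F. cinner b y *\<^sub>C b"
  have "cinner (y - ?s) ?s = 0"
  proof -
    have "cinner ?s (y - ?s) = (\<Sum>b\<in>F. cnj (cinner b y) * cinner b (y - ?s))"
      by (simp only: cinner_sum_left cinner_scaleC_left)
    also have "\<dots> = 0"
      using assms by (intro sum.neutral) (auto simp: cinner_diff_right coeff)
    finally show ?thesis by (subst cinner_zero_commute)
  qed
  from norm_add_sq_orthogonal[OF this] nrm[of "\<lambda>b. cinner b y"]
  show "(norm (y - ?s))\<^sup>2 = (norm y)\<^sup>2 - (\<Sum>b\<in>F. (cmod (cinner b y))\<^sup>2)" by simp
qed

end

text \<open>By Bessel's inequality the squared coefficients are summable. Finite expansions of \<open>y\<close> whose
  coefficients nearly exhaust this sum form a Cauchy sequence; its limit has the same coefficients as \<open>y\<close>,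
  so it is \<open>y\<close> by maximality of \<open>E\<close>.\<close>

lemma onb_has_sum_norm:
  fixes y :: "'a::chilbert_space"
  assumes E: "is_onb E"
  shows "((\<lambda>b. (cmod (cinner b y))\<^sup>2) has_sum (norm y)\<^sup>2) E"
proof -
  define f where "f = (\<lambda>b. (cmod (cinner b y))\<^sup>2)"
  have bessel: "sum f F \<le> (norm y)\<^sup>2" if "finite F" "F \<subseteq> E" for F
    unfolding f_def using onb_partial_sum(3)[OF E that, of y]
      zero_le_power2[of "norm (y - (\<Sum>b\<in>F. cinner b y *\<^sub>C b))"] by linarith
  have f0: "f b \<ge> 0" for b by (simp add: f_def)
  have "f summable_on E"
    by (rule nonneg_bdd_above_summable_on) (auto simp: f0 intro!: bdd_aboveI[where M="(norm y)\<^sup>2"] bessel)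
  define S where "S = infsum f E"
  have hs: "(f has_sum S) E" unfolding S_def using \<open>f summable_on E\<close> by (rule has_sum_infsum)
  have le_S: "sum f F \<le> S" if "finite F" "F \<subseteq> E" for F
    unfolding S_def by (rule finite_sum_le_infsum) (use that f0 \<open>f summable_on E\<close> in auto)
  have "\<exists>F. finite F \<and> F \<subseteq> E \<and> S - sum f F < 1 / real (Suc n)" for n
  proof -
    have "eventually (\<lambda>F. dist (sum f F) S < 1 / real (Suc n)) (finite_subsets_at_top E)"
      using hs unfolding has_sum_def by (rule tendstoD) simp
    then obtain F where "finite F" "F \<subseteq> E" "dist (sum f F) S < 1 / real (Suc n)"
      unfolding eventually_finite_subsets_at_top by blast
    then show ?thesis using le_S[of F] by (auto simp: dist_real_def intro!: exI[of _ F])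
  qed
  then obtain F where F: "\<And>n. finite (F n)" "\<And>n. F n \<subseteq> E" "\<And>n. S - sum f (F n) < 1 / real (Suc n)"
    by metis
  define s where "s G = (\<Sum>b\<in>G. cinner b y *\<^sub>C b)" for G
  have step: "(norm (s H - s G))\<^sup>2 \<le> S - sum f G" if "finite H" "G \<subseteq> H" "H \<subseteq> E" for G H
  proof -
    have "s H - s G = s (H - G)" unfolding s_def using that by (simp add: sum_diff)
    moreover have "(norm (s (H - G)))\<^sup>2 = sum f (H - G)"
      unfolding s_def f_def using that by (subst onb_partial_sum(1)[OF E]) auto
    moreover have "sum f (H - G) = sum f H - sum f G" using that by (simp add: sum_diff)
    ultimately show ?thesis using le_S[of H] that by auto
  qed
  have near: "norm (s (F m) - s (F n)) \<le> sqrt (1 / real (Suc m)) + sqrt (1 / real (Suc n))" for m n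
  proof -
    have 1: "norm (s (F m \<union> F n) - s (F k)) \<le> sqrt (1 / real (Suc k))" if "k \<in> {m, n}" for k
    proof (rule real_le_rsqrt)
      have "(norm (s (F m \<union> F n) - s (F k)))\<^sup>2 \<le> S - sum f (F k)"
        using F that by (intro step) auto
      then show "(norm (s (F m \<union> F n) - s (F k)))\<^sup>2 \<le> 1 / real (Suc k)"
        using F(3)[of k] by linarith
    qed
    have "norm (s (F m) - s (F n)) \<le> norm (s (F m \<union> F n) - s (F m)) + norm (s (F m \<union> F n) - s (F n))"
      using norm_triangle_ineq4[of "s (F m \<union> F n) - s (F n)" "s (F m \<union> F n) - s (F m)"] by simp
    then show ?thesis using 1[of m] 1[of n] by simp
  qed
  have lim0: "(\<lambda>n. sqrt (1 / real (Suc n))) \<longlonglongrightarrow> 0"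
    using tendsto_real_sqrt[OF LIMSEQ_inverse_real_of_nat] by (simp add: inverse_eq_divide)
  have "Cauchy (\<lambda>n. s (F n))"
  proof (rule metric_CauchyI)
    fix e :: real assume "e > 0"
    from LIMSEQ_D[OF lim0, of "e/2"] \<open>e > 0\<close> obtain N
      where N: "\<And>n. n \<ge> N \<Longrightarrow> norm (sqrt (1 / real (Suc n)) - 0) < e / 2" by auto
    show "\<exists>M. \<forall>m\<ge>M. \<forall>n\<ge>M. dist (s (F m)) (s (F n)) < e"
    proof (intro exI allI impI)
      fix m n assume "m \<ge> N" "n \<ge> N"
      then show "dist (s (F m)) (s (F n)) < e"
        using near[of m n] N[of m] N[of n] by (simp add: dist_norm del: of_nat_Suc)
    qed
  qed
  then obtain z where z: "(\<lambda>n. s (F n)) \<longlonglongrightarrow> z" using Cauchy_convergent convergent_def by blast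
  have "cinner b (y - z) = 0" if b: "b \<in> E" for b
  proof -
    have "(\<lambda>n. cinner b (y - s (F n))) \<longlonglongrightarrow> cinner b (y - z)"
      by (intro bounded_linear.tendsto[OF bounded_linear_cinner_right] tendsto_intros z)
    moreover have "(\<lambda>n. cinner b (y - s (F n))) \<longlonglongrightarrow> 0"
    proof (rule Lim_null_comparison[OF _ lim0], rule always_eventually, rule allI)
      fix n
      show "norm (cinner b (y - s (F n))) \<le> sqrt (1 / real (Suc n))"
      proof (rule real_le_rsqrt, cases "b \<in> F n")
        case True
        then have "cinner b (y - s (F n)) = 0"
          unfolding s_def using onb_partial_sum(2)[OF E F(1,2) b] by (simp add: cinner_diff_right)
        then show "(norm (cinner b (y - s (F n))))\<^sup>2 \<le> 1 / real (Suc n)" by simp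
      next
        case False
        then have "cinner b (y - s (F n)) = cinner b y"
          unfolding s_def using onb_partial_sum(2)[OF E F(1,2) b] by (simp add: cinner_diff_right)
        moreover have "f b + sum f (F n) \<le> S"
          using le_S[of "insert b (F n)"] False F(1,2) b by auto
        ultimately show "(norm (cinner b (y - s (F n))))\<^sup>2 \<le> 1 / real (Suc n)"
          using F(3)[of n] unfolding f_def by simp
      qed
    qed
    ultimately show ?thesis by (rule LIMSEQ_unique)
  qed
  then have "y - z = 0" using E unfolding is_onb_def by blast
  then have "(\<lambda>n. (norm (y - s (F n)))\<^sup>2) \<longlonglongrightarrow> (norm (y - y))\<^sup>2"
    using z by (intro tendsto_intros) simp
  then have *: "(\<lambda>n. (norm y)\<^sup>2 - sum f (F n)) \<longlonglongrightarrow> 0"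
    unfolding s_def f_def using onb_partial_sum(3)[OF E F(1,2)] by simp
  have "(norm y)\<^sup>2 - S \<le> 0"
    by (rule LIMSEQ_le_const[OF *]) (use le_S F in auto)
  moreover have "S \<le> (norm y)\<^sup>2"
    unfolding S_def by (rule infsum_le_finite_sums[OF \<open>f summable_on E\<close>]) (use bessel in auto)
  ultimately show ?thesis using hs unfolding f_def by simp
qed

lemma onb_has_sum_cinner:
  fixes x y :: "'a::chilbert_space"
  assumes E: "is_onb E"
  shows "((\<lambda>b. cinner x b * cinner b y) has_sum cinner x y) E"
proof -
  have "((\<lambda>F. (norm y)\<^sup>2 - (\<Sum>b\<in>F. (cmod (cinner b y))\<^sup>2)) \<longlongrightarrow> (norm y)\<^sup>2 - (norm y)\<^sup>2) (finite_subsets_at_top E)"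
    using onb_has_sum_norm[OF E, of y] unfolding has_sum_def by (intro tendsto_intros)
  then have "((\<lambda>F. sqrt ((norm y)\<^sup>2 - (\<Sum>b\<in>F. (cmod (cinner b y))\<^sup>2))) \<longlongrightarrow> 0) (finite_subsets_at_top E)"
    using tendsto_real_sqrt by fastforce
  moreover have "eventually (\<lambda>F. sqrt ((norm y)\<^sup>2 - (\<Sum>b\<in>F. (cmod (cinner b y))\<^sup>2))
      = norm ((\<Sum>b\<in>F. cinner b y *\<^sub>C b) - y)) (finite_subsets_at_top E)"
  proof (rule eventually_finite_subsets_at_top_weakI)
    fix F assume "finite F" "F \<subseteq> E"
    from onb_partial_sum(3)[OF E this, of y]
    show "sqrt ((norm y)\<^sup>2 - (\<Sum>b\<in>F. (cmod (cinner b y))\<^sup>2)) = norm ((\<Sum>b\<in>F. cinner b y *\<^sub>C b) - y)"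
      by (subst norm_minus_commute) (metis abs_norm_cancel real_sqrt_abs)
  qed
  ultimately have "((\<lambda>F. norm ((\<Sum>b\<in>F. cinner b y *\<^sub>C b) - y)) \<longlongrightarrow> 0) (finite_subsets_at_top E)"
    by (rule Lim_transform_eventually)
  then have "((\<lambda>b. cinner b y *\<^sub>C b) has_sum y) E"
    unfolding has_sum_def by (simp add: tendsto_norm_zero_iff LIM_zero_iff)
  from has_sum_bounded_linear[OF bounded_linear_cinner_right[of x] this]
  show ?thesis by (simp add: o_def cinner_scaleC_right mult.commute)
qed


section \<open>Operators of rank at most two and bases of projections\<close>

lemma op_of_selfadjoint: "cinner (op_of X x) y = cinner x (op_of X y)"
  using op_of[of X] by (simp add: selfadjoint_def)

lemma op_of_scaleC: "op_of X (c *\<^sub>C x) = c *\<^sub>C op_of X x"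
  using op_of[of X] by (simp add: selfadjoint_def BH_def)

lemma op_of_sum: "op_of (\<Sum>i\<in>I. f i) = (\<Sum>i\<in>I. op_of (f i))"
  by (induction I rule: infinite_finite_induct) (simp_all add: zero_sa_hs.rep_eq plus_sa_hs.rep_eq)

definition ketbra :: "'a::complex_inner \<Rightarrow> 'a \<Rightarrow> 'a \<Rightarrow>\<^sub>L 'a" where
  "ketbra u v = Blinfun (\<lambda>x. cinner v x *\<^sub>C u)"

lemma ketbra_apply: "ketbra u v x = cinner v x *\<^sub>C u"
proof -
  have "norm (cinner v x *\<^sub>C u) \<le> norm x * (norm u * norm v)" for x
    using mult_right_mono[OF cinner_Cauchy_Schwarz[of v x], of "norm u"]
    by (simp add: norm_scaleC mult_ac)
  then have "bounded_linear (\<lambda>x. cinner v x *\<^sub>C u)"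
    by (intro bounded_linear_intro)
       (auto simp: cinner_simps scaleR_scaleC scaleC_scaleC scaleC_add_left)
  then show ?thesis by (simp add: ketbra_def bounded_linear_Blinfun_apply)
qed

lemma ketbra_BH: "ketbra u v \<in> BH"
  by (simp add: BH_def ketbra_apply cinner_simps scaleC_scaleC)

lemma hilbert_schmidt_ketbra: "hilbert_schmidt (ketbra u (v::'a::chilbert_space))"
proof -
  have "(\<lambda>b. (norm u)\<^sup>2 * (cmod (cinner b v))\<^sup>2) summable_on onb"
    using onb_has_sum_norm[OF is_onb_onb, of v] by (intro summable_on_cmult_right has_sum_imp_summable)
  moreover have "cmod (cinner b v) = cmod (cinner v b)" for b
    by (metis cinner_commute complex_mod_cnj)
  ultimately show ?thesis
    by (simp add: hilbert_schmidt_def ketbra_apply norm_scaleC power_mult_distrib mult.commute)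
qed

text \<open>The self-adjoint operator $|u\rangle\langle v| + |v\rangle\langle u|$. Pairing with it in the
  Hilbert--Schmidt inner product reads off a matrix element, which turns Cauchy--Schwarz for
  operators into bounds for matrix elements.\<close>

definition symop :: "'a::complex_inner \<Rightarrow> 'a \<Rightarrow> 'a sa_hs" where
  "symop u v = Abs_sa_hs (ketbra u v + ketbra v u)"

lemma op_of_symop:
  fixes u v :: "'a::chilbert_space"
  shows "op_of (symop u v) = ketbra u v + ketbra v u"
proof -
  have "selfadjoint (ketbra u v + ketbra v u)"
  proof -
    have "cinner (ketbra u v x + ketbra v u x) y = cinner x (ketbra u v y + ketbra v u y)" for x y
      using cinner_commute[of x u] cinner_commute[of x v] by (simp add: ketbra_apply cinner_simps)
    moreover have "ketbra u v + ketbra v u \<in> BH"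
      using ketbra_BH[of u v] ketbra_BH[of v u] by (simp add: BH_def blinfun.add_left scaleC_add_right)
    ultimately show ?thesis by (simp add: selfadjoint_def blinfun.add_left)
  qed
  then show ?thesis
    unfolding symop_def by (subst Abs_sa_hs_inverse) (auto simp: hilbert_schmidt_add hilbert_schmidt_ketbra)
qed

lemma symop_apply:
  "op_of (symop u v) x = cinner v x *\<^sub>C u + cinner u x *\<^sub>C (v::'a::chilbert_space)"
  by (simp add: op_of_symop blinfun.add_left ketbra_apply)

lemma inner_symop:
  fixes u v :: "'a::chilbert_space"
  shows "inner X (symop u v) = 2 * Re (cinner u (op_of X v))"
proof -
  have s: "((\<lambda>b. cinner y b * cinner b (op_of X x)) has_sum cinner y (op_of X x)) onb" for x y
    by (rule onb_has_sum_cinner[OF is_onb_onb])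
  have "((\<lambda>b. cinner (op_of X b) (op_of (symop u v) b)) has_sum
      (cinner v (op_of X u) + cinner u (op_of X v))) onb"
    using has_sum_add[OF s[of v u] s[of u v]]
    by (simp add: symop_apply cinner_simps op_of_selfadjoint)
  then have "inner X (symop u v) = Re (cinner v (op_of X u) + cinner u (op_of X v))"
    using op_of[of X] by (simp add: inner_sa_hs_def op_trace_mult_selfadjoint infsumI)
  moreover have "Re (cinner v (op_of X u)) = Re (cinner u (op_of X v))"
    by (subst cinner_commute) (simp add: op_of_selfadjoint)
  ultimately show ?thesis by simp
qed

text \<open>For a unit vector this is the orthogonal projection onto its line.\<close>

definition line_proj :: "'a::complex_inner \<Rightarrow> 'a sa_hs" where
  "line_proj e = (1/2) *\<^sub>R symop e e"

lemma line_proj_apply: "op_of (line_proj e) x = cinner e x *\<^sub>C (e::'a::chilbert_space)"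
proof -
  have "op_of (line_proj e) x = ((1/2) + (1/2)) *\<^sub>R (cinner e x *\<^sub>C e)"
    unfolding line_proj_def scaleR_sa_hs.rep_eq blinfun.scaleR_left symop_apply
    by (simp only: scaleR_add_right scaleR_add_left)
  then show ?thesis by simp
qed

lemma inner_line_proj: "inner X (line_proj e) = Re (cinner e (op_of X (e::'a::chilbert_space)))"
  by (simp add: line_proj_def inner_symop)

lemma inner_line_proj_line_proj:
  "inner (line_proj e) (line_proj f) = (cmod (cinner e (f::'a::chilbert_space)))\<^sup>2"
proof -
  have "cinner f e = cnj (cinner e f)" by (rule cinner_commute)
  then show ?thesis
    unfolding cmod_power2
    by (simp add: inner_line_proj line_proj_apply cinner_simps power2_eq_square)
qed

lemma line_proj_scaleC: "cmod c = 1 \<Longrightarrow> line_proj (c *\<^sub>C e) = line_proj (e::'a::chilbert_space)"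
proof -
  assume "cmod c = 1"
  then have "cnj c * c = 1" by (metis complex_norm_square mult.commute of_real_1 one_power2)
  then have "op_of (line_proj (c *\<^sub>C e)) x = op_of (line_proj e) x" for x
    by (simp add: line_proj_apply cinner_simps scaleC_scaleC mult.commute mult.left_commute[of c])
  then have "op_of (line_proj (c *\<^sub>C e)) = op_of (line_proj e)" by (rule blinfun_eqI)
  then show ?thesis by (simp only: op_of_inject)
qed

subsection \<open>Orthonormal bases of finite rank projections\<close>

definition orthonormal :: "nat \<Rightarrow> (nat \<Rightarrow> 'a::complex_inner) \<Rightarrow> bool" where
  "orthonormal r e \<longleftrightarrow> (\<forall>i<r. \<forall>j<r. cinner (e i) (e j) = (if i = j then 1 else 0))"

text \<open>Only the first \<open>rk P\<close> values of a basis matter. By \<open>orthonormal_le_rk\<close> and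
  \<open>maximal_orthonormal_expansion\<close> such a family spans the range of \<open>P\<close>.\<close>

definition proj_basis :: "'a::complex_inner sa_hs \<Rightarrow> (nat \<Rightarrow> 'a) set" where
  "proj_basis P = {e. orthonormal (rk P) e \<and> (\<forall>k<rk P. op_of P (e k) = e k)}"

lemma orthonormal_norm: "orthonormal r e \<Longrightarrow> k < r \<Longrightarrow> norm (e k) = 1"
  by (auto simp: orthonormal_def norm_eq_sqrt_cinner)

lemma orthonormal_inj: "orthonormal r e \<Longrightarrow> inj_on e {..<r}"
  by (rule inj_onI) (auto simp: orthonormal_def split: if_splits dest: spec, metis zero_neq_one)

lemma orthonormal_independent:
  assumes "orthonormal r e"
  shows "complex_vector.independent (e ` {..<r})"
proof (rule complex_vector.independent_if_scalars_zero)
  fix c x assume 0: "(\<Sum>x\<in>e ` {..<r}. c x *\<^sub>C x) = 0" and "x \<in> e ` {..<r}"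
  then obtain k where k: "k < r" "x = e k" by auto
  have "0 = cinner (e k) (\<Sum>i<r. c (e i) *\<^sub>C e i)"
    using 0 orthonormal_inj[OF assms] by (simp add: sum.reindex)
  also have "\<dots> = (\<Sum>i<r. if i = k then c (e i) else 0)"
    unfolding cinner_simps using assms k by (intro sum.cong) (auto simp: orthonormal_def)
  finally show "c x = 0" using k by (simp add: sum.delta)
qed simp

lemma Pc_idem: "P \<in> Pc \<Longrightarrow> op_of P (op_of P x) = op_of P x"
  unfolding Pc_def by (simp flip: blinfun_apply_blinfun_compose)

lemma orthonormal_le_rk:
  assumes P: "P \<in> Pc" and "orthonormal r e" "\<forall>k<r. op_of P (e k) = e k"
  shows "r \<le> rk P"
proof -
  obtain B where B: "finite B" "range (op_of P) = complex_vector.span B"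
    using P unfolding Pc_def by blast
  obtain C where C: "C \<subseteq> range (op_of P)" "complex_vector.independent C"
    "range (op_of P) \<subseteq> complex_vector.span C" "card C = rk P"
    using complex_vector.basis_exists[of "range (op_of P)"] unfolding rk_def by blast
  have "finite C"
    using complex_vector.independent_span_bound[OF B(1) C(2)] C(1) B(2) by simp
  have "e ` {..<r} \<subseteq> complex_vector.span C"
  proof
    fix x assume "x \<in> e ` {..<r}"
    then have "x \<in> range (op_of P)" using assms(3) by (metis imageE lessThan_iff rangeI)
    then show "x \<in> complex_vector.span C" using C(3) by blast
  qed
  from complex_vector.independent_span_bound[OF \<open>finite C\<close> orthonormal_independent[OF assms(2)] this]
  show ?thesis using C(4) card_image[OF orthonormal_inj[OF assms(2)]] by simp
qed

text \<open>An orthonormal family in the range of \<open>P\<close> that cannot be enlarged there spans the range,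
  since \<open>P x\<close> minus its expansion in the family could be normalised and added.\<close>

lemma maximal_orthonormal_expansion:
  fixes P :: "'a::chilbert_space sa_hs"
  assumes P: "P \<in> Pc" and on: "orthonormal r e" and fix_e: "\<forall>k<r. op_of P (e k) = e k"
    and max: "\<And>f. orthonormal (Suc r) f \<Longrightarrow> \<not> (\<forall>k<Suc r. op_of P (f k) = f k)"
  shows "op_of P x = (\<Sum>k<r. cinner (e k) x *\<^sub>C e k)"
proof (rule ccontr)
  define y where "y = op_of P x - (\<Sum>k<r. cinner (e k) x *\<^sub>C e k)"
  assume "op_of P x \<noteq> (\<Sum>k<r. cinner (e k) x *\<^sub>C e k)"
  then have "y \<noteq> 0" by (simp add: y_def)
  have Py: "op_of P y = y"
    unfolding y_def using fix_e by (simp add: blinfun.diff_right blinfun.sum_right Pc_idem[OF P] op_of_scaleC)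
  have ort: "cinner (e k) y = 0" if "k < r" for k
  proof -
    have "cinner (e k) (\<Sum>i<r. cinner (e i) x *\<^sub>C e i) = (\<Sum>i<r. if i = k then cinner (e i) x else 0)"
      unfolding cinner_simps using on that by (intro sum.cong) (auto simp: orthonormal_def)
    moreover have "cinner (e k) (op_of P x) = cinner (e k) x"
      using fix_e that by (metis op_of_selfadjoint)
    ultimately show ?thesis using that by (simp add: y_def cinner_diff_right sum.delta)
  qed
  define u where "u = (1 / norm y) *\<^sub>R y"
  have u: "op_of P u = u" "cinner u u = 1" "k < r \<Longrightarrow> cinner (e k) u = 0" "k < r \<Longrightarrow> cinner u (e k) = 0" for k
    using \<open>y \<noteq> 0\<close> Py ort cinner_zero_commute[of y "e k"]
    by (auto simp: u_def blinfun.scaleR_right cinner_simps cinner_self power2_eq_square)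
  have "orthonormal (Suc r) (e(r := u))"
    using on u by (auto simp: orthonormal_def less_Suc_eq)
  moreover have "\<forall>k<Suc r. op_of P ((e(r := u)) k) = (e(r := u)) k"
    using fix_e u by (auto simp: less_Suc_eq)
  ultimately show False using max by blast
qed

lemma proj_basis_apply:
  fixes P :: "'a::chilbert_space sa_hs"
  assumes "P \<in> Pc" "e \<in> proj_basis P"
  shows "op_of P x = (\<Sum>k<rk P. cinner (e k) x *\<^sub>C e k)"
  by (rule maximal_orthonormal_expansion)
     (use assms orthonormal_le_rk[OF assms(1)] in \<open>fastforce simp: proj_basis_def\<close>)+

lemma proj_basis_sum:
  fixes P :: "'a::chilbert_space sa_hs"
  assumes "P \<in> Pc" "e \<in> proj_basis P"
  shows "P = (\<Sum>k<rk P. line_proj (e k))"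
proof -
  have "op_of P x = op_of (\<Sum>k<rk P. line_proj (e k)) x" for x
    unfolding op_of_sum blinfun.sum_left line_proj_apply by (rule proj_basis_apply[OF assms])
  then have "op_of P = op_of (\<Sum>k<rk P. line_proj (e k))" by (rule blinfun_eqI)
  then show ?thesis by (simp only: op_of_inject)
qed

text \<open>A longest orthonormal family in the range exists because its length is bounded by the rank, and it spans
  the range, so its length is the rank.\<close>

lemma proj_basis_nonempty:
  fixes P :: "'a::chilbert_space sa_hs"
  assumes P: "P \<in> Pc"
  shows "proj_basis P \<noteq> {}"
proof -
  define Q where "Q r \<longleftrightarrow> (\<exists>e. orthonormal r e \<and> (\<forall>k<r. op_of P (e k) = e k))" for r
  have "Q 0" by (simp add: Q_def orthonormal_def)
  moreover have "Q r \<Longrightarrow> r \<le> rk P" for r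
    unfolding Q_def using orthonormal_le_rk[OF P] by blast
  ultimately obtain r where r: "Q r" "\<And>s. Q s \<Longrightarrow> s \<le> r"
    by (metis GreatestI_nat Greatest_le_nat)
  then obtain e where e: "orthonormal r e" "\<forall>k<r. op_of P (e k) = e k" unfolding Q_def by blast
  have "\<not> (\<forall>k<Suc r. op_of P (f k) = f k)" if "orthonormal (Suc r) f" for f
    using r(2)[of "Suc r"] that unfolding Q_def by auto
  from maximal_orthonormal_expansion[OF P e this]
  have "op_of P x = (\<Sum>k<r. cinner (e k) x *\<^sub>C e k)" for x by simp
  then have "range (op_of P) \<subseteq> complex_vector.span (e ` {..<r})"
    by (auto intro!: complex_vector.span_sum intro: complex_vector.span_scale complex_vector.span_base)
  then have "rk P \<le> card (e ` {..<r})" unfolding rk_def by (rule complex_vector.dim_le_card) simp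
  also have "\<dots> \<le> r" using card_image_le[of "{..<r}" e] by simp
  finally have "r = rk P" using orthonormal_le_rk[OF P e] by simp
  then show ?thesis using e unfolding proj_basis_def by blast
qed

lemma line_proj_Pr1:
  fixes e :: "'a::chilbert_space"
  assumes "norm e = 1"
  shows "line_proj e \<in> Pr 1"
proof -
  have e: "cinner e e = 1" using assms by (simp add: cinner_self)
  have "op_of (line_proj e) o\<^sub>L op_of (line_proj e) = op_of (line_proj e)"
    by (rule blinfun_eqI) (simp add: line_proj_apply cinner_simps e)
  moreover have rg: "range (op_of (line_proj e)) = complex_vector.span {e}"
  proof
    show "range (op_of (line_proj e)) \<subseteq> complex_vector.span {e}"
      by (auto simp: line_proj_apply complex_vector.span_singleton)
    show "complex_vector.span {e} \<subseteq> range (op_of (line_proj e))"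
    proof
      fix x assume "x \<in> complex_vector.span {e}"
      then obtain c where "x = c *\<^sub>C e" by (auto simp: complex_vector.span_singleton)
      then have "x = op_of (line_proj e) x" by (simp add: line_proj_apply cinner_simps e)
      then show "x \<in> range (op_of (line_proj e))" by blast
    qed
  qed
  moreover have "complex_vector.independent {e}" using assms by auto
  then have "rk (line_proj e) = 1"
    unfolding rk_def rg complex_vector.dim_span by (simp add: complex_vector.dim_eq_card_independent)
  ultimately show ?thesis unfolding Pr_def Pc_def by (auto intro!: exI[of _ "{e}"])
qed

lemma Pr_subset_Pc: "P \<in> Pr r \<Longrightarrow> P \<in> Pc" and Pr_rk: "P \<in> Pr r \<Longrightarrow> rk P = r"
  by (simp_all add: Pr_def)

text \<open>$\mathrm{tr}(P) = \mathrm{tr}(P^2)$ is the inner product of \<open>P\<close> with the sum of the lines of a basis, each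
  of which contributes 1.\<close>

lemma trace_Pc:
  fixes P :: "'a::chilbert_space sa_hs"
  assumes P: "P \<in> Pc"
  shows "Re (op_trace (op_of P)) = inner P P" and "inner P P = real (rk P)"
proof -
  show "Re (op_trace (op_of P)) = inner P P"
    using P unfolding inner_sa_hs_def Pc_def by simp
  obtain e where e: "e \<in> proj_basis P" using proj_basis_nonempty[OF P] by blast
  have "inner P P = (\<Sum>k<rk P. inner P (line_proj (e k)))"
    by (subst (2) proj_basis_sum[OF P e]) (rule inner_sum_right)
  also have "\<dots> = (\<Sum>k<rk P. 1)"
    using e by (intro sum.cong) (auto simp: inner_line_proj proj_basis_def orthonormal_def)
  finally show "inner P P = real (rk P)" by simp
qed

lemma rk_eq_0_iff:
  fixes P :: "'a::chilbert_space sa_hs"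
  assumes "P \<in> Pc" shows "rk P = 0 \<longleftrightarrow> P = 0"
  using trace_Pc(2)[OF assms] by auto

text \<open>$\mathrm{tr}(PQ)$ is the sum of the squared overlaps of two bases, so it vanishes only if
  all overlaps do.\<close>

lemma inner_zero_basis_orthogonal:
  fixes P Q :: "'a::chilbert_space sa_hs"
  assumes P: "P \<in> Pc" "e \<in> proj_basis P" and Q: "Q \<in> Pc" "f \<in> proj_basis Q"
    and 0: "inner P Q = 0" and "k < rk P" "l < rk Q"
  shows "cinner (e k) (f l) = 0"
proof -
  have "(\<Sum>k<rk P. \<Sum>l<rk Q. (cmod (cinner (e k) (f l)))\<^sup>2) = inner P Q"
    by (subst (2) proj_basis_sum[OF P], subst (2) proj_basis_sum[OF Q])
       (simp add: inner_sum_left inner_sum_right inner_line_proj_line_proj, rule sum.swap)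
  then have "(\<Sum>k<rk P. \<Sum>l<rk Q. (cmod (cinner (e k) (f l)))\<^sup>2) = 0" using 0 by simp
  then have "\<forall>k<rk P. (\<Sum>l<rk Q. (cmod (cinner (e k) (f l)))\<^sup>2) = 0"
    by (subst (asm) sum_nonneg_eq_0_iff) (auto intro: sum_nonneg)
  then have "(\<Sum>l<rk Q. (cmod (cinner (e k) (f l)))\<^sup>2) = 0" using assms by blast
  then have "\<forall>l<rk Q. (cmod (cinner (e k) (f l)))\<^sup>2 = 0"
    by (subst (asm) sum_nonneg_eq_0_iff) auto
  then show ?thesis using assms by simp
qed

section \<open>Geodesic distance and overlaps of vectors\<close>

definition admissible_curve where
  "admissible_curve P Q \<gamma> \<gamma>' \<longleftrightarrow> \<gamma> ` {0..1::real} \<subseteq> Pc \<and> \<gamma> 0 = P \<and> \<gamma> 1 = Q \<and>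
     continuous_on {0..1} \<gamma>' \<and>
     (\<forall>t\<in>{0..1}. (\<gamma> has_vector_derivative \<gamma>' t) (at t within {0..1}))"

lemma geod_dist_le:
  assumes "admissible_curve P Q \<gamma> \<gamma>'"
  shows "geod_dist P Q \<le> ennreal (integral {0..1} (\<lambda>t. norm (\<gamma>' t)))"
  unfolding geod_dist_def
  by (rule INF_lower2[of "(\<gamma>, \<gamma>')"]) (use assms in \<open>auto simp: admissible_curve_def\<close>)

lemma geod_dist_greatest:
  assumes "\<And>\<gamma> \<gamma>'. admissible_curve P Q \<gamma> \<gamma>' \<Longrightarrow> x \<le> ennreal (integral {0..1} (\<lambda>t. norm (\<gamma>' t)))"
  shows "x \<le> geod_dist P Q"
  unfolding geod_dist_def
  by (rule INF_greatest) (use assms in \<open>auto simp: admissible_curve_def\<close>)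

lemma geod_dist_self: "P \<in> Pc \<Longrightarrow> geod_dist P P = 0"
  using geod_dist_le[of P P "\<lambda>_. P" "\<lambda>_. 0"] by (auto simp: admissible_curve_def)

lemma line_proj_combination:
  fixes e g :: "'a::chilbert_space"
  shows "line_proj (a *\<^sub>R e + b *\<^sub>R g) = a\<^sup>2 *\<^sub>R line_proj e + b\<^sup>2 *\<^sub>R line_proj g + (a * b) *\<^sub>R symop e g"
proof -
  have "op_of (line_proj (a *\<^sub>R e + b *\<^sub>R g)) x
      = op_of (a\<^sup>2 *\<^sub>R line_proj e + b\<^sup>2 *\<^sub>R line_proj g + (a * b) *\<^sub>R symop e g) x" for x
    by (simp add: plus_sa_hs.rep_eq scaleR_sa_hs.rep_eq blinfun.add_left blinfun.scaleR_left
        line_proj_apply symop_apply cinner_simps scaleR_scaleC scaleC_scaleC scaleC_add_left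
        scaleC_add_right power2_eq_square algebra_simps)
  then have "op_of (line_proj (a *\<^sub>R e + b *\<^sub>R g))
      = op_of (a\<^sup>2 *\<^sub>R line_proj e + b\<^sup>2 *\<^sub>R line_proj g + (a * b) *\<^sub>R symop e g)"
    by (rule blinfun_eqI)
  then show ?thesis by (simp only: op_of_inject)
qed

lemma norm_symop_orthogonal:
  fixes u v :: "'a::chilbert_space"
  assumes "cinner u v = 0"
  shows "norm (symop u v) = sqrt 2 * (norm u * norm v)"
proof -
  have "inner (symop u v) (symop u v) = 2 * ((norm u)\<^sup>2 * (norm v)\<^sup>2)"
    using assms by (simp add: inner_symop symop_apply cinner_simps cinner_self)
  then have "(norm (symop u v))\<^sup>2 = (sqrt 2 * (norm u * norm v))\<^sup>2"
    by (simp add: power2_norm_eq_inner power_mult_distrib)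
  then show ?thesis by (rule power2_eq_imp_eq) simp_all
qed

text \<open>For orthonormal \<open>e\<close>, \<open>g\<close> the lines spanned by $\cos(\theta t)e + \sin(\theta t)g$ form a curve of
  constant speed $\sqrt 2\,\theta$.\<close>

lemma geod_dist_rotation_le:
  fixes e g :: "'a::chilbert_space"
  assumes e: "norm e = 1" and g: "norm g = 1" and eg: "cinner e g = 0" and "\<theta> \<ge> 0"
  shows "geod_dist (line_proj e) (line_proj (cos \<theta> *\<^sub>R e + sin \<theta> *\<^sub>R g)) \<le> ennreal (sqrt 2 * \<theta>)"
proof -
  define A where "A = (1/2) *\<^sub>R (line_proj e + line_proj g)"
  define B where "B = (1/2) *\<^sub>R (line_proj e - line_proj g)"
  define C where "C = (1/2) *\<^sub>R symop e g"
  define \<gamma> where "\<gamma> t = A + cos (2 * (\<theta> * t)) *\<^sub>R B + sin (2 * (\<theta> * t)) *\<^sub>R C" for t :: real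
  define \<gamma>' where "\<gamma>' t = (- sin (2 * (\<theta> * t)) * (2 * \<theta>)) *\<^sub>R B + (cos (2 * (\<theta> * t)) * (2 * \<theta>)) *\<^sub>R C" for t :: real
  have ge: "cinner g e = 0" using eg cinner_zero_commute by blast
  have \<gamma>: "\<gamma> t = line_proj (cos (\<theta> * t) *\<^sub>R e + sin (\<theta> * t) *\<^sub>R g)" for t
  proof -
    have c: "(cos (\<theta> * t))\<^sup>2 = 1/2 + cos (2 * (\<theta> * t)) / 2" "(sin (\<theta> * t))\<^sup>2 = 1/2 - cos (2 * (\<theta> * t)) / 2"
      using cos_double_cos[of "\<theta> * t"] cos_double_sin[of "\<theta> * t"] by (linarith, linarith)
    have s: "cos (\<theta> * t) * sin (\<theta> * t) = sin (2 * (\<theta> * t)) / 2" by (simp add: sin_double)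
    show ?thesis
      unfolding line_proj_combination c s \<gamma>_def A_def B_def C_def
      by (simp add: algebra_simps)
  qed
  have "norm (cos (\<theta> * t) *\<^sub>R e + sin (\<theta> * t) *\<^sub>R g) = 1" for t
  proof -
    have "(norm (cos (\<theta> * t) *\<^sub>R e + sin (\<theta> * t) *\<^sub>R g))\<^sup>2 = 1"
      by (subst norm_add_sq_orthogonal) (simp_all add: cinner_simps eg e g)
    then show ?thesis by (simp add: power2_eq_1_iff)
       (metis norm_ge_zero not_one_le_zero neg_0_le_iff_le order.trans zero_le_one abs_norm_cancel abs_minus abs_one)
  qed
  then have "\<gamma> t \<in> Pc" for t using \<gamma> line_proj_Pr1 Pr_subset_Pc by metis
  moreover have "(\<gamma> has_vector_derivative \<gamma>' t) (at t within {0..1})" for t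
  proof -
    have "((\<lambda>t. cos (2 * (\<theta> * t))) has_real_derivative - sin (2 * (\<theta> * t)) * (2 * \<theta>)) (at t within {0..1})"
      "((\<lambda>t. sin (2 * (\<theta> * t))) has_real_derivative cos (2 * (\<theta> * t)) * (2 * \<theta>)) (at t within {0..1})"
      by (auto intro!: derivative_eq_intros)
    then show ?thesis
      unfolding \<gamma>_def \<gamma>'_def
      by (auto intro!: derivative_eq_intros simp: has_real_derivative_iff_has_vector_derivative
          mult.commute[of \<theta> 2])
  qed
  moreover have "continuous_on {0..1} \<gamma>'" unfolding \<gamma>'_def by (intro continuous_intros)
  ultimately have "admissible_curve (line_proj e) (line_proj (cos \<theta> *\<^sub>R e + sin \<theta> *\<^sub>R g)) \<gamma> \<gamma>'"
    unfolding admissible_curve_def using \<gamma>[of 0] \<gamma>[of 1] by auto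
  moreover have "norm (\<gamma>' t) = sqrt 2 * \<theta>" for t
  proof -
    have BB: "inner B B = 1/2"
      by (simp add: B_def inner_diff_left inner_diff_right inner_line_proj_line_proj eg ge e g cinner_self)
    have CC: "inner C C = 1/2" using norm_symop_orthogonal[OF eg] e g
      by (simp add: C_def norm_eq_sqrt_inner)
    have "inner (line_proj e) (symop e g) = 0" "inner (line_proj g) (symop e g) = 0"
      by (simp_all add: inner_symop line_proj_apply cinner_simps eg ge)
    then have BC: "inner B C = 0" "inner C B = 0"
      by (simp_all add: B_def C_def inner_diff_left inner_diff_right inner_commute[of "symop e g"])
    have alg: "(s * (2 * \<theta>))\<^sup>2 * (1/2) + (c * (2 * \<theta>))\<^sup>2 * (1/2) = 2 * \<theta>\<^sup>2 * (s\<^sup>2 + c\<^sup>2)" for s c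
      by (simp add: power2_eq_square algebra_simps)
    have "(norm (\<gamma>' t))\<^sup>2 = (sin (2 * (\<theta> * t)) * (2 * \<theta>))\<^sup>2 * (1/2) + (cos (2 * (\<theta> * t)) * (2 * \<theta>))\<^sup>2 * (1/2)"
      unfolding power2_norm_eq_inner \<gamma>'_def
      by (simp add: inner_add_left inner_add_right inner_diff_left inner_diff_right BB CC BC power2_eq_square)
    also have "\<dots> = 2 * \<theta>\<^sup>2 * ((sin (2 * (\<theta> * t)))\<^sup>2 + (cos (2 * (\<theta> * t)))\<^sup>2)"
      by (rule alg)
    also have "\<dots> = (sqrt 2 * \<theta>)\<^sup>2" by (simp add: power_mult_distrib)
    finally show ?thesis by (rule power2_eq_imp_eq) (use \<open>\<theta> \<ge> 0\<close> in simp_all)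
  qed
  ultimately show ?thesis using geod_dist_le by fastforce
qed

text \<open>If the phase of \<open>f\<close> is chosen such that the overlap with \<open>e\<close> is real, then \<open>f\<close> arises from \<open>e\<close> by a rotation
  in a plane, by the angle \<open>arccos \<bar>\<langle>e, f\<rangle>\<bar>\<close>.\<close>

lemma geod_dist_line_proj_le:
  fixes e f :: "'a::chilbert_space"
  assumes e: "norm e = 1" and f: "norm f = 1"
  shows "geod_dist (line_proj e) (line_proj f) \<le> ennreal (sqrt 2 * arccos (cmod (cinner e f)))"
proof -
  define m where "m = cmod (cinner e f)"
  have m: "0 \<le> m" "m \<le> 1" using cinner_Cauchy_Schwarz[of e f] e f by (simp_all add: m_def)
  define c where "c = (if m = 0 then 1 else cnj (cinner e f) / of_real m)"
  have c: "cmod c = 1" by (simp add: c_def norm_divide m_def)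
  define h where "h = c *\<^sub>C f"
  have h: "norm h = 1" "line_proj h = line_proj f"
    using c f by (simp_all add: h_def norm_scaleC line_proj_scaleC)
  have "cinner e f * cnj (cinner e f) = complex_of_real (m\<^sup>2)"
    unfolding m_def by (rule complex_norm_square[symmetric])
  then have eh: "cinner e h = of_real m"
    unfolding h_def c_def cinner_scaleC_right by (auto simp: m_def power2_eq_square field_simps)
  have he: "cinner h e = of_real m" by (subst cinner_commute) (simp add: eh)
  define y where "y = h - m *\<^sub>R e"
  have ey: "cinner e y = 0" by (simp add: y_def cinner_simps eh cinner_self e)
  have hy: "h = m *\<^sub>R e + y" by (simp add: y_def)
  have "(norm h)\<^sup>2 = m\<^sup>2 + (norm y)\<^sup>2"
    using norm_add_sq_orthogonal[of "m *\<^sub>R e" y] ey e by (simp add: hy cinner_simps)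
  then have ny: "(norm y)\<^sup>2 = 1 - m\<^sup>2" using h by simp
  show ?thesis
  proof (cases "m = 1")
    case True
    then have "line_proj e = line_proj f" using ny hy h by simp
    moreover have "line_proj f \<in> Pc" using line_proj_Pr1[OF f] Pr_subset_Pc by blast
    ultimately show ?thesis by (simp add: geod_dist_self)
  next
    case False
    define s where "s = sin (arccos m)"
    have s: "s = sqrt (1 - m\<^sup>2)" unfolding s_def using m by (intro sin_arccos) auto
    have "m\<^sup>2 < 1" using m False by (simp add: abs_square_less_1)
    then have "s > 0" "norm y = s" using ny s by (auto intro!: real_sqrt_unique[symmetric] simp: s)
    define g where "g = (1 / s) *\<^sub>R y"
    have "norm g = 1" "cinner e g = 0" using \<open>s > 0\<close> \<open>norm y = s\<close> ey by (simp_all add: g_def cinner_simps)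
    from geod_dist_rotation_le[OF e this, of "arccos m"] m
    have "geod_dist (line_proj e) (line_proj (m *\<^sub>R e + s *\<^sub>R g)) \<le> ennreal (sqrt 2 * arccos m)"
      by (simp add: s_def arccos_lbound)
    moreover have "m *\<^sub>R e + s *\<^sub>R g = h" using \<open>s > 0\<close> by (simp add: g_def hy)
    ultimately show ?thesis using h by (simp add: m_def)
  qed
qed

lemma geod_dist_line_proj_le_diameter:
  fixes e f :: "'a::chilbert_space"
  assumes e: "norm e = 1" and f: "norm f = 1"
  shows "geod_dist (line_proj e) (line_proj f) \<le> ennreal (sqrt 2 * (pi / 2))"
proof -
  have "arccos (cmod (cinner e f)) \<le> arccos 0"
    using cinner_Cauchy_Schwarz[of e f] e f by (intro arccos_le_arccos) auto
  then show ?thesis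
    using geod_dist_line_proj_le[OF e f] by (elim order_trans) (simp add: ennreal_leI)
qed

subsection \<open>The overlap of a vector with a moving projection\<close>

lemma projection_quadratic_form:
  fixes P :: "'a::chilbert_space sa_hs"
  assumes P: "P \<in> Pc"
  shows "inner P (line_proj x) = (norm (op_of P x))\<^sup>2"
    and "cinner (op_of P x) (x - op_of P x) = 0"
    and "(norm x)\<^sup>2 = (norm (op_of P x))\<^sup>2 + (norm (x - op_of P x))\<^sup>2"
proof -
  show "inner P (line_proj x) = (norm (op_of P x))\<^sup>2"
    unfolding inner_line_proj Re_cinner_self[symmetric] op_of_selfadjoint[of P x] Pc_idem[OF P] ..
  show *: "cinner (op_of P x) (x - op_of P x) = 0"
    by (simp add: cinner_diff_right op_of_selfadjoint Pc_idem[OF P])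
  show "(norm x)\<^sup>2 = (norm (op_of P x))\<^sup>2 + (norm (x - op_of P x))\<^sup>2"
    using norm_add_sq_orthogonal[OF *] by simp
qed

lemma projection_norm_le:
  fixes P :: "'a::chilbert_space sa_hs"
  assumes P: "P \<in> Pc"
  shows "norm (op_of P x) \<le> norm x"
proof -
  have "(norm (op_of P x))\<^sup>2 \<le> (norm x)\<^sup>2" using projection_quadratic_form(3)[OF P, of x] by simp
  then show ?thesis by (rule power2_le_imp_le) simp
qed

text \<open>The velocity of a curve of projections has no matrix elements between two vectors of the range,
  or two vectors of the kernel: the quadratic forms $\langle u, \gamma(s) u\rangle$ and
  $\langle v, \gamma(s) v\rangle$ are extremal at the time considered. So only the off-diagonal part
  contributes to the derivative of $\|\gamma(t)e\|^2$.\<close>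

lemma overlap_derivative_bound:
  fixes \<gamma> :: "real \<Rightarrow> 'a::chilbert_space sa_hs"
  assumes Pc: "\<And>s. s \<in> {0..1} \<Longrightarrow> \<gamma> s \<in> Pc" and t: "0 < t" "t < 1"
    and der: "(\<gamma> has_vector_derivative X) (at t)" and e: "norm e = 1"
  defines "h \<equiv> inner (\<gamma> t) (line_proj e)"
  shows "\<bar>inner X (line_proj e)\<bar> \<le> sqrt 2 * norm X * sqrt (h * (1 - h))"
proof -
  have P: "\<gamma> t \<in> Pc" using Pc t by simp
  define u where "u = op_of (\<gamma> t) e"
  define v where "v = e - u"
  have uv: "cinner u v = 0" "e = u + v" and nu: "(norm u)\<^sup>2 = h" and nv: "(norm v)\<^sup>2 = 1 - h"
    using projection_quadratic_form[OF P, of e] e by (simp_all add: u_def v_def h_def)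
  have Pu: "op_of (\<gamma> t) u = u" by (simp add: u_def Pc_idem[OF P])
  have Pv: "op_of (\<gamma> t) v = 0" by (simp add: v_def blinfun.diff_right Pu) (simp add: u_def)
  have D: "((\<lambda>s. inner (\<gamma> s) (line_proj w)) has_real_derivative inner X (line_proj w)) (at t)" for w
    unfolding has_real_derivative_iff_has_vector_derivative
    by (rule bounded_linear.has_vector_derivative[OF bounded_linear_inner_left der])
  have near: "s \<in> {0..1}" if "\<bar>t - s\<bar> < min t (1 - t)" for s using that by auto
  have d: "0 < min t (1 - t)" using t by simp
  have "inner X (line_proj u) = 0"
  proof (rule DERIV_local_max[OF D d], intro allI impI)
    fix s assume "\<bar>t - s\<bar> < min t (1 - t)"
    then have "\<gamma> s \<in> Pc" by (intro Pc near)
    then show "inner (\<gamma> s) (line_proj u) \<le> inner (\<gamma> t) (line_proj u)"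
      by (simp add: projection_quadratic_form(1) P Pu power_mono projection_norm_le)
  qed
  moreover have "inner X (line_proj v) = 0"
  proof (rule DERIV_local_min[OF D d], intro allI impI)
    fix s assume "\<bar>t - s\<bar> < min t (1 - t)"
    then have "\<gamma> s \<in> Pc" by (intro Pc near)
    then show "inner (\<gamma> t) (line_proj v) \<le> inner (\<gamma> s) (line_proj v)"
      by (simp add: projection_quadratic_form(1) P Pv)
  qed
  moreover have "line_proj e = line_proj u + line_proj v + symop u v"
    using line_proj_combination[of 1 u 1 v] uv(2) by simp
  ultimately have "inner X (line_proj e) = inner X (symop u v)" by (simp add: inner_add_right)
  also have "\<bar>\<dots>\<bar> \<le> norm X * norm (symop u v)" by (rule Cauchy_Schwarz_ineq2)
  also have "\<dots> = sqrt 2 * norm X * (norm u * norm v)" by (simp add: norm_symop_orthogonal uv)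
  also have "norm u * norm v = sqrt (h * (1 - h))"
  proof -
    have "sqrt (h * (1 - h)) = sqrt ((norm u)\<^sup>2 * (norm v)\<^sup>2)" by (simp only: nu nv)
    then show ?thesis by (simp add: real_sqrt_mult)
  qed
  finally show ?thesis .
qed

text \<open>For $y = 2\|\gamma e\|^2 - 1$ the previous bound reads
  $|y'| \le \sqrt 2\,\|\gamma'\|\sqrt{1 - y^2}$, so \<open>arcsin y\<close> changes by at most $\sqrt 2$ times the length
  of the curve. The arcsine is not differentiable where the overlap is 0 or 1, which is the case at an end
  of the curves of interest; a factor \<open>r < 1\<close> keeps away from these points.\<close>

lemma overlap_along_curve_aux:
  fixes \<gamma> :: "real \<Rightarrow> 'a::chilbert_space sa_hs"
  assumes curve: "admissible_curve P Q \<gamma> \<gamma>'" and e: "norm e = 1" and r: "0 \<le> r" "r < 1"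
  shows "\<bar>arcsin (r * (2 * inner Q (line_proj e) - 1)) - arcsin (r * (2 * inner P (line_proj e) - 1))\<bar>
    \<le> sqrt 2 * integral {0..1} (\<lambda>t. norm (\<gamma>' t))"
proof -
  have Pc: "\<gamma> s \<in> Pc" if "s \<in> {0..1}" for s using curve that by (auto simp: admissible_curve_def)
  have ends: "\<gamma> 0 = P" "\<gamma> 1 = Q" and c': "continuous_on {0..1} \<gamma>'"
    and der: "\<And>t. t \<in> {0..1} \<Longrightarrow> (\<gamma> has_vector_derivative \<gamma>' t) (at t within {0..1})"
    using curve by (auto simp: admissible_curve_def)
  define y where "y t = 2 * inner (\<gamma> t) (line_proj e) - 1" for t
  have y: "\<bar>y t\<bar> \<le> 1" if "t \<in> {0..1}" for t
    using projection_quadratic_form(1,3)[OF Pc[OF that], of e] e zero_le_power2[of "norm (e - op_of (\<gamma> t) e)"]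
      zero_le_power2[of "norm (op_of (\<gamma> t) e)"] unfolding y_def abs_le_iff e one_power2 by linarith
  have ry: "\<bar>r * y t\<bar> < 1" if "t \<in> {0..1}" for t
  proof -
    have "\<bar>r * y t\<bar> \<le> r * 1" using y[OF that] r unfolding abs_mult by (intro mult_mono) auto
    then show ?thesis using r by simp
  qed
  define k where "k t = (if t \<in> {0<..<1}
    then r * (2 * inner (\<gamma>' t) (line_proj e)) / sqrt (1 - (r * y t)\<^sup>2) else 0)" for t
  have "continuous_on {0..1} \<gamma>"
    by (rule continuous_on_vector_derivative[OF der])
  then have "continuous_on {0..1} (\<lambda>t. arcsin (r * y t))"
    unfolding y_def using ry
    by (intro continuous_intros) (force simp: y_def abs_le_iff dest: less_imp_le)+
  moreover have "((\<lambda>t. arcsin (r * y t)) has_vector_derivative k t) (at t)" if t: "t \<in> {0<..<1}" for t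
  proof -
    have "(\<gamma> has_vector_derivative \<gamma>' t) (at t)"
      using der[of t] t at_within_Icc_at[of 0 t 1] by simp
    then have "((\<lambda>s. inner (\<gamma> s) (line_proj e)) has_real_derivative inner (\<gamma>' t) (line_proj e)) (at t)"
      unfolding has_real_derivative_iff_has_vector_derivative
      by (rule bounded_linear.has_vector_derivative[OF bounded_linear_inner_left])
    then have "((\<lambda>t. r * y t) has_real_derivative r * (2 * inner (\<gamma>' t) (line_proj e))) (at t)"
      unfolding y_def by (auto intro!: derivative_eq_intros)
    moreover have "-1 < r * y t" "r * y t < 1" using ry[of t] t by (auto simp: abs_less_iff)
    ultimately have "((\<lambda>t. arcsin (r * y t)) has_real_derivative
        inverse (sqrt (1 - (r * y t)\<^sup>2)) * (r * (2 * inner (\<gamma>' t) (line_proj e)))) (at t)"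
      by (intro DERIV_chain2[OF DERIV_arcsin])
    then have "((\<lambda>t. arcsin (r * y t)) has_real_derivative k t) (at t)"
      using t by (simp add: k_def divide_inverse mult.commute)
    then show ?thesis by (simp add: has_real_derivative_iff_has_vector_derivative)
  qed
  ultimately have k: "(k has_integral arcsin (r * y 1) - arcsin (r * y 0)) {0..1}"
    by (intro fundamental_theorem_of_calculus_interior) auto
  have bound: "norm (k t) \<le> sqrt 2 * norm (\<gamma>' t)" if t: "t \<in> {0..1}" for t
  proof (cases "t \<in> {0<..<1}")
    case True
    define h where "h = inner (\<gamma> t) (line_proj e)"
    have "(\<gamma> has_vector_derivative \<gamma>' t) (at t)"
      using der[of t] True at_within_Icc_at[of 0 t 1] by simp
    then have "\<bar>inner (\<gamma>' t) (line_proj e)\<bar> \<le> sqrt 2 * norm (\<gamma>' t) * sqrt (h * (1 - h))"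
      unfolding h_def using True Pc e by (intro overlap_derivative_bound) auto
    then have "\<bar>2 * inner (\<gamma>' t) (line_proj e)\<bar> \<le> sqrt 2 * norm (\<gamma>' t) * (2 * sqrt (h * (1 - h)))" by simp
    also have "2 * sqrt (h * (1 - h)) = sqrt (4 * (h * (1 - h)))" by (simp add: real_sqrt_mult)
    also have "4 * (h * (1 - h)) = 1 - (y t)\<^sup>2"
      by (simp add: y_def h_def power2_eq_square algebra_simps)
    finally have D: "\<bar>2 * inner (\<gamma>' t) (line_proj e)\<bar> \<le> sqrt 2 * norm (\<gamma>' t) * sqrt (1 - (y t)\<^sup>2)" .
    have "r\<^sup>2 * (y t)\<^sup>2 \<le> 1 * (y t)\<^sup>2" using r by (intro mult_right_mono) (auto simp: abs_square_le_1)
    then have "sqrt (1 - (y t)\<^sup>2) \<le> sqrt (1 - (r * y t)\<^sup>2)" by (simp add: power_mult_distrib)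
    with D have "\<bar>2 * inner (\<gamma>' t) (line_proj e)\<bar> \<le> sqrt 2 * norm (\<gamma>' t) * sqrt (1 - (r * y t)\<^sup>2)"
      by (elim order_trans) (intro mult_left_mono, auto)
    then have "r * \<bar>2 * inner (\<gamma>' t) (line_proj e)\<bar> \<le> 1 * (sqrt 2 * norm (\<gamma>' t) * sqrt (1 - (r * y t)\<^sup>2))"
      using r by (intro mult_mono) auto
    moreover have "sqrt (1 - (r * y t)\<^sup>2) > 0" using ry[OF t] by (simp add: abs_square_less_1)
    ultimately show ?thesis using True r by (simp add: k_def abs_mult pos_divide_le_eq)
  next
    case False
    then show ?thesis by (simp only: k_def if_False norm_zero) simp
  qed
  have "norm (integral {0..1} k) \<le> integral {0..1} (\<lambda>t. sqrt 2 * norm (\<gamma>' t))"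
  proof (rule integral_norm_bound_integral)
    show "k integrable_on {0..1}" using k by blast
    show "(\<lambda>t. sqrt 2 * norm (\<gamma>' t)) integrable_on {0..1}"
      by (intro integrable_continuous_real continuous_intros c')
  qed (rule bound)
  then show ?thesis using k by (simp add: integral_unique y_def ends)
qed

lemma overlap_along_curve:
  fixes \<gamma> :: "real \<Rightarrow> 'a::chilbert_space sa_hs"
  assumes curve: "admissible_curve P Q \<gamma> \<gamma>'" and e: "norm e = 1"
  shows "\<bar>arcsin (2 * inner Q (line_proj e) - 1) - arcsin (2 * inner P (line_proj e) - 1)\<bar>
    \<le> sqrt 2 * integral {0..1} (\<lambda>t. norm (\<gamma>' t))"
proof -
  have "P \<in> Pc" "Q \<in> Pc" using curve by (auto simp: admissible_curve_def)
  have y: "\<bar>2 * inner R (line_proj e) - 1\<bar> \<le> 1" if "R \<in> Pc" for R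
    using projection_quadratic_form(1,3)[OF that, of e] e zero_le_power2[of "norm (e - op_of R e)"]
      zero_le_power2[of "norm (op_of R e)"] unfolding abs_le_iff e one_power2 by linarith
  define r where "r n = 1 - 1 / real (Suc n)" for n
  have r: "0 \<le> r n" "r n < 1" for n by (simp_all add: r_def)
  have "r \<longlonglongrightarrow> 1 - 0"
    unfolding r_def using LIMSEQ_inverse_real_of_nat by (intro tendsto_intros) (simp add: inverse_eq_divide)
  then have lim: "(\<lambda>n. arcsin (r n * x)) \<longlonglongrightarrow> arcsin x" if "\<bar>x\<bar> \<le> 1" for x
  proof -
    have "(\<lambda>n. r n * x) \<longlonglongrightarrow> 1 * x" using \<open>r \<longlonglongrightarrow> 1 - 0\<close> by (intro tendsto_intros) simp
    moreover have "r n * x \<in> {-1..1}" for n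
    proof -
      have "\<bar>r n * x\<bar> \<le> 1 * 1" unfolding abs_mult using r[of n] that by (intro mult_mono) auto
      then show ?thesis by (auto simp: abs_le_iff)
    qed
    ultimately show ?thesis
      using that continuous_on_tendsto_compose[OF continuous_on_arcsin', of "\<lambda>n. r n * x" x sequentially]
      by (auto simp: abs_le_iff)
  qed
  show ?thesis
  proof (rule LIMSEQ_le_const2)
    show "(\<lambda>n. \<bar>arcsin (r n * (2 * inner Q (line_proj e) - 1)) - arcsin (r n * (2 * inner P (line_proj e) - 1))\<bar>)
      \<longlonglongrightarrow> \<bar>arcsin (2 * inner Q (line_proj e) - 1) - arcsin (2 * inner P (line_proj e) - 1)\<bar>"
      by (intro tendsto_rabs tendsto_diff lim y \<open>P \<in> Pc\<close> \<open>Q \<in> Pc\<close>)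
  qed (use overlap_along_curve_aux[OF curve e r] in blast)
qed

text \<open>If the overlap $\|Re\|$ is $\cos\varphi$, then $2\|Re\|^2 - 1 = \cos 2\varphi$, whose arcsine is
  $\pi/2 - 2\varphi$.\<close>

lemma arccos_le_geod_dist:
  fixes P Q :: "'a::chilbert_space sa_hs"
  assumes e: "norm e = 1" and PQ: "P \<in> Pc" "Q \<in> Pc"
  shows "op_of P e = e \<Longrightarrow> ennreal (sqrt 2 * arccos (norm (op_of Q e))) \<le> geod_dist P Q"
    and "op_of Q e = e \<Longrightarrow> ennreal (sqrt 2 * arccos (norm (op_of P e))) \<le> geod_dist P Q"
proof -
  have half: "2 * arccos (norm (op_of R e)) = arcsin 1 - arcsin (2 * inner R (line_proj e) - 1)"
    if "R \<in> Pc" for R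
  proof -
    define \<phi> where "\<phi> = arccos (norm (op_of R e))"
    have le: "norm (op_of R e) \<le> 1" "-1 \<le> norm (op_of R e)"
      using projection_norm_le[OF that, of e] e by (simp_all add: order_trans[of _ 0])
    then have c: "cos \<phi> = norm (op_of R e)" unfolding \<phi>_def by (intro cos_arccos)
    have "arccos (norm (op_of R e)) \<le> arccos 0" using le by (intro arccos_le_arccos) auto
    then have \<phi>: "0 \<le> \<phi>" "\<phi> \<le> pi / 2"
      using le arccos_lbound[of "norm (op_of R e)"] by (auto simp: \<phi>_def)
    have y: "2 * inner R (line_proj e) - 1 = cos (2 * \<phi>)"
      by (simp add: projection_quadratic_form(1)[OF that] cos_double_cos c)
    have "arcsin (cos (2 * \<phi>)) = arcsin (sin (pi / 2 - 2 * \<phi>))" by (simp add: cos_sin_eq)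
    also have "\<dots> = pi / 2 - 2 * \<phi>" using \<phi> by (intro arcsin_sin) auto
    finally show ?thesis by (simp add: y \<phi>_def)
  qed
  have one: "2 * inner R (line_proj e) - 1 = 1" if "R \<in> Pc" "op_of R e = e" for R
    using projection_quadratic_form(1)[OF that(1), of e] that(2) e by simp
  have "sqrt 2 * a \<le> L" if "2 * a \<le> sqrt 2 * L" for a L :: real
  proof -
    have "sqrt 2 * (sqrt 2 * a) \<le> sqrt 2 * L" using that by (simp flip: mult.assoc)
    then show ?thesis by (subst (asm) mult_le_cancel_left_pos) auto
  qed
  note scale = this
  show "ennreal (sqrt 2 * arccos (norm (op_of Q e))) \<le> geod_dist P Q" if "op_of P e = e"
  proof (rule geod_dist_greatest, rule ennreal_leI, rule scale)
    fix \<gamma> \<gamma>' assume "admissible_curve P Q \<gamma> \<gamma>'"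
    from overlap_along_curve[OF this e]
    show "2 * arccos (norm (op_of Q e)) \<le> sqrt 2 * integral {0..1} (\<lambda>t. norm (\<gamma>' t))"
      unfolding one[OF PQ(1) that] half[OF PQ(2)] by linarith
  qed
  show "ennreal (sqrt 2 * arccos (norm (op_of P e))) \<le> geod_dist P Q" if "op_of Q e = e"
  proof (rule geod_dist_greatest, rule ennreal_leI, rule scale)
    fix \<gamma> \<gamma>' assume "admissible_curve P Q \<gamma> \<gamma>'"
    from overlap_along_curve[OF this e]
    show "2 * arccos (norm (op_of P e)) \<le> sqrt 2 * integral {0..1} (\<lambda>t. norm (\<gamma>' t))"
      unfolding one[OF PQ(2) that] half[OF PQ(1)] by linarith
  qed
qed

subsection \<open>Aligned bases\<close>

text \<open>Gram--Schmidt applied to the vectors $Qe_k$. The new vector with index \<open>n\<close> is $Qx/\|Qx\|$ for a vector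
  \<open>x\<close> of the range of \<open>P\<close> with $x - e_n$ orthogonal to $e_n$, and its overlap with $e_n$ is
  $\|Qx\| \ge c\|x\| \ge c$: orthogonalisation does not spoil the lower bound. The vector $z_k$ is mapped to
  $f_k$ by \<open>Q\<close>; it is orthogonal to the $e_m$ that are still to come.\<close>

lemma Gram_Schmidt_overlap:
  fixes P Q :: "'a::chilbert_space sa_hs"
  assumes Q: "Q \<in> Pc" and e: "orthonormal r e" "\<And>k. k < r \<Longrightarrow> op_of P (e k) = e k"
    and c: "c > 0" "\<And>x. op_of P x = x \<Longrightarrow> c * norm x \<le> norm (op_of Q x)"
  shows "n \<le> r \<Longrightarrow> \<exists>f z. orthonormal n f \<and> (\<forall>k<n. f k = op_of Q (z k) \<and> op_of P (z k) = z k
    \<and> (\<forall>m<r. k < m \<longrightarrow> cinner (e m) (z k) = 0) \<and> c \<le> cmod (cinner (e k) (f k)))"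
proof (induction n)
  case 0
  then show ?case by (simp add: orthonormal_def)
next
  case (Suc n)
  then obtain f z where f: "orthonormal n f"
    and fz: "\<And>k. k < n \<Longrightarrow> f k = op_of Q (z k)" "\<And>k. k < n \<Longrightarrow> op_of P (z k) = z k"
      "\<And>k m. k < n \<Longrightarrow> m < r \<Longrightarrow> k < m \<Longrightarrow> cinner (e m) (z k) = 0"
      "\<And>k. k < n \<Longrightarrow> c \<le> cmod (cinner (e k) (f k))"
    by (metis Suc_leD)
  have n: "n < r" using Suc.prems by simp
  define x where "x = e n - (\<Sum>k<n. cinner (f k) (e n) *\<^sub>C z k)"
  have Px: "op_of P x = x"
    unfolding x_def by (simp add: blinfun.diff_right blinfun.sum_right op_of_scaleC fz(2) e(2)[OF n])
  have Qx: "op_of Q (e n) = op_of Q x + (\<Sum>k<n. cinner (f k) (e n) *\<^sub>C f k)"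
    unfolding x_def by (simp add: blinfun.diff_right blinfun.sum_right op_of_scaleC fz(1))
  have Qf: "op_of Q (f k) = f k" if "k < n" for k using fz(1)[OF that] Pc_idem[OF Q] by simp
  have ort: "cinner (f j) (op_of Q x) = 0" if j: "j < n" for j
  proof -
    have "cinner (f j) (\<Sum>k<n. cinner (f k) (e n) *\<^sub>C f k) = (\<Sum>k<n. if k = j then cinner (f k) (e n) else 0)"
      unfolding cinner_simps using f j by (intro sum.cong) (auto simp: orthonormal_def)
    also have "\<dots> = cinner (f j) (e n)" using j by (simp add: sum.delta)
    also have "\<dots> = cinner (f j) (op_of Q (e n))" using Qf[OF j] by (metis op_of_selfadjoint)
    finally show ?thesis unfolding Qx by (simp add: cinner_add_right)
  qed
  have ex: "cinner (e m) x = (if m = n then 1 else 0)" if "n \<le> m" "m < r" for m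
    unfolding x_def cinner_diff_right cinner_sum_right cinner_scaleC_right
    using e(1) that n by (simp add: fz(3) orthonormal_def)
  have "1 \<le> norm x"
    using cinner_Cauchy_Schwarz[of "e n" x] ex[of n] orthonormal_norm[OF e(1) n] n by simp
  then have "c \<le> c * norm x" using c(1) by simp
  also have "\<dots> \<le> norm (op_of Q x)" by (rule c(2)[OF Px])
  finally have N: "c \<le> norm (op_of Q x)" "0 < norm (op_of Q x)" using c(1) by linarith+
  define N where "N = norm (op_of Q x)"
  define fn where "fn = (1 / N) *\<^sub>R op_of Q x"
  have fn: "fn = op_of Q ((1 / N) *\<^sub>R x)" "cinner fn fn = 1" "\<And>k. k < n \<Longrightarrow> cinner (f k) fn = 0"
    "\<And>k. k < n \<Longrightarrow> cinner fn (f k) = 0"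
    using N(2) ort cinner_zero_commute[of "op_of Q x"]
    by (auto simp: fn_def N_def blinfun.scaleR_right cinner_simps cinner_self power2_eq_square)
  have "cinner (e n) fn = cinner (op_of Q (e n)) fn"
    unfolding fn(1) op_of_selfadjoint Pc_idem[OF Q] ..
  also have "\<dots> = cinner (op_of Q x) fn"
    unfolding Qx cinner_add_left cinner_sum_left cinner_scaleC_left by (simp add: fn(3))
  also have "\<dots> = of_real N"
    using N(2) by (simp add: fn_def cinner_scaleR_right cinner_self N_def power2_eq_square)
  finally have "c \<le> cmod (cinner (e n) fn)" using N by (simp add: N_def)
  then have "orthonormal (Suc n) (f(n := fn)) \<and> (\<forall>k<Suc n. (f(n := fn)) k = op_of Q ((z(n := (1 / N) *\<^sub>R x)) k)
    \<and> op_of P ((z(n := (1 / N) *\<^sub>R x)) k) = (z(n := (1 / N) *\<^sub>R x)) k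
    \<and> (\<forall>m<r. k < m \<longrightarrow> cinner (e m) ((z(n := (1 / N) *\<^sub>R x)) k) = 0)
    \<and> c \<le> cmod (cinner (e k) ((f(n := fn)) k)))"
    using f fn fz Px ex
    by (auto simp: orthonormal_def less_Suc_eq blinfun.scaleR_right cinner_scaleR_right)
  then show ?case by blast
qed

text \<open>The angle between two lines is at most $\pi/2$, so for $d \ge \pi/\sqrt 2$ every basis of \<open>Q\<close> will do.
  For smaller \<open>d\<close> the assumption bounds the overlaps with \<open>Q\<close> from below by $\cos(d/\sqrt 2) > 0$.\<close>

lemma aligned_basis_exists:
  fixes P Q :: "'a::chilbert_space sa_hs"
  assumes PQ: "P \<in> Pc" "Q \<in> Pc" and rk: "rk P = rk Q" and e: "e \<in> proj_basis P"
    and far: "\<And>x. norm x = 1 \<Longrightarrow> op_of P x = x \<Longrightarrow> ennreal (sqrt 2 * arccos (norm (op_of Q x))) \<le> d"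
  shows "\<exists>f\<in>proj_basis Q. \<forall>k<rk Q. ennreal (sqrt 2 * arccos (cmod (cinner (e k) (f k)))) \<le> d"
proof (cases "ennreal (sqrt 2 * (pi / 2)) \<le> d")
  case True
  obtain f where f: "f \<in> proj_basis Q" using proj_basis_nonempty[OF PQ(2)] by blast
  have "ennreal (sqrt 2 * arccos (cmod (cinner (e k) (f k)))) \<le> d" if "k < rk Q" for k
  proof -
    have "norm (e k) = 1" "norm (f k) = 1"
      using e f that rk orthonormal_norm unfolding proj_basis_def by fastforce+
    then have "arccos (cmod (cinner (e k) (f k))) \<le> arccos 0"
      using cinner_Cauchy_Schwarz[of "e k" "f k"] by (intro arccos_le_arccos) auto
    then show ?thesis using True by (elim order_trans[rotated]) (simp add: ennreal_leI)
  qed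
  then show ?thesis using f by blast
next
  case False
  then have "d < ennreal (sqrt 2 * (pi / 2))" by simp
  then obtain \<delta> where \<delta>: "d = ennreal \<delta>" "0 \<le> \<delta>" "\<delta> < sqrt 2 * (pi / 2)"
    by (cases d) (auto simp: ennreal_less_iff)
  define \<theta> where "\<theta> = \<delta> / sqrt 2"
  have \<theta>: "0 \<le> \<theta>" "\<theta> < pi / 2" using \<delta> by (simp_all add: \<theta>_def divide_simps mult.commute)
  have \<delta>\<theta>: "\<delta> = sqrt 2 * \<theta>" by (simp add: \<theta>_def)
  have c0: "cos \<theta> > 0" using \<theta> by (intro cos_gt_zero_pi) auto
  have "cos \<theta> * norm x \<le> norm (op_of Q x)" if "op_of P x = x" for x
  proof (cases "x = 0")
    case False
    define u where "u = (1 / norm x) *\<^sub>R x"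
    have u: "norm u = 1" "op_of P u = u" using False that by (auto simp: u_def blinfun.scaleR_right)
    have le: "norm (op_of Q u) \<le> 1" "-1 \<le> norm (op_of Q u)"
      using projection_norm_le[OF PQ(2), of u] u by (simp_all add: order_trans[of _ 0])
    have "arccos (norm (op_of Q u)) \<le> \<theta>"
      using far[OF u] \<theta> unfolding \<delta> \<delta>\<theta> by (subst (asm) ennreal_le_iff) auto
    moreover have "0 \<le> arccos (norm (op_of Q u))"
      using le by (intro arccos_lbound)
    ultimately have "cos \<theta> \<le> cos (arccos (norm (op_of Q u)))"
      using \<theta> by (intro cos_monotone_0_pi_le) auto
    also have "\<dots> = norm (op_of Q u)" using le by (intro cos_arccos)
    also have "\<dots> = norm (op_of Q x) / norm x" by (simp add: u_def blinfun.scaleR_right)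
    finally show ?thesis using False by (simp add: pos_le_divide_eq)
  qed simp
  from Gram_Schmidt_overlap[OF PQ(2) _ _ c0 this, where P = P and e = e and r = "rk P" and n = "rk P"] e
  have "\<exists>f z. orthonormal (rk P) f \<and> (\<forall>k<rk P. f k = op_of Q (z k) \<and> cos \<theta> \<le> cmod (cinner (e k) (f k)))"
    unfolding proj_basis_def mem_Collect_eq by (smt (verit, best) order_refl)
  then obtain f z where f: "orthonormal (rk P) f" "\<And>k. k < rk P \<Longrightarrow> f k = op_of Q (z k)"
    "\<And>k. k < rk P \<Longrightarrow> cos \<theta> \<le> cmod (cinner (e k) (f k))" by blast
  have "f \<in> proj_basis Q" using f rk Pc_idem[OF PQ(2)] by (simp add: proj_basis_def)
  moreover have "ennreal (sqrt 2 * arccos (cmod (cinner (e k) (f k)))) \<le> d" if "k < rk Q" for k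
  proof -
    have "norm (e k) = 1" "norm (f k) = 1"
      using e f that rk orthonormal_norm unfolding proj_basis_def by fastforce+
    then have "cmod (cinner (e k) (f k)) \<le> 1" using cinner_Cauchy_Schwarz[of "e k" "f k"] by simp
    then have "arccos (cmod (cinner (e k) (f k))) \<le> arccos (cos \<theta>)"
      using f(3)[of k] that rk c0 by (intro arccos_le_arccos) auto
    also have "\<dots> = \<theta>" using \<theta> by (intro arccos_cos) auto
    finally show ?thesis unfolding \<delta> \<delta>\<theta> by (intro ennreal_leI) simp
  qed
  ultimately show ?thesis by blast
qed

definition aligned :: "'a::complex_inner sa_hs \<Rightarrow> 'a sa_hs \<Rightarrow> (nat \<Rightarrow> 'a) \<Rightarrow> (nat \<Rightarrow> 'a) \<Rightarrow> bool" where
  "aligned P Q e f \<longleftrightarrow> (\<forall>k<rk P. geod_dist (line_proj (e k)) (line_proj (f k)) \<le> geod_dist P Q)"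

lemma aligned_bases:
  fixes P Q :: "'a::chilbert_space sa_hs"
  assumes PQ: "P \<in> Pc" "Q \<in> Pc" and rk: "rk P = rk Q"
  shows "e \<in> proj_basis P \<Longrightarrow> \<exists>f\<in>proj_basis Q. aligned P Q e f"
    and "f \<in> proj_basis Q \<Longrightarrow> \<exists>e\<in>proj_basis P. aligned P Q e f"
proof -
  have le: "geod_dist (line_proj (e k)) (line_proj (f k)) \<le> d"
    if "e \<in> proj_basis P" "f \<in> proj_basis Q" "k < rk P"
      "ennreal (sqrt 2 * arccos (cmod (cinner (e k) (f k)))) \<le> d" for e f k d
  proof -
    have "norm (e k) = 1" "norm (f k) = 1"
      using that rk orthonormal_norm unfolding proj_basis_def by fastforce+
    from geod_dist_line_proj_le[OF this] that(4) show ?thesis by (rule order_trans)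
  qed
  show "\<exists>f\<in>proj_basis Q. aligned P Q e f" if e: "e \<in> proj_basis P"
    using aligned_basis_exists[OF PQ rk e arccos_le_geod_dist(1)[OF _ PQ]] le[OF e] rk
    unfolding aligned_def by metis
  show "\<exists>e\<in>proj_basis P. aligned P Q e f" if f: "f \<in> proj_basis Q"
  proof -
    obtain e where e: "e \<in> proj_basis P"
      "\<And>k. k < rk P \<Longrightarrow> ennreal (sqrt 2 * arccos (cmod (cinner (f k) (e k)))) \<le> geod_dist P Q"
      using aligned_basis_exists[OF PQ(2,1) rk[symmetric] f arccos_le_geod_dist(2)[OF _ PQ]] by blast
    have "cmod (cinner (f k) (e k)) = cmod (cinner (e k) (f k))" for k
      by (metis cinner_commute complex_mod_cnj)
    then show ?thesis using e le[OF e(1) f] unfolding aligned_def by metis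
  qed
qed

section \<open>Labelling the support of a finite transport plan\<close>

lemma homogeneous_system_nontrivial_solution:
  fixes a :: "'v \<Rightarrow> 'e \<Rightarrow> real"
  assumes "finite V" "finite E" "card V < card E"
  shows "\<exists>z. (\<exists>e\<in>E. z e \<noteq> 0) \<and> (\<forall>v\<in>V. (\<Sum>e\<in>E. a v e * z e) = 0)"
  using assms
proof (induction V arbitrary: E a rule: finite_induct)
  case empty
  then have "E \<noteq> {}" by auto
  then show ?case by (intro exI[of _ "\<lambda>_. 1"]) auto
next
  case (insert v V)
  show ?case
  proof (cases "\<forall>e\<in>E. a v e = 0")
    case True
    have "card V < card E" using insert by simp
    from insert.IH[OF insert.prems(1) this, of a] True show ?thesis by (auto intro: sum.neutral)
  next
    case False
    then obtain e0 where e0: "e0 \<in> E" "a v e0 \<noteq> 0" by blast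
    \<comment> \<open>Gaussian elimination of the unknown \<open>e0\<close> with the equation \<open>v\<close>.\<close>
    define b where "b u e = a u e - a u e0 * a v e / a v e0" for u e
    have "card V < card (E - {e0})" using insert e0 by simp
    from insert.IH[OF _ this, of b] insert.prems(1)
    obtain z where z: "\<exists>e\<in>E - {e0}. z e \<noteq> 0" "\<And>u. u \<in> V \<Longrightarrow> (\<Sum>e\<in>E - {e0}. b u e * z e) = 0" by auto
    define y where "y = z(e0 := - (\<Sum>e\<in>E - {e0}. a v e * z e) / a v e0)"
    have split: "(\<Sum>e\<in>E. a u e * y e) = a u e0 * y e0 + (\<Sum>e\<in>E - {e0}. a u e * z e)" for u
      using insert.prems(1) e0 by (simp add: sum.remove[of E e0] y_def)
    have "(\<Sum>e\<in>E. a v e * y e) = 0" unfolding split using e0 by (simp add: y_def)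
    moreover have "(\<Sum>e\<in>E. a u e * y e) = 0" if "u \<in> V" for u
    proof -
      have "(\<Sum>e\<in>E - {e0}. b u e * z e)
          = (\<Sum>e\<in>E - {e0}. a u e * z e) - a u e0 / a v e0 * (\<Sum>e\<in>E - {e0}. a v e * z e)"
        unfolding b_def left_diff_distrib sum_subtractf sum_distrib_left by (simp add: mult_ac)
      then show ?thesis unfolding split using z(2)[OF that] by (simp add: y_def)
    qed
    moreover have "\<exists>e\<in>E. y e \<noteq> 0" using z(1) by (auto simp: y_def)
    ultimately show ?thesis by (intro exI[of _ y]) auto
  qed
qed

lemma card_le_half_of_fibres:
  fixes f :: "'e \<Rightarrow> 'v"
  assumes "finite E" and two: "\<And>e. e \<in> E \<Longrightarrow> \<exists>e'\<in>E. e' \<noteq> e \<and> f e' = f e"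
  shows "2 * card (f ` E) \<le> card E"
proof -
  have "2 \<le> card {e\<in>E. f e = v}" if "v \<in> f ` E" for v
  proof -
    from that obtain e where e: "e \<in> E" "f e = v" by auto
    from two[OF e(1)] e obtain e' where "e' \<in> E" "e' \<noteq> e" "f e' = v" by auto
    then have "{e, e'} \<subseteq> {e\<in>E. f e = v}" "card {e, e'} = 2" using e by auto
    then show ?thesis using card_mono[of "{e\<in>E. f e = v}" "{e, e'}"] assms(1) by simp
  qed
  then have "(\<Sum>v\<in>f ` E. 2) \<le> (\<Sum>v\<in>f ` E. card {e\<in>E. f e = v})" by (rule sum_mono)
  also have "\<dots> = card E" using sum.image_gen[OF assms(1), of "\<lambda>_. 1::nat" f] by simp
  finally show ?thesis by simp
qed

text \<open>If every row and every column that is used by \<open>E\<close> is used at least twice, then there are at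
  least as many unknowns on \<open>E\<close> as there are row and column equations, and one of these equations
  is redundant because the rows and the columns have the same total.\<close>

lemma zero_margin_perturbation:
  fixes E :: "('a \<times> 'b) set"
  assumes fin: "finite E" and ne: "E \<noteq> {}"
    and rows: "\<And>e. e \<in> E \<Longrightarrow> \<exists>e'\<in>E. e' \<noteq> e \<and> fst e' = fst e"
    and cols: "\<And>e. e \<in> E \<Longrightarrow> \<exists>e'\<in>E. e' \<noteq> e \<and> snd e' = snd e"
  shows "\<exists>z::'a \<times> 'b \<Rightarrow> real. (\<exists>e\<in>E. z e \<noteq> 0) \<and> (\<forall>a. (\<Sum>e | e \<in> E \<and> fst e = a. z e) = 0)
    \<and> (\<forall>b. (\<Sum>e | e \<in> E \<and> snd e = b. z e) = 0)"
proof -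
  obtain e0 where e0: "e0 \<in> E" using ne by blast
  define V where "V = Inl ` fst ` E \<union> Inr ` (snd ` E - {snd e0})"
  define a where "a v e = (case v of Inl x \<Rightarrow> (of_bool (fst e = x) :: real) | Inr y \<Rightarrow> of_bool (snd e = y))"
    for v and e :: "'a \<times> 'b"
  have "card V = card (fst ` E) + card (snd ` E - {snd e0})"
    unfolding V_def using fin by (subst card_Un_disjoint) (auto simp: card_image)
  moreover have "card (snd ` E - {snd e0}) < card (snd ` E)"
    using fin e0 by (intro psubset_card_mono) auto
  ultimately have "card V < card E"
    using card_le_half_of_fibres[OF fin rows] card_le_half_of_fibres[OF fin cols] by simp
  moreover have "finite V" using fin by (simp add: V_def)
  ultimately obtain z where z: "\<exists>e\<in>E. z e \<noteq> 0" "\<And>v. v \<in> V \<Longrightarrow> (\<Sum>e\<in>E. a v e * z e) = 0"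
    using homogeneous_system_nontrivial_solution[of V E a] fin by blast
  have row: "(\<Sum>e | e \<in> E \<and> fst e = x. z e) = 0" for x
  proof (cases "x \<in> fst ` E")
    case True
    have "(\<Sum>e | e \<in> E \<and> fst e = x. z e) = (\<Sum>e\<in>E. a (Inl x) e * z e)"
      using fin by (intro sum.mono_neutral_cong_left) (auto simp: a_def)
    also have "\<dots> = 0" using True by (intro z(2)) (simp add: V_def)
    finally show ?thesis .
  next
    case False
    then have "{e. e \<in> E \<and> fst e = x} = {}" by force
    then show ?thesis by (simp only: sum.empty)
  qed
  have col: "(\<Sum>e | e \<in> E \<and> snd e = y. z e) = 0" if "y \<noteq> snd e0" for y
  proof (cases "y \<in> snd ` E")
    case True
    have "(\<Sum>e | e \<in> E \<and> snd e = y. z e) = (\<Sum>e\<in>E. a (Inr y) e * z e)"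
      using fin by (intro sum.mono_neutral_cong_left) (auto simp: a_def)
    also have "\<dots> = 0" using True that by (intro z(2)) (simp add: V_def)
    finally show ?thesis .
  next
    case False
    then have "{e. e \<in> E \<and> snd e = y} = {}" by force
    then show ?thesis by (simp only: sum.empty)
  qed
  have "0 = (\<Sum>x\<in>fst ` E. \<Sum>e | e \<in> E \<and> fst e = x. z e)" by (simp add: row)
  also have "\<dots> = (\<Sum>y\<in>snd ` E. \<Sum>e | e \<in> E \<and> snd e = y. z e)"
    using sum.image_gen[OF fin, of z fst] sum.image_gen[OF fin, of z snd] by simp
  also have "\<dots> = (\<Sum>e | e \<in> E \<and> snd e = snd e0. z e)"
    using fin e0 by (subst sum.remove[of _ "snd e0"]) (auto simp: col)
  finally have "(\<Sum>e | e \<in> E \<and> snd e = y. z e) = 0" for y using col by (cases "y = snd e0") auto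
  with z(1) row show ?thesis by blast
qed

text \<open>Moving a plan along a perturbation with zero margins, in the direction that does not increase the
  cost, until the first entry vanishes.\<close>

lemma transport_plan_delete_entry:
  fixes E :: "('a \<times> 'b) set" and w c z :: "'a \<times> 'b \<Rightarrow> real"
  assumes fin: "finite E" and w: "\<And>e. e \<in> E \<Longrightarrow> w e \<ge> 0"
    and z: "\<exists>e\<in>E. z e \<noteq> 0" "\<And>a. (\<Sum>e | e \<in> E \<and> fst e = a. z e) = 0"
      "\<And>b. (\<Sum>e | e \<in> E \<and> snd e = b. z e) = 0"
  obtains u e0 where "e0 \<in> E" "u e0 = 0" "\<And>e. e \<in> E \<Longrightarrow> u e \<ge> 0"
    "\<And>a. (\<Sum>e | e \<in> E \<and> fst e = a. u e) = (\<Sum>e | e \<in> E \<and> fst e = a. w e)"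
    "\<And>b. (\<Sum>e | e \<in> E \<and> snd e = b. u e) = (\<Sum>e | e \<in> E \<and> snd e = b. w e)"
    "(\<Sum>e\<in>E. u e * c e) \<le> (\<Sum>e\<in>E. w e * c e)"
proof -
  define y where "y e = (if (\<Sum>e\<in>E. z e * c e) \<le> 0 then z e else - z e)" for e
  have y: "\<exists>e\<in>E. y e \<noteq> 0" "\<And>a. (\<Sum>e | e \<in> E \<and> fst e = a. y e) = 0"
      "\<And>b. (\<Sum>e | e \<in> E \<and> snd e = b. y e) = 0" "(\<Sum>e\<in>E. y e * c e) \<le> 0"
    using z by (cases "(\<Sum>e\<in>E. z e * c e) \<le> 0"; simp add: y_def sum_negf)+
  have "\<exists>e\<in>E. y e < 0"
  proof (rule ccontr)
    assume "\<not> (\<exists>e\<in>E. y e < 0)"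
    then have nn: "\<forall>e\<in>E. y e \<ge> 0" by (auto simp: not_less)
    have "y e = 0" if "e \<in> E" for e
    proof -
      have "(\<Sum>e' | e' \<in> E \<and> fst e' = fst e. y e') = 0" by (rule y(2))
      then have "\<forall>e'\<in>{e'. e' \<in> E \<and> fst e' = fst e}. y e' = 0"
        using nn fin by (subst (asm) sum_nonneg_eq_0_iff) auto
      then show ?thesis using that by blast
    qed
    then show False using y(1) by blast
  qed
  define N where "N = {e\<in>E. y e < 0}"
  have N: "finite N" "N \<noteq> {}" using fin \<open>\<exists>e\<in>E. y e < 0\<close> by (auto simp: N_def)
  define s where "s = Min ((\<lambda>e. w e / (- y e)) ` N)"
  have "s \<in> (\<lambda>e. w e / (- y e)) ` N" unfolding s_def using N by (intro Min_in) auto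
  then obtain e0 where e0: "e0 \<in> E" "y e0 < 0" "s = w e0 / (- y e0)" by (auto simp: N_def)
  have s_le: "s \<le> w e / (- y e)" if "e \<in> N" for e unfolding s_def using N that by auto
  have s0: "s \<ge> 0" using e0 w[of e0] by (simp add: divide_le_0_iff)
  define u where "u e = w e + s * y e" for e
  have "u e0 = 0" using e0 by (simp add: u_def)
  moreover have "u e \<ge> 0" if "e \<in> E" for e
  proof (cases "y e < 0")
    case True
    then have "s * (- y e) \<le> w e"
      using s_le[of e] that by (subst pos_le_divide_eq[symmetric]) (simp_all add: N_def)
    then show ?thesis by (simp add: u_def)
  next
    case False
    then show ?thesis using s0 w[OF that] by (simp add: u_def)
  qed
  moreover have "(\<Sum>e\<in>E. u e * c e) \<le> (\<Sum>e\<in>E. w e * c e)"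
  proof -
    have "(\<Sum>e\<in>E. u e * c e) = (\<Sum>e\<in>E. w e * c e) + s * (\<Sum>e\<in>E. y e * c e)"
      by (simp add: u_def distrib_right sum.distrib sum_distrib_left mult.assoc)
    then show ?thesis using mult_nonneg_nonpos[OF s0 y(4)] by simp
  qed
  moreover have "(\<Sum>e | e \<in> E \<and> fst e = a. u e) = (\<Sum>e | e \<in> E \<and> fst e = a. w e)" for a
    using y(2)[of a] by (simp add: u_def sum.distrib flip: sum_distrib_left)
  moreover have "(\<Sum>e | e \<in> E \<and> snd e = b. u e) = (\<Sum>e | e \<in> E \<and> snd e = b. w e)" for b
    using y(3)[of b] by (simp add: u_def sum.distrib flip: sum_distrib_left)
  ultimately show thesis using e0(1) by (intro that[of e0 u])
qed

lemma sum_fibre_insert_edge: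
  fixes u :: "'e \<Rightarrow> real"
  assumes "finite E" "e0 \<in> E"
  shows "(\<Sum>e | e \<in> E \<and> f e = v. (u(e0 := t)) e)
    = (\<Sum>e | e \<in> E - {e0} \<and> f e = v. u e) + (if f e0 = v then t else 0)"
proof (cases "f e0 = v")
  case True
  then have "{e. e \<in> E \<and> f e = v} = insert e0 {e. e \<in> E - {e0} \<and> f e = v}" using assms by auto
  moreover have "(\<Sum>e | e \<in> E - {e0} \<and> f e = v. (u(e0 := t)) e) = (\<Sum>e | e \<in> E - {e0} \<and> f e = v. u e)"
    by (intro sum.cong) auto
  ultimately show ?thesis using True assms by simp
next
  case False
  then have "{e. e \<in> E \<and> f e = v} = {e. e \<in> E - {e0} \<and> f e = v}" by auto
  then show ?thesis using False by (auto intro!: sum.cong)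
qed

text \<open>\<open>u\<close> is a plan on \<open>E\<close> with the margins of \<open>w\<close> that costs at most as much, and \<open>f\<close>, \<open>g\<close> label the rows
  and the columns compatibly along the support of \<open>u\<close>.\<close>

definition labelled_plan ::
  "('a \<times> 'b \<Rightarrow> real) \<Rightarrow> ('a \<Rightarrow> 'l set) \<Rightarrow> ('b \<Rightarrow> 'm set) \<Rightarrow> ('a \<Rightarrow> 'b \<Rightarrow> 'l \<Rightarrow> 'm \<Rightarrow> bool) \<Rightarrow>
    ('a \<times> 'b) set \<Rightarrow> ('a \<times> 'b \<Rightarrow> real) \<Rightarrow> ('a \<times> 'b \<Rightarrow> real) \<Rightarrow> ('a \<Rightarrow> 'l) \<Rightarrow> ('b \<Rightarrow> 'm) \<Rightarrow> bool" where
  "labelled_plan c LA LB R E w u f g \<longleftrightarrow> (\<forall>e\<in>E. u e \<ge> 0)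
    \<and> (\<forall>a. (\<Sum>e | e \<in> E \<and> fst e = a. u e) = (\<Sum>e | e \<in> E \<and> fst e = a. w e))
    \<and> (\<forall>b. (\<Sum>e | e \<in> E \<and> snd e = b. u e) = (\<Sum>e | e \<in> E \<and> snd e = b. w e))
    \<and> (\<Sum>e\<in>E. u e * c e) \<le> (\<Sum>e\<in>E. w e * c e)
    \<and> (\<forall>a. f a \<in> LA a) \<and> (\<forall>b. g b \<in> LB b)
    \<and> (\<forall>(a, b)\<in>E. u (a, b) > 0 \<longrightarrow> R a b (f a) (g b))"

text \<open>An edge that was left out may be restored with its mass in \<open>w\<close>. Labels may be changed for this purpose
  at rows and columns that carry no other mass of \<open>u\<close>.\<close>

lemma labelled_plan_insert_edge:
  assumes plan: "labelled_plan c LA LB R (E - {(a0, b0)}) w u f g"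
    and E: "finite E" "(a0, b0) \<in> E" "w (a0, b0) \<ge> 0"
    and f': "\<And>a. f' a \<in> LA a" "\<And>a b. (a, b) \<in> E - {(a0, b0)} \<Longrightarrow> u (a, b) > 0 \<Longrightarrow> f' a = f a"
    and g': "\<And>b. g' b \<in> LB b" "\<And>a b. (a, b) \<in> E - {(a0, b0)} \<Longrightarrow> u (a, b) > 0 \<Longrightarrow> g' b = g b"
    and R: "w (a0, b0) > 0 \<Longrightarrow> R a0 b0 (f' a0) (g' b0)"
  shows "labelled_plan c LA LB R E w (u((a0, b0) := w (a0, b0))) f' g'"
proof -
  have row: "(\<Sum>e | e \<in> E \<and> fst e = a. (u((a0, b0) := w (a0, b0))) e) = (\<Sum>e | e \<in> E \<and> fst e = a. w e)" for a
    using plan sum_fibre_insert_edge[OF E(1,2), where f = fst and v = a and u = u and t = "w (a0, b0)"]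
      sum_fibre_insert_edge[OF E(1,2), where f = fst and v = a and u = w and t = "w (a0, b0)"] by (simp add: labelled_plan_def)
  have col: "(\<Sum>e | e \<in> E \<and> snd e = b. (u((a0, b0) := w (a0, b0))) e) = (\<Sum>e | e \<in> E \<and> snd e = b. w e)" for b
    using plan sum_fibre_insert_edge[OF E(1,2), where f = snd and v = b and u = u and t = "w (a0, b0)"]
      sum_fibre_insert_edge[OF E(1,2), where f = snd and v = b and u = w and t = "w (a0, b0)"] by (simp add: labelled_plan_def)
  have cost: "(\<Sum>e\<in>E. (u((a0, b0) := w (a0, b0))) e * c e) \<le> (\<Sum>e\<in>E. w e * c e)"
    using plan E by (simp add: sum.remove[of E "(a0, b0)"] labelled_plan_def)
  show ?thesis
    unfolding labelled_plan_def
  proof (intro conjI allI row col cost f'(1) g'(1))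
    show "\<forall>e\<in>E. 0 \<le> (u((a0, b0) := w (a0, b0))) e"
      using plan E by (auto simp: labelled_plan_def)
    show "\<forall>(a, b)\<in>E. 0 < (u((a0, b0) := w (a0, b0))) (a, b) \<longrightarrow> R a b (f' a) (g' b)"
    proof safe
      fix a b assume ab: "(a, b) \<in> E" "0 < (u((a0, b0) := w (a0, b0))) (a, b)"
      show "R a b (f' a) (g' b)"
      proof (cases "(a, b) = (a0, b0)")
        case True
        then show ?thesis using ab R by simp
      next
        case False
        then have *: "(a, b) \<in> E - {(a0, b0)}" "u (a, b) > 0" using ab by auto
        then have "R a b (f a) (g b)" using plan unfolding labelled_plan_def by blast
        then show ?thesis using f'(2)[OF *] g'(2)[OF *] by simp
      qed
    qed
  qed
qed

text \<open>Deleting entries along perturbations with zero margins leads to an acyclic support, that is, one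
  with a row or a column that is used only once. The label of that row or column can be chosen last.\<close>

lemma labelled_transport_plan:
  fixes E :: "('a \<times> 'b) set" and w c :: "'a \<times> 'b \<Rightarrow> real"
    and LA :: "'a \<Rightarrow> 'l set" and LB :: "'b \<Rightarrow> 'm set" and R :: "'a \<Rightarrow> 'b \<Rightarrow> 'l \<Rightarrow> 'm \<Rightarrow> bool"
  assumes "finite E" "\<And>e. e \<in> E \<Longrightarrow> w e \<ge> 0"
    and ne: "\<And>a. LA a \<noteq> {}" "\<And>b. LB b \<noteq> {}"
    and ext: "\<And>a b x. (a, b) \<in> E \<Longrightarrow> x \<in> LA a \<Longrightarrow> \<exists>y\<in>LB b. R a b x y"
      "\<And>a b y. (a, b) \<in> E \<Longrightarrow> y \<in> LB b \<Longrightarrow> \<exists>x\<in>LA a. R a b x y"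
  shows "\<exists>u f g. labelled_plan c LA LB R E w u f g"
  using assms(1,2) ext
proof (induction "card E" arbitrary: E w)
  case 0
  then have "labelled_plan c LA LB R E w w (\<lambda>a. SOME x. x \<in> LA a) (\<lambda>b. SOME x. x \<in> LB b)"
    using ne by (simp add: labelled_plan_def some_in_eq)
  then show ?case by blast
next
  case (Suc n)
  have IH: "\<exists>u f g. labelled_plan c LA LB R (E - {e0}) v u f g"
    if "e0 \<in> E" "\<And>e. e \<in> E \<Longrightarrow> v e \<ge> 0" for v e0
  proof (rule Suc.hyps(1))
    show "n = card (E - {e0})" using Suc.hyps(2) Suc.prems(1) that(1) by simp
  qed (use Suc.prems that in auto)
  consider (leafA) a0 b0 where "(a0, b0) \<in> E" "\<And>b. (a0, b) \<in> E \<Longrightarrow> b = b0"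
    | (leafB) a0 b0 where "(a0, b0) \<in> E" "\<And>a. (a, b0) \<in> E \<Longrightarrow> a = a0"
    | (cyclic) "\<And>e. e \<in> E \<Longrightarrow> \<exists>e'\<in>E. e' \<noteq> e \<and> fst e' = fst e"
        "\<And>e. e \<in> E \<Longrightarrow> \<exists>e'\<in>E. e' \<noteq> e \<and> snd e' = snd e"
    by (metis prod.collapse fst_conv snd_conv)
  then show ?case
  proof cases
    case leafA
    obtain u f g where plan: "labelled_plan c LA LB R (E - {(a0, b0)}) w u f g"
      using IH[where v = w, OF leafA(1) Suc.prems(2)] by blast
    then have fg: "\<And>a. f a \<in> LA a" "\<And>b. g b \<in> LB b" by (auto simp: labelled_plan_def)
    from Suc.prems(4)[OF leafA(1) fg(2)] obtain x where x: "x \<in> LA a0" "R a0 b0 x (g b0)" ..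
    have "labelled_plan c LA LB R E w (u((a0, b0) := w (a0, b0))) (f(a0 := x)) g"
    proof (rule labelled_plan_insert_edge[OF plan])
      show "(f(a0 := x)) a \<in> LA a" for a using fg x by simp
      show "(f(a0 := x)) a = f a" if "(a, b) \<in> E - {(a0, b0)}" for a b using that leafA(2) by auto
    qed (use Suc.prems(1,2) leafA(1) fg x in auto)
    then show ?thesis by blast
  next
    case leafB
    obtain u f g where plan: "labelled_plan c LA LB R (E - {(a0, b0)}) w u f g"
      using IH[where v = w, OF leafB(1) Suc.prems(2)] by blast
    then have fg: "\<And>a. f a \<in> LA a" "\<And>b. g b \<in> LB b" by (auto simp: labelled_plan_def)
    from Suc.prems(3)[OF leafB(1) fg(1)] obtain y where y: "y \<in> LB b0" "R a0 b0 (f a0) y" ..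
    have "labelled_plan c LA LB R E w (u((a0, b0) := w (a0, b0))) f (g(b0 := y))"
    proof (rule labelled_plan_insert_edge[OF plan])
      show "(g(b0 := y)) b \<in> LB b" for b using fg y by simp
      show "(g(b0 := y)) b = g b" if "(a, b) \<in> E - {(a0, b0)}" for a b using that leafB(2) by auto
    qed (use Suc.prems(1,2) leafB(1) fg y in auto)
    then show ?thesis by blast
  next
    case cyclic
    have "E \<noteq> {}" using Suc.hyps(2) by auto
    from zero_margin_perturbation[OF Suc.prems(1) this cyclic] obtain z :: "'a \<times> 'b \<Rightarrow> real"
      where z: "\<exists>e\<in>E. z e \<noteq> 0" "\<And>a. (\<Sum>e | e \<in> E \<and> fst e = a. z e) = 0"
        "\<And>b. (\<Sum>e | e \<in> E \<and> snd e = b. z e) = 0" by blast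
    obtain v e0
      where e0: "e0 \<in> E" "v e0 = 0" and v: "\<And>e. e \<in> E \<Longrightarrow> v e \<ge> 0"
        "\<And>a. (\<Sum>e | e \<in> E \<and> fst e = a. v e) = (\<Sum>e | e \<in> E \<and> fst e = a. w e)"
        "\<And>b. (\<Sum>e | e \<in> E \<and> snd e = b. v e) = (\<Sum>e | e \<in> E \<and> snd e = b. w e)"
        "(\<Sum>e\<in>E. v e * c e) \<le> (\<Sum>e\<in>E. w e * c e)" 
      by (rule transport_plan_delete_entry[where c = c and w = w, OF Suc.prems(1) _ z])
         (rule Suc.prems(2), assumption, erule that)
    obtain a0 b0 where ab: "e0 = (a0, b0)" by (cases e0)
    obtain u f g where plan: "labelled_plan c LA LB R (E - {e0}) v u f g"
      using IH[where v = v, OF e0(1) v(1)] by blast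
    then have fg: "\<And>a. f a \<in> LA a" "\<And>b. g b \<in> LB b" by (auto simp: labelled_plan_def)
    have "labelled_plan c LA LB R E v (u((a0, b0) := v (a0, b0))) f g"
      by (rule labelled_plan_insert_edge[OF plan[unfolded ab]]) (use Suc.prems(1) fg e0 ab in auto)
    then have "labelled_plan c LA LB R E w (u((a0, b0) := v (a0, b0))) f g"
      unfolding labelled_plan_def using v(2-4) by (auto intro: order_trans)
    then show ?thesis by blast
  qed
qed

section \<open>Discrete Borel measures\<close>

text \<open>A mass function concentrated on \<open>A\<close> as a Borel measure on \<open>A\<close>. It is restricted to \<open>A\<close> first so that the
  identity maps into the space \<open>A\<close>.\<close>

definition borel_of_pmf :: "'b::topological_space set \<Rightarrow> 'b pmf \<Rightarrow> 'b measure" where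
  "borel_of_pmf A q = distr (restrict_space (measure_pmf q) A) (restrict_space borel A) (\<lambda>x. x)"

lemma sets_borel_of_pmf [simp]: "sets (borel_of_pmf A q) = sets (restrict_space borel A)"
  and space_borel_of_pmf [simp]: "space (borel_of_pmf A q) = A"
  by (simp_all add: borel_of_pmf_def space_restrict_space)

lemma measurable_id_restrict_pmf:
  "(\<lambda>x. x) \<in> restrict_space (measure_pmf q) A \<rightarrow>\<^sub>M restrict_space borel (A :: 'b::topological_space set)"
  by (rule measurable_restrict_space3) auto

lemma emeasure_borel_of_pmf:
  assumes "B \<in> sets (restrict_space borel (A :: 'b::topological_space set))"
  shows "emeasure (borel_of_pmf A q) B = emeasure (measure_pmf q) B"
proof -
  have "B \<subseteq> A" using assms sets.sets_into_space by (fastforce simp: space_restrict_space)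
  then have "B \<inter> A = B" by blast
  then show ?thesis
    unfolding borel_of_pmf_def using assms \<open>B \<subseteq> A\<close>
    by (subst emeasure_distr[OF measurable_id_restrict_pmf])
       (simp_all add: space_restrict_space emeasure_restrict_space)
qed

lemma nn_integral_borel_of_pmf_measurable:
  assumes "f \<in> borel_measurable (restrict_space borel (A :: 'b::topological_space set))" "set_pmf q \<subseteq> A"
  shows "(\<integral>\<^sup>+x. f x \<partial>borel_of_pmf A q) = (\<integral>\<^sup>+x. f x \<partial>measure_pmf q)"
proof -
  have "(\<integral>\<^sup>+x. f x \<partial>borel_of_pmf A q) = (\<integral>\<^sup>+x. f x * indicator A x \<partial>measure_pmf q)"
    unfolding borel_of_pmf_def using assms(1)
    by (simp add: nn_integral_distr[OF measurable_id_restrict_pmf] nn_integral_restrict_space)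
  also have "\<dots> = (\<integral>\<^sup>+x. f x \<partial>measure_pmf q)"
    using assms(2) by (intro nn_integral_cong_AE) (auto simp: AE_measure_pmf_iff)
  finally show ?thesis .
qed

lemma singleton_in_sets_restrict_borel:
  "x \<in> A \<Longrightarrow> {x} \<in> sets (restrict_space borel (A :: 'b::t1_space set))"
  by (auto simp: sets_restrict_space intro!: image_eqI[of _ _ "{x}"])

lemma countable_in_sets_restrict_borel:
  assumes "countable C" "C \<subseteq> (A :: 'b::t1_space set)"
  shows "C \<in> sets (restrict_space borel A)"
  by (rule sets.countable[OF _ assms(1)]) (use assms(2) singleton_in_sets_restrict_borel in blast)

lemma measurable_countable_support:
  fixes f :: "'b::t1_space \<Rightarrow> ennreal"
  assumes "countable C" "C \<subseteq> A" "sets M = sets (restrict_space borel A)"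
  shows "(\<lambda>x. f x * indicator C x) \<in> borel_measurable M"
proof (rule measurableI)
  fix B :: "ennreal set"
  have sub: "D \<in> sets (restrict_space borel A)" if "D \<subseteq> C" for D
    using that assms by (intro countable_in_sets_restrict_borel) (auto intro: countable_subset)
  have sp: "space M = A" using sets_eq_imp_space_eq[OF assms(3)] by (simp add: space_restrict_space)
  have "(\<lambda>x. f x * indicator C x) -` B \<inter> A
      = {x \<in> C. f x \<in> B} \<union> (if 0 \<in> B then A - C else {})"
    using assms(2) by (auto simp: indicator_def of_bool_def split: if_splits)
  moreover have "A - C \<in> sets (restrict_space borel A)"
    using sets.compl_sets[OF sub[OF order_refl]] by (simp add: space_restrict_space)
  ultimately show "(\<lambda>x. f x * indicator C x) -` B \<inter> space M \<in> sets M"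
    unfolding sp assms(3) using sub[of "{x\<in>C. f x \<in> B}"] by auto
qed simp

lemma nn_integral_mult_indicator_le: "(\<integral>\<^sup>+x. f x * indicator C x \<partial>M) \<le> (\<integral>\<^sup>+x. f x \<partial>M)"
  by (rule nn_integral_mono) (simp add: indicator_def)

lemma AE_borel_of_pmf:
  assumes "set_pmf q \<subseteq> (A :: 'b::t1_space set)"
  shows "(AE x in borel_of_pmf A q. \<Phi> x) \<longleftrightarrow> (\<forall>x\<in>set_pmf q. \<Phi> x)"
proof
  assume "AE x in borel_of_pmf A q. \<Phi> x"
  then obtain N where N: "{x\<in>A. \<not> \<Phi> x} \<subseteq> N" "N \<in> sets (borel_of_pmf A q)" "emeasure (borel_of_pmf A q) N = 0"
    by (auto elim!: AE_E)
  then have "emeasure (measure_pmf q) N = 0" by (simp add: emeasure_borel_of_pmf)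
  then have "set_pmf q \<inter> N = {}"
    by (simp add: measure_pmf.emeasure_eq_measure measure_pmf_zero_iff)
  then show "\<forall>x\<in>set_pmf q. \<Phi> x" using N(1) assms by blast
next
  assume "\<forall>x\<in>set_pmf q. \<Phi> x"
  have "set_pmf q \<in> sets (restrict_space borel A)"
    using assms by (intro countable_in_sets_restrict_borel) auto
  then have *: "A - set_pmf q \<in> sets (restrict_space borel A)"
    using sets.compl_sets by (fastforce simp: space_restrict_space)
  have "emeasure (measure_pmf q) (A - set_pmf q) = 0"
    by (simp add: measure_pmf.emeasure_eq_measure measure_pmf_zero_iff)
  then show "AE x in borel_of_pmf A q. \<Phi> x"
    using * \<open>\<forall>x\<in>set_pmf q. \<Phi> x\<close>
    by (intro AE_I[of _ _ "A - set_pmf q"]) (auto simp: emeasure_borel_of_pmf)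
qed

text \<open>The integrand may be replaced by 0 off the countable support, which makes it measurable.\<close>

lemma nn_integral_borel_of_pmf:
  fixes f :: "'b::t1_space \<Rightarrow> ennreal"
  assumes "set_pmf q \<subseteq> A"
  shows "(\<integral>\<^sup>+x. f x \<partial>borel_of_pmf A q) = (\<integral>\<^sup>+x. f x \<partial>measure_pmf q)"
proof -
  have "(\<integral>\<^sup>+x. f x \<partial>borel_of_pmf A q) = (\<integral>\<^sup>+x. f x * indicator (set_pmf q) x \<partial>borel_of_pmf A q)"
    by (rule nn_integral_cong_AE) (simp add: AE_borel_of_pmf[OF assms])
  also have "\<dots> = (\<integral>\<^sup>+x. f x * indicator (set_pmf q) x \<partial>measure_pmf q)"
    using assms by (intro nn_integral_borel_of_pmf_measurable measurable_countable_support) auto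
  also have "\<dots> = (\<integral>\<^sup>+x. f x \<partial>measure_pmf q)"
    by (intro nn_integral_cong_AE) (auto simp: AE_measure_pmf_iff)
  finally show ?thesis .
qed

lemma borel_of_pmf_in_borel_prob:
  assumes "set_pmf q \<subseteq> (A :: 'b::t1_space set)"
  shows "borel_of_pmf A q \<in> borel_prob A"
proof -
  have "emeasure (borel_of_pmf A q) A = emeasure (measure_pmf q) A"
    using sets.top[of "restrict_space borel A"] by (intro emeasure_borel_of_pmf) (simp add: space_restrict_space)
  also have "\<dots> = 1" using assms by (intro measure_pmf.emeasure_eq_1_AE) (auto simp: AE_measure_pmf_iff)
  finally show ?thesis by (auto simp: borel_prob_def intro: prob_spaceI)
qed

lemma distr_borel_of_pmf:
  assumes g: "g \<in> restrict_space borel A \<rightarrow>\<^sub>M restrict_space borel B"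
    and q: "set_pmf q \<subseteq> (A :: 'b::t1_space set)"
  shows "distr (borel_of_pmf A q) (restrict_space borel B) g
    = borel_of_pmf (B :: 'c::t1_space set) (map_pmf g q)"
proof (rule measure_eqI)
  fix C assume "C \<in> sets (distr (borel_of_pmf A q) (restrict_space borel B) g)"
  then have C: "C \<in> sets (restrict_space borel B)" by simp
  have gC: "g -` C \<inter> A \<in> sets (restrict_space borel A)"
    using measurable_sets[OF g C] by (simp add: space_restrict_space)
  have "emeasure (distr (borel_of_pmf A q) (restrict_space borel B) g) C = emeasure (borel_of_pmf A q) (g -` C \<inter> A)"
    using g C by (subst emeasure_distr) (auto simp: measurable_def space_restrict_space)
  also have "\<dots> = emeasure (measure_pmf q) (g -` C \<inter> A)" using gC by (rule emeasure_borel_of_pmf)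
  also have "\<dots> = emeasure (measure_pmf q) (g -` C)"
    by (rule emeasure_eq_AE) (use q in \<open>auto simp: AE_measure_pmf_iff\<close>)
  also have "\<dots> = emeasure (borel_of_pmf B (map_pmf g q)) C" using C by (simp add: emeasure_borel_of_pmf)
  finally show "emeasure (distr (borel_of_pmf A q) (restrict_space borel B) g) C
    = emeasure (borel_of_pmf B (map_pmf g q)) C" .
qed simp

lemma borel_of_pmf_inject:
  assumes "borel_of_pmf A q = borel_of_pmf A q'" "set_pmf q \<subseteq> (A :: 'b::t1_space set)" "set_pmf q' \<subseteq> A"
  shows "q = q'"
proof (rule pmf_eqI)
  fix x
  show "pmf q x = pmf q' x"
  proof (cases "x \<in> A")
    case True
    from singleton_in_sets_restrict_borel[OF this]
    have "emeasure (measure_pmf q) {x} = emeasure (measure_pmf q') {x}"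
      using assms(1) by (simp flip: emeasure_borel_of_pmf)
    then show ?thesis by (simp add: emeasure_pmf_single)
  next
    case False
    then have "x \<notin> set_pmf q" "x \<notin> set_pmf q'" using assms by auto
    then show ?thesis by (simp add: set_pmf_iff)
  qed
qed

lemma borel_prob_discrete:
  fixes A :: "'b::t1_space set"
  assumes \<mu>: "\<mu> \<in> borel_prob A" and C: "countable C" "C \<subseteq> A" and ae: "AE x in \<mu>. x \<in> C"
  shows "\<exists>q. set_pmf q \<subseteq> C \<and> \<mu> = borel_of_pmf A q"
proof -
  interpret prob_space \<mu> using \<mu> by (simp add: borel_prob_def)
  have sets_\<mu>: "sets \<mu> = sets (restrict_space borel A)" using \<mu> by (simp add: borel_prob_def)
  have sp: "space \<mu> = A" using sets_eq_imp_space_eq[OF sets_\<mu>] by (simp add: space_restrict_space)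
  have sing: "{x} \<in> sets \<mu>" if "x \<in> C" for x
    unfolding sets_\<mu> using C that by (intro singleton_in_sets_restrict_borel) auto
  define w where "w x = (if x \<in> C then measure \<mu> {x} else 0)" for x
  have mass: "(\<integral>\<^sup>+x. ennreal (w x) * indicator B x \<partial>count_space UNIV) = emeasure \<mu> B"
    if B: "B \<in> sets \<mu>" for B
  proof -
    have BC: "countable (B \<inter> C)" using C by (auto intro: countable_subset)
    have "(\<integral>\<^sup>+x. ennreal (w x) * indicator B x \<partial>count_space UNIV)
        = (\<integral>\<^sup>+x. emeasure \<mu> {x} * indicator (B \<inter> C) x \<partial>count_space UNIV)"
      by (intro nn_integral_cong) (auto simp: w_def emeasure_eq_measure indicator_def)
    also have "\<dots> = (\<integral>\<^sup>+x. emeasure \<mu> {x} \<partial>count_space (B \<inter> C))"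
      by (simp add: nn_integral_count_space_indicator)
    also have "\<dots> = emeasure \<mu> (\<Union>x\<in>B \<inter> C. {x})"
      using BC by (intro emeasure_UN_countable[symmetric]) (auto simp: sing disjoint_family_on_def)
    also have "(\<Union>x\<in>B \<inter> C. {x}) = B \<inter> C" by blast
    also have "emeasure \<mu> (B \<inter> C) = emeasure \<mu> B"
      using ae B countable_in_sets_restrict_borel[OF C] sets_\<mu>
      by (intro emeasure_eq_AE) auto
    finally show ?thesis .
  qed
  have "(\<integral>\<^sup>+x. ennreal (w x) \<partial>count_space UNIV) = (\<integral>\<^sup>+x. ennreal (w x) * indicator A x \<partial>count_space UNIV)"
    using C by (intro nn_integral_cong) (auto simp: w_def indicator_def)
  also have "\<dots> = 1" using mass[of A] sp sets.top[of \<mu>] emeasure_space_1 by simp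
  finally have one: "(\<integral>\<^sup>+x. ennreal (w x) \<partial>count_space UNIV) = 1" .
  define q where "q = embed_pmf w"
  have pmf_q: "pmf q x = w x" for x
    unfolding q_def by (rule pmf_embed_pmf) (use one in \<open>auto simp: w_def\<close>)
  have "set_pmf q \<subseteq> C" by (auto simp: set_pmf_iff pmf_q w_def split: if_splits)
  moreover have "\<mu> = borel_of_pmf A q"
  proof (rule measure_eqI)
    fix B assume B: "B \<in> sets \<mu>"
    have "emeasure (borel_of_pmf A q) B = emeasure (measure_pmf q) B"
      using B sets_\<mu> by (intro emeasure_borel_of_pmf) simp
    also have "\<dots> = (\<integral>\<^sup>+x. indicator B x \<partial>measure_pmf q)" by simp
    also have "\<dots> = (\<integral>\<^sup>+x. ennreal (w x) * indicator B x \<partial>count_space UNIV)"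
      by (subst nn_integral_measure_pmf) (simp add: pmf_q)
    also have "\<dots> = emeasure \<mu> B" by (rule mass[OF B])
    finally show "emeasure \<mu> B = emeasure (borel_of_pmf A q) B" by simp
  qed (simp add: sets_\<mu>)
  ultimately show ?thesis by blast
qed

section \<open>Orthogonal discrete measures as probability mass functions\<close>

text \<open>The operator $\rho$ of the decomposition given by \<open>q\<close>, with weights \<open>pmf q X / rk X\<close> so that
  $\mathrm{tr}(\cdot)$ times the discrete measure is the probability measure \<open>q\<close>.\<close>

definition orthogonal_decomposition :: "('a::complex_inner \<Rightarrow>\<^sub>L 'a) \<Rightarrow> 'a sa_hs pmf \<Rightarrow> bool" where
  "orthogonal_decomposition \<rho> q \<longleftrightarrow> set_pmf q \<subseteq> Pc - {0} \<and>
     (\<forall>X\<in>set_pmf q. \<forall>Y\<in>set_pmf q. X \<noteq> Y \<longrightarrow> inner X Y = 0) \<and>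
     ((\<lambda>X. (pmf q X / rk X) *\<^sub>R op_of X) has_sum \<rho>) (set_pmf q)"

lemma orthogonal_decompositionD:
  assumes "orthogonal_decomposition \<rho> q"
  shows "set_pmf q \<subseteq> Pc - {0}"
    and "\<And>X Y. X \<in> set_pmf q \<Longrightarrow> Y \<in> set_pmf q \<Longrightarrow> X \<noteq> Y \<Longrightarrow> inner X Y = 0"
    and "((\<lambda>X. (pmf q X / rk X) *\<^sub>R op_of X) has_sum \<rho>) (set_pmf q)"
  using assms by (simp_all add: orthogonal_decomposition_def)

lemma measurable_trace:
  fixes \<mu> :: "'a::chilbert_space sa_hs measure"
  assumes "sets \<mu> = sets (restrict_space borel Pc)"
  shows "(\<lambda>X. ennreal (Re (op_trace (op_of X)))) \<in> borel_measurable \<mu>"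
proof -
  have "(\<lambda>X::'a sa_hs. ennreal (inner X X)) \<in> borel_measurable borel"
    by (intro measurable_compose[OF _ measurable_ennreal] borel_measurable_continuous_onI continuous_intros)
  then have "(\<lambda>X::'a sa_hs. ennreal (inner X X)) \<in> borel_measurable (restrict_space borel Pc)"
    by (rule measurable_restrict_space1)
  then have "(\<lambda>X::'a sa_hs. ennreal (Re (op_trace (op_of X)))) \<in> borel_measurable (restrict_space borel Pc)"
    by (rule measurable_cong[THEN iffD2, rotated]) (simp add: space_restrict_space trace_Pc(1))
  then show ?thesis by (simp add: measurable_cong_sets[OF assms refl])
qed

lemma tr_meas_rank_one:
  fixes \<mu> :: "'a::chilbert_space sa_hs measure"
  assumes "\<mu> \<in> prob_on_Pr 1"
  shows "tr_meas \<mu> = \<mu>"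
proof -
  have "AE X in \<mu>. X \<in> Pr 1" "sets \<mu> = sets (restrict_space borel Pc)"
    using assms by (auto simp: prob_on_Pr_def borel_prob_def)
  moreover have "Re (op_trace (op_of X)) = 1" if "X \<in> Pr 1" for X :: "'a sa_hs"
    using trace_Pc[OF Pr_subset_Pc[OF that]] Pr_rk[OF that] by simp
  ultimately have "tr_meas \<mu> = density \<mu> (\<lambda>_. 1)"
    unfolding tr_meas_def by (intro density_cong measurable_trace) (auto elim!: eventually_mono)
  then show ?thesis by (simp add: density_1)
qed

lemma open_Int_in_sets_restrict_borel:
  "open U \<Longrightarrow> U \<inter> A \<in> sets (restrict_space borel (A :: 'b::topological_space set))"
  unfolding sets_restrict_space by (subst Int_commute) (rule imageI, simp)

subsection \<open>From measures to mass functions\<close>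

context
  fixes l :: "nat \<Rightarrow> real" and P :: "nat \<Rightarrow> 'a::chilbert_space sa_hs"
  assumes l: "\<And>i. l i \<ge> 0" and P: "\<And>i. P i \<in> Pc"
begin

lemma measurable_weighted_diracs:
  "P \<in> density (count_space UNIV) (\<lambda>i. ennreal (l i)) \<rightarrow>\<^sub>M restrict_space borel Pc"
  using P by (simp add: measurable_def space_restrict_space)

lemma nn_integral_weighted_diracs:
  assumes "f \<in> borel_measurable (restrict_space borel Pc)"
  shows "(\<integral>\<^sup>+X. f X \<partial>weighted_diracs l P) = (\<Sum>i. ennreal (l i) * f (P i))"
  unfolding weighted_diracs_def
  by (subst nn_integral_distr[OF measurable_weighted_diracs])
     (use assms in \<open>simp_all add: nn_integral_density nn_integral_count_space_nat\<close>)

lemma emeasure_tr_meas_weighted_diracs: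
  assumes "B \<in> sets (restrict_space borel Pc)"
  shows "emeasure (tr_meas (weighted_diracs l P)) B = (\<Sum>i. ennreal (l i * rk (P i) * indicator B (P i)))"
proof -
  have sets: "sets (weighted_diracs l P) = sets (restrict_space borel Pc)" by (simp add: weighted_diracs_def)
  have m: "(\<lambda>X::'a sa_hs. ennreal (Re (op_trace (op_of X))) * indicator B X) \<in> borel_measurable (restrict_space borel Pc)"
    using assms measurable_trace[of "restrict_space borel Pc"] by (intro borel_measurable_times_ennreal) auto
  have "emeasure (tr_meas (weighted_diracs l P)) B
      = (\<integral>\<^sup>+X. ennreal (Re (op_trace (op_of X))) * indicator B X \<partial>weighted_diracs l P)"
    unfolding tr_meas_def using assms sets by (subst emeasure_density[OF measurable_trace]) auto
  also have "\<dots> = (\<Sum>i. ennreal (l i) * (ennreal (Re (op_trace (op_of (P i)))) * indicator B (P i)))"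
    by (rule nn_integral_weighted_diracs[OF m])
  also have "\<dots> = (\<Sum>i. ennreal (l i * rk (P i) * indicator B (P i)))"
    using l P by (intro suminf_cong) (auto simp: trace_Pc ennreal_mult indicator_def)
  finally show ?thesis .
qed

lemma weighted_diracs_support:
  assumes "l i > 0"
  shows "P i \<in> msupport (weighted_diracs l P)"
proof -
  have sp: "space (weighted_diracs l P) = Pc" by (simp add: weighted_diracs_def space_restrict_space)
  have "emeasure (weighted_diracs l P) (U \<inter> Pc) > 0" if U: "open U" "P i \<in> U" for U
  proof -
    have UPc: "U \<inter> Pc \<in> sets (restrict_space borel Pc)" by (rule open_Int_in_sets_restrict_borel[OF U(1)])
    have "0 < ennreal (l i) * indicator (U \<inter> Pc) (P i)" using U P assms by simp
    also have "\<dots> = (\<Sum>j\<in>{i}. ennreal (l j) * indicator (U \<inter> Pc) (P j))"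
      by (simp only: sum.insert[OF finite.emptyI] empty_iff not_False_eq_True sum.empty add_0_right)
    also have "\<dots> \<le> (\<Sum>j. ennreal (l j) * indicator (U \<inter> Pc) (P j))"
      by (rule sum_le_suminf) (simp_all add: summableI)
    also have "\<dots> = (\<integral>\<^sup>+X. indicator (U \<inter> Pc) X \<partial>weighted_diracs l P)"
      using UPc by (intro nn_integral_weighted_diracs[symmetric]) auto
    also have "\<dots> = emeasure (weighted_diracs l P) (U \<inter> Pc)"
      using UPc by (intro nn_integral_indicator) (simp add: weighted_diracs_def)
    finally show ?thesis .
  qed
  then show ?thesis using P sp by (auto simp: msupport_def)
qed

end

lemma norm_projection_le_1:
  fixes X :: "'a::chilbert_space sa_hs"
  assumes "X \<in> Pc"
  shows "norm (op_of X) \<le> 1"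
  by (rule norm_blinfun_bound) (simp_all add: projection_norm_le[OF assms])

lemma rk_ge_1: "X \<in> Pc \<Longrightarrow> X \<noteq> 0 \<Longrightarrow> rk (X::'a::chilbert_space sa_hs) \<ge> 1"
  using rk_eq_0_iff[of X] by linarith

text \<open>In $\sum_i \lambda_i \delta_{P_i}$ a projection may be repeated, and 0 may occur with any weight. The
  measure with density \<open>tr\<close> does not see 0, and the total weight of the indices with $P_i = X$ is
  \<open>pmf q X / rk X\<close>. The series for the density matrix may be regrouped accordingly because it converges absolutely:
  $\|\lambda_i P_i\| \le \lambda_i\,\mathrm{tr}(P_i)$, and these numbers have the sum 1.\<close>

lemma Lambda_perp_imp_orthogonal_decomposition:
  fixes \<phi> :: "('a::chilbert_space \<Rightarrow>\<^sub>L 'a) \<Rightarrow> complex"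
  assumes \<mu>: "\<mu> \<in> Lambda_perp \<phi>"
  shows "\<exists>q. orthogonal_decomposition (density_matrix \<phi>) q \<and> tr_meas \<mu> = borel_of_pmf Pc q"
proof -
  obtain l and P :: "nat \<Rightarrow> 'a sa_hs" where l: "\<And>i. l i \<ge> 0" and P: "\<And>i. P i \<in> Pc"
    and \<mu>_eq: "\<mu> = weighted_diracs l P" and sums: "(\<lambda>i. l i *\<^sub>R op_of (P i)) sums density_matrix \<phi>"
    using \<mu> unfolding Lambda_perp_def by blast
  have prob: "tr_meas \<mu> \<in> borel_prob Pc"
    and orth: "\<And>X Y. X \<in> msupport \<mu> \<Longrightarrow> Y \<in> msupport \<mu> \<Longrightarrow> X \<noteq> Y \<Longrightarrow> op_trace (op_of X o\<^sub>L op_of Y) = 0"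
    using \<mu> unfolding Lambda_perp_def D1_perp_def by auto
  have emeas: "emeasure (tr_meas \<mu>) B = (\<Sum>i. ennreal (l i * rk (P i) * indicator B (P i)))"
    if "B \<in> sets (restrict_space borel Pc)" for B
    unfolding \<mu>_eq using that by (rule emeasure_tr_meas_weighted_diracs[OF l P])
  have sets: "sets (tr_meas \<mu>) = sets (restrict_space borel Pc)" using prob by (simp add: borel_prob_def)
  have sp: "space (tr_meas \<mu>) = Pc" using sets_eq_imp_space_eq[OF sets] by (simp add: space_restrict_space)
  define I where "I = {i. l i > 0 \<and> P i \<noteq> 0}"
  define C where "C = P ` I"
  have C: "countable C" "C \<subseteq> Pc" using P by (auto simp: C_def)
  have off_I: "l i * rk (P i) = 0" if "i \<notin> I" for i
    using that l[of i] rk_eq_0_iff[OF P, of i] by (auto simp: I_def)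
  have "AE X in tr_meas \<mu>. X \<in> C"
  proof (rule AE_I[of _ _ "Pc - C"])
    have *: "Pc - C \<in> sets (restrict_space borel Pc)"
      using sets.compl_sets[OF countable_in_sets_restrict_borel[OF C]] by (simp add: space_restrict_space)
    then show "Pc - C \<in> sets (tr_meas \<mu>)" by (simp add: sets)
    have 0: "l i * rk (P i) * indicator (Pc - C) (P i) = 0" for i
      using off_I[of i] by (cases "i \<in> I") (auto simp: C_def)
    show "emeasure (tr_meas \<mu>) (Pc - C) = 0" unfolding emeas[OF *] 0 by simp
  qed (use sp in auto)
  from borel_prob_discrete[OF prob C this] obtain q
    where q: "set_pmf q \<subseteq> C" "tr_meas \<mu> = borel_of_pmf Pc q" by blast
  have pmf_sums: "(\<lambda>i. l i * rk X * indicator {X} (P i)) sums pmf q X" if X: "X \<in> Pc" for X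
  proof -
    have "ennreal (pmf q X) = emeasure (tr_meas \<mu>) {X}"
      using singleton_in_sets_restrict_borel[OF X]
      by (simp add: q(2) emeasure_borel_of_pmf emeasure_pmf_single)
    also have "\<dots> = (\<Sum>i. ennreal (l i * rk (P i) * indicator {X} (P i)))"
      by (rule emeas[OF singleton_in_sets_restrict_borel[OF X]])
    also have "\<dots> = (\<Sum>i. ennreal (l i * rk X * indicator {X} (P i)))"
      by (intro suminf_cong) (auto simp: indicator_def)
    finally have "(\<lambda>i. ennreal (l i * rk X * indicator {X} (P i))) sums ennreal (pmf q X)"
      by (simp add: sums_iff)
    then show ?thesis using l by (subst (asm) sums_ennreal) auto
  qed
  have weight: "(l has_sum pmf q X / rk X) {i \<in> I. P i = X}" if X: "X \<in> C" for X
  proof -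
    have "X \<in> Pc" "X \<noteq> 0" using X C by (auto simp: C_def I_def)
    then have r: "rk X > 0" using rk_ge_1[of X] by simp
    have "(\<lambda>i. l i * indicator {X} (P i)) sums (pmf q X / rk X)"
      using sums_divide[OF pmf_sums[OF \<open>X \<in> Pc\<close>], of "rk X"] r by (simp add: mult_ac)
    then have "((\<lambda>i. l i * indicator {X} (P i)) has_sum (pmf q X / rk X)) UNIV"
      using l by (intro sums_nonneg_imp_has_sum) auto
    then show ?thesis
      by (rule has_sum_cong_neutral[THEN iffD1, rotated 3])
         (use l \<open>X \<noteq> 0\<close> in \<open>auto simp: I_def indicator_def less_le\<close>)
  qed
  have "summable (\<lambda>i. norm (l i *\<^sub>R op_of (P i)))"
  proof (rule summable_comparison_test', rule summable_suminf_not_top)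
    have "(\<Sum>i. ennreal (l i * rk (P i) * indicator Pc (P i))) = emeasure (tr_meas \<mu>) Pc"
      using sets.top[of "restrict_space borel Pc"] by (intro emeas[symmetric]) (simp add: space_restrict_space)
    also have "\<dots> = 1" using prob sp by (auto simp: borel_prob_def dest: prob_space.emeasure_space_1)
    finally show "(\<Sum>i. ennreal (l i * rk (P i) * indicator Pc (P i))) \<noteq> top" by simp
    show "norm (norm (l i *\<^sub>R op_of (P i))) \<le> l i * rk (P i) * indicator Pc (P i)" for i
    proof (cases "P i = 0")
      case False
      have "l i * norm (op_of (P i)) \<le> l i * real (rk (P i))"
        using norm_projection_le_1[OF P, of i] rk_ge_1[OF P False] l[of i] by (intro mult_left_mono) auto
      then show ?thesis using P l by simp
    qed (use l in \<open>simp add: zero_sa_hs.rep_eq\<close>)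
  qed (use l in auto)
  from norm_summable_imp_has_sum[OF this sums]
  have "((\<lambda>i. l i *\<^sub>R op_of (P i)) has_sum density_matrix \<phi>) I"
    by (rule has_sum_cong_neutral[THEN iffD1, rotated 3])
       (use l in \<open>auto simp: I_def zero_sa_hs.rep_eq less_le\<close>)
  also have "?this \<longleftrightarrow> ((\<lambda>(X, i). l i *\<^sub>R op_of X) has_sum density_matrix \<phi>) (SIGMA X:C. {i \<in> I. P i = X})"
    by (rule has_sum_reindex_bij_witness[of _ snd "\<lambda>i. (P i, i)"]) (auto simp: C_def)
  finally have "((\<lambda>X. (pmf q X / rk X) *\<^sub>R op_of X) has_sum density_matrix \<phi>) C"
  proof (rule has_sum_SigmaD)
    fix X assume "X \<in> C"
    from has_sum_bounded_linear[OF bounded_linear_scaleR_left weight[OF this]]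
    show "((\<lambda>i. case (X, i) of (X, i) \<Rightarrow> l i *\<^sub>R op_of X) has_sum (pmf q X / rk X) *\<^sub>R op_of X) {i \<in> I. P i = X}"
      by simp
  qed
  then have "((\<lambda>X. (pmf q X / rk X) *\<^sub>R op_of X) has_sum density_matrix \<phi>) (set_pmf q)"
    by (rule has_sum_cong_neutral[THEN iffD1, rotated 3]) (use q(1) in \<open>auto simp: set_pmf_iff\<close>)
  moreover have "set_pmf q \<subseteq> Pc - {0}" using q(1) C by (auto simp: C_def I_def)
  moreover have "inner X Y = 0" if "X \<in> set_pmf q" "Y \<in> set_pmf q" "X \<noteq> Y" for X Y
  proof -
    have "X \<in> msupport \<mu>" "Y \<in> msupport \<mu>"
      using that q(1) weighted_diracs_support[of l P, OF l P] by (auto simp: C_def I_def \<mu>_eq)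
    from orth[OF this that(3)] show ?thesis by (simp add: inner_sa_hs_def)
  qed
  ultimately show ?thesis using q(2) unfolding orthogonal_decomposition_def by blast
qed

subsection \<open>From rank one mass functions to measures\<close>

text \<open>The weights are the masses of the image of \<open>q\<close> under an enumeration of its support; they vanish at
  indices that do not enumerate anything.\<close>

lemma borel_of_pmf_eq_weighted_diracs:
  fixes q :: "'a::chilbert_space sa_hs pmf"
  assumes q: "set_pmf q \<subseteq> Pc" and sum: "((\<lambda>X. pmf q X *\<^sub>R op_of X) has_sum \<rho>) (set_pmf q)"
  shows "\<exists>l P. (\<forall>i. l i \<ge> 0) \<and> (\<forall>i. P i \<in> Pc) \<and> borel_of_pmf Pc q = weighted_diracs l P \<and>
    (\<lambda>i. l i *\<^sub>R op_of (P i)) sums \<rho>"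
proof -
  define T where "T = set_pmf q"
  have T: "countable T" "T \<noteq> {}" by (simp_all add: T_def set_pmf_not_empty)
  define q' where "q' = map_pmf (to_nat_on T) q"
  define P where "P = from_nat_into T"
  have P: "P i \<in> Pc" for i using q from_nat_into[OF T(2), of i] by (auto simp: P_def T_def)
  have P_inv: "P (to_nat_on T X) = X" if "X \<in> T" for X
    unfolding P_def using T(1) that by (rule from_nat_into_to_nat_on)
  have inj: "inj_on (to_nat_on T) (set_pmf q)" using inj_on_to_nat_on[OF T(1)] by (simp add: T_def)
  have q_eq: "map_pmf P q' = q"
    unfolding q'_def map_pmf_comp by (rule map_pmf_idI) (simp add: P_inv[unfolded T_def] T_def)
  have "weighted_diracs (pmf q') P = distr (measure_pmf q') (restrict_space borel Pc) P"
    unfolding weighted_diracs_def measure_pmf_eq_density[of q'] ..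
  moreover have "\<dots> = borel_of_pmf Pc q"
  proof (rule measure_eqI)
    fix B assume "B \<in> sets (distr (measure_pmf q') (restrict_space borel Pc) P)"
    then have B: "B \<in> sets (restrict_space borel Pc)" by simp
    have "emeasure (distr (measure_pmf q') (restrict_space borel Pc) P) B = emeasure (measure_pmf q') (P -` B)"
      using B P by (subst emeasure_distr) (auto simp: measurable_def space_restrict_space)
    also have "\<dots> = emeasure (measure_pmf q) B" by (simp flip: q_eq)
    finally show "emeasure (distr (measure_pmf q') (restrict_space borel Pc) P) B = emeasure (borel_of_pmf Pc q) B"
      using B by (simp add: emeasure_borel_of_pmf)
  qed simp
  moreover have "((\<lambda>n. pmf q' n *\<^sub>R op_of (P n)) has_sum \<rho>) (to_nat_on T ` set_pmf q)"
    unfolding has_sum_reindex[OF inj]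
    by (rule has_sum_cong[THEN iffD1, OF _ sum]) (simp add: q'_def pmf_map_inj[OF inj] P_inv flip: T_def)
  then have "((\<lambda>n. pmf q' n *\<^sub>R op_of (P n)) has_sum \<rho>) UNIV"
    by (rule has_sum_cong_neutral[THEN iffD1, rotated 3]) (auto simp: q'_def set_pmf_iff[symmetric] pmf_eq_0_set_pmf)
  then have "(\<lambda>n. pmf q' n *\<^sub>R op_of (P n)) sums \<rho>" by (rule has_sum_imp_sums)
  ultimately show ?thesis using P by (intro exI[of _ "pmf q'"] exI[of _ P]) simp
qed

text \<open>Distinct orthogonal projections of rank one are at distance $\sqrt 2$, so the atoms do not accumulate
  and the support consists of atoms only.\<close>

lemma msupport_rank_one:
  fixes q :: "'a::chilbert_space sa_hs pmf"
  assumes q: "set_pmf q \<subseteq> Pr 1"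
    and orth: "\<And>X Y. X \<in> set_pmf q \<Longrightarrow> Y \<in> set_pmf q \<Longrightarrow> X \<noteq> Y \<Longrightarrow> inner X Y = 0"
  shows "msupport (borel_of_pmf Pc q) \<subseteq> set_pmf q"
proof
  fix Z assume Z: "Z \<in> msupport (borel_of_pmf Pc q)"
  have pos: "set_pmf q \<inter> U \<noteq> {}" if U: "open U" "Z \<in> U" for U
  proof -
    have "emeasure (borel_of_pmf Pc q) (U \<inter> Pc) > 0" using Z U by (simp add: msupport_def)
    moreover have "U \<inter> Pc \<in> sets (restrict_space borel Pc)" by (rule open_Int_in_sets_restrict_borel[OF U(1)])
    ultimately have "emeasure (measure_pmf q) (U \<inter> Pc) \<noteq> 0" by (simp add: emeasure_borel_of_pmf)
    then show ?thesis
      by (auto simp: measure_pmf.emeasure_eq_measure measure_pmf_zero_iff)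
  qed
  have norm1: "inner X X = 1" if "X \<in> set_pmf q" for X
  proof -
    have "X \<in> Pr 1" using that q by blast
    then show ?thesis using trace_Pc(2)[OF Pr_subset_Pc] Pr_rk by fastforce
  qed
  have far: "X = Y" if "X \<in> set_pmf q" "Y \<in> set_pmf q" "dist X Y < 1" for X Y
  proof (rule ccontr)
    assume "X \<noteq> Y"
    have "(dist X Y)\<^sup>2 = inner X X + inner Y Y - 2 * inner X Y"
      by (simp add: dist_norm power2_norm_eq_inner inner_diff_left inner_diff_right inner_commute)
    then have "(dist X Y)\<^sup>2 = 2" using orth[OF that(1,2) \<open>X \<noteq> Y\<close>] norm1 that by simp
    moreover have "(dist X Y)\<^sup>2 < 1" using that(3) by (simp add: abs_square_less_1)
    ultimately show False by simp
  qed
  obtain X where X: "X \<in> set_pmf q" "dist Z X < 1/2"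
    using pos[of "ball Z (1/2)"] by auto
  show "Z \<in> set_pmf q"
  proof (rule ccontr)
    assume "Z \<notin> set_pmf q"
    then have "0 < dist Z X" using X by auto
    then obtain Y where Y: "Y \<in> set_pmf q" "dist Z Y < dist Z X"
      using pos[of "ball Z (dist Z X)"] by auto
    have "dist X Y < 1" using X Y dist_triangle2[of X Y Z] by (simp add: dist_commute)
    then have "X = Y" using far X Y by blast
    then show False using Y by simp
  qed
qed

lemma line_proj_basis_Pr1:
  fixes X :: "'a::chilbert_space sa_hs"
  assumes "X \<in> Pr 1" "e \<in> proj_basis X"
  shows "X = line_proj (e 0)"
  using proj_basis_sum[OF Pr_subset_Pc[OF assms(1)] assms(2)] Pr_rk[OF assms(1)] by simp

lemma rank_one_decomposition_in_Lambda_perp: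
  fixes q :: "'a::chilbert_space sa_hs pmf"
  assumes dec: "orthogonal_decomposition (density_matrix \<phi>) q" and q: "set_pmf q \<subseteq> Pr 1"
  shows "borel_of_pmf Pc q \<in> Lambda_perp \<phi> \<inter> prob_on_Pr 1"
proof -
  note orth = orthogonal_decompositionD(2)[OF dec]
  have qPc: "set_pmf q \<subseteq> Pc" using q Pr_subset_Pc by blast
  have "((\<lambda>X. (pmf q X / rk X) *\<^sub>R op_of X) has_sum density_matrix \<phi>) (set_pmf q)"
    by (rule orthogonal_decompositionD(3)[OF dec])
  then have "((\<lambda>X. pmf q X *\<^sub>R op_of X) has_sum density_matrix \<phi>) (set_pmf q)"
    by (rule has_sum_cong[THEN iffD1, rotated]) (use q in \<open>auto dest!: subsetD simp: Pr_def\<close>)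
  from borel_of_pmf_eq_weighted_diracs[OF qPc this]
  have wd: "\<exists>l P. (\<forall>i. l i \<ge> 0) \<and> (\<forall>i. P i \<in> Pc) \<and> borel_of_pmf Pc q = weighted_diracs l P \<and>
    (\<lambda>i. l i *\<^sub>R op_of (P i)) sums density_matrix \<phi>" .
  have pr: "borel_of_pmf Pc q \<in> borel_prob Pc" by (rule borel_of_pmf_in_borel_prob[OF qPc])
  moreover have "AE X in borel_of_pmf Pc q. X \<in> Pr 1" using q by (auto simp: AE_borel_of_pmf[OF qPc])
  ultimately have pr1: "borel_of_pmf Pc q \<in> prob_on_Pr 1" by (simp add: prob_on_Pr_def)
  have "op_trace (op_of X o\<^sub>L op_of Y) = 0"
    if "X \<in> msupport (borel_of_pmf Pc q)" "Y \<in> msupport (borel_of_pmf Pc q)" "X \<noteq> Y" for X Y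
  proof -
    have XY: "X \<in> set_pmf q" "Y \<in> set_pmf q" using that msupport_rank_one[OF q orth] by blast+
    then have Pr: "X \<in> Pr 1" "Y \<in> Pr 1" using q by blast+
    note Pc = Pr_subset_Pc[OF Pr(1)] Pr_subset_Pc[OF Pr(2)]
    obtain e f where ef: "e \<in> proj_basis X" "f \<in> proj_basis Y"
      using proj_basis_nonempty[OF Pc(1)] proj_basis_nonempty[OF Pc(2)] by blast
    have "cinner (e 0) (f 0) = 0"
      using inner_zero_basis_orthogonal[OF Pc(1) ef(1) Pc(2) ef(2) orth[OF XY that(3)]] Pr_rk[OF Pr(1)] Pr_rk[OF Pr(2)]
      by simp
    then have "op_of X o\<^sub>L op_of Y = 0"
      unfolding line_proj_basis_Pr1[OF Pr(1) ef(1)] line_proj_basis_Pr1[OF Pr(2) ef(2)]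
      by (intro blinfun_eqI) (simp add: line_proj_apply cinner_simps)
    then show ?thesis by (simp add: op_trace_def)
  qed
  then have "borel_of_pmf Pc q \<in> D1_perp"
    unfolding D1_perp_def using wd pr tr_meas_rank_one[OF pr1] by auto
  then show ?thesis using wd pr1 unfolding Lambda_perp_def by blast
qed

subsection \<open>Splitting projections into lines\<close>

definition split_pmf :: "('a::complex_inner sa_hs \<Rightarrow> nat \<Rightarrow> 'a) \<Rightarrow> 'a sa_hs pmf \<Rightarrow> 'a sa_hs pmf" where
  "split_pmf e q = bind_pmf q (\<lambda>X. map_pmf (\<lambda>k. line_proj (e X k)) (pmf_of_set {..<rk X}))"

text \<open>The lines of all bases are pairwise orthogonal, within one projection and across distinct ones. In particular
  they are distinct, so each line of \<open>X\<close> receives the mass \<open>pmf q X / rk X\<close>, and the lines of \<open>X\<close>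
  add up to \<open>X\<close>.\<close>

lemma split_pmf_decomposition:
  fixes q :: "'a::chilbert_space sa_hs pmf"
  assumes dec: "orthogonal_decomposition \<rho> q" and e: "\<And>X. X \<in> set_pmf q \<Longrightarrow> e X \<in> proj_basis X"
  shows "orthogonal_decomposition \<rho> (split_pmf e q)" and "set_pmf (split_pmf e q) \<subseteq> Pr 1"
proof -
  have q: "X \<in> Pc" "rk X > 0" if "X \<in> set_pmf q" for X
  proof -
    have "X \<in> Pc - {0}" using orthogonal_decompositionD(1)[OF dec] that by (rule subsetD)
    then have "X \<in> Pc" "X \<noteq> 0" by simp_all
    then show "X \<in> Pc" "rk X > 0" using rk_ge_1[of X] by linarith+
  qed
  note orth = orthogonal_decompositionD(2)[OF dec]
  note sum = orthogonal_decompositionD(3)[OF dec]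
  define T where "T = (SIGMA X:set_pmf q. {..<rk X})"
  define h where "h = (\<lambda>(X, k). line_proj (e X k))"
  have set: "set_pmf (split_pmf e q) = h ` T"
    using q by (force simp: split_pmf_def h_def T_def lessThan_empty_iff)
  have unit: "norm (e X k) = 1" if "(X, k) \<in> T" for X k
    using that e orthonormal_norm unfolding T_def proj_basis_def by fastforce
  show Pr1: "set_pmf (split_pmf e q) \<subseteq> Pr 1"
    using unit line_proj_Pr1 unfolding set h_def by fastforce
  have cross: "inner (h s) (h t) = (if s = t then 1 else 0)" if "s \<in> T" "t \<in> T" for s t
  proof -
    obtain X k Y m where st: "s = (X, k)" "t = (Y, m)" by (cases s, cases t)
    then have T: "X \<in> set_pmf q" "k < rk X" "Y \<in> set_pmf q" "m < rk Y" using that by (auto simp: T_def)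
    have "cinner (e X k) (e Y m) = (if s = t then 1 else 0)"
    proof (cases "X = Y")
      case True
      then show ?thesis using e[OF T(1)] T st by (simp add: proj_basis_def orthonormal_def)
    next
      case False
      from inner_zero_basis_orthogonal[OF q(1)[OF T(1)] e[OF T(1)] q(1)[OF T(3)] e[OF T(3)] orth[OF T(1,3) this] T(2,4)]
      show ?thesis using False st by simp
    qed
    then show ?thesis by (simp add: st h_def inner_line_proj_line_proj)
  qed
  have inj: "inj_on h T" by (rule inj_onI) (metis cross zero_neq_one)
  have pmf: "pmf (split_pmf e q) (h (X, k)) = pmf q X / rk X" if XT: "(X, k) \<in> T" for X k
  proof -
    have XQ: "X \<in> set_pmf q" "k < rk X" using XT by (auto simp: T_def)
    have "ennreal (pmf (split_pmf e q) (h (X, k)))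
        = (\<integral>\<^sup>+Y. pmf (map_pmf (\<lambda>k. line_proj (e Y k)) (pmf_of_set {..<rk Y})) (h (X, k)) \<partial>measure_pmf q)"
      unfolding split_pmf_def by (rule ennreal_pmf_bind)
    also have "\<dots> = (\<integral>\<^sup>+Y. ennreal (1 / rk X) * indicator {X} Y \<partial>measure_pmf q)"
    proof (intro nn_integral_cong_AE, subst AE_measure_pmf_iff, intro ballI)
      fix Y assume Y: "Y \<in> set_pmf q"
      have ne: "{..<rk Y} \<noteq> {}" using q(2)[OF Y] by (auto simp: lessThan_empty_iff)
      show "ennreal (pmf (map_pmf (\<lambda>k. line_proj (e Y k)) (pmf_of_set {..<rk Y})) (h (X, k)))
        = ennreal (1 / rk X) * indicator {X} Y"
      proof (cases "Y = X")
        case True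
        have "inj_on (\<lambda>k. line_proj (e X k)) {..<rk X}"
          by (rule inj_onI) (use inj XQ in \<open>auto simp: inj_on_def h_def T_def\<close>)
        then have "pmf (map_pmf (\<lambda>k. line_proj (e X k)) (pmf_of_set {..<rk X})) (line_proj (e X k)) = 1 / rk X"
          using ne XQ True by (subst pmf_map_inj) auto
        then show ?thesis using True by (simp add: h_def)
      next
        case False
        have "h (X, k) \<notin> (\<lambda>k. line_proj (e Y k)) ` {..<rk Y}"
        proof
          assume "h (X, k) \<in> (\<lambda>k. line_proj (e Y k)) ` {..<rk Y}"
          then obtain m where "m < rk Y" "h (X, k) = h (Y, m)" by (auto simp: h_def)
          then show False using inj XT Y False by (auto simp: inj_on_def T_def)
        qed
        then have "pmf (map_pmf (\<lambda>k. line_proj (e Y k)) (pmf_of_set {..<rk Y})) (h (X, k)) = 0"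
          using ne by (simp add: pmf_eq_0_set_pmf)
        then show ?thesis using False by simp
      qed
    qed
    also have "\<dots> = ennreal (1 / rk X) * ennreal (pmf q X)"
      by (simp add: nn_integral_cmult emeasure_pmf_single)
    also have "\<dots> = ennreal (pmf q X / rk X)" by (simp add: ennreal_mult'[symmetric])
    finally show ?thesis by simp
  qed
  have "(\<lambda>(X, k). (pmf q X / rk X) *\<^sub>R op_of (line_proj (e X k))) summable_on T"
  proof (rule abs_summable_summable, rule summable_on_comparison_test)
    have "pmf (split_pmf e q) summable_on h ` T"
    proof (rule nonneg_bdd_above_summable_on)
      show "bdd_above (sum (pmf (split_pmf e q)) ` {F. F \<subseteq> h ` T \<and> finite F})"
        by (rule bdd_aboveI[of _ 1]) (auto simp: measure_measure_pmf_finite[symmetric])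
    qed simp
    then show "(pmf (split_pmf e q) \<circ> h) summable_on T" by (simp add: summable_on_reindex[OF inj])
    fix s assume s: "s \<in> T"
    obtain X k where Xk: "s = (X, k)" by (cases s)
    have "norm (op_of (line_proj (e X k))) \<le> 1"
      using s Xk unit line_proj_Pr1 Pr_subset_Pc by (intro norm_projection_le_1) blast
    then have "pmf q X / rk X * norm (op_of (line_proj (e X k))) \<le> pmf q X / rk X * 1"
      by (intro mult_left_mono) auto
    then show "norm (case s of (X, k) \<Rightarrow> (pmf q X / rk X) *\<^sub>R op_of (line_proj (e X k))) \<le> (pmf (split_pmf e q) \<circ> h) s"
      using pmf s Xk by simp
  qed simp
  moreover have "((\<lambda>k. case (X, k) of (X, k) \<Rightarrow> (pmf q X / rk X) *\<^sub>R op_of (line_proj (e X k)))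
      has_sum (pmf q X / rk X) *\<^sub>R op_of X) {..<rk X}" if "X \<in> set_pmf q" for X
  proof -
    have "op_of X = (\<Sum>k<rk X. op_of (line_proj (e X k)))"
      unfolding op_of_sum[symmetric] using proj_basis_sum[OF q(1) e] that by simp
    then show ?thesis using has_sum_finite[of "{..<rk X}" "\<lambda>k. (pmf q X / rk X) *\<^sub>R op_of (line_proj (e X k))"]
      by (simp add: scaleR_sum_right)
  qed
  ultimately have "((\<lambda>(X, k). (pmf q X / rk X) *\<^sub>R op_of (line_proj (e X k))) has_sum \<rho>) T"
    unfolding T_def by (intro has_sum_SigmaI[OF _ sum]) 
  then have "((\<lambda>Z. pmf (split_pmf e q) Z *\<^sub>R op_of Z) has_sum \<rho>) (h ` T)"
    unfolding has_sum_reindex[OF inj]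
    by (rule has_sum_cong[THEN iffD1, rotated]) (use pmf in \<open>auto simp: h_def\<close>)
  then have "((\<lambda>Z. (pmf (split_pmf e q) Z / rk Z) *\<^sub>R op_of Z) has_sum \<rho>) (set_pmf (split_pmf e q))"
    unfolding set by (rule has_sum_cong[THEN iffD1, rotated]) (use Pr1 set in \<open>auto dest!: subsetD simp: Pr_def\<close>)
  moreover have "set_pmf (split_pmf e q) \<subseteq> Pc - {0}"
    using Pr1 Pr_subset_Pc rk_eq_0_iff[of "0 :: 'a sa_hs"] by (force simp: Pr_def)
  moreover have "inner X Y = 0" if "X \<in> set_pmf (split_pmf e q)" "Y \<in> set_pmf (split_pmf e q)" "X \<noteq> Y" for X Y
    using that cross unfolding set by auto
  ultimately show "orthogonal_decomposition \<rho> (split_pmf e q)"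
    unfolding orthogonal_decomposition_def by blast
qed

section \<open>Couplings of the lines\<close>

text \<open>The integral formula yields both the marginals and the cost of the new plan.\<close>

lemma pmf_replace_on_finite:
  fixes N :: "'b pmf"
  assumes F: "finite F" "F \<subseteq> set_pmf N" and u: "\<And>z. z \<in> F \<Longrightarrow> u z \<ge> 0" and sum: "sum u F = sum (pmf N) F"
  shows "\<exists>M. set_pmf M \<subseteq> set_pmf N \<and> (\<forall>z\<in>F. pmf M z = u z) \<and>
    (\<forall>g. (\<integral>\<^sup>+z. g z \<partial>measure_pmf M)
      = (\<Sum>z\<in>F. ennreal (u z) * g z) + (\<integral>\<^sup>+z. g z * indicator (- F) z \<partial>measure_pmf N))"
proof -
  define w where "w z = (if z \<in> F then u z else pmf N z)" for z
  have w: "w z \<ge> 0" for z using u by (simp add: w_def)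
  have int: "(\<integral>\<^sup>+z. ennreal (w z) * g z \<partial>count_space UNIV)
      = (\<Sum>z\<in>F. ennreal (u z) * g z) + (\<integral>\<^sup>+z. g z * indicator (- F) z \<partial>measure_pmf N)" for g
  proof -
    have "(\<integral>\<^sup>+z. ennreal (w z) * g z \<partial>count_space UNIV)
      = (\<integral>\<^sup>+z. (ennreal (u z) * g z) * indicator F z + ennreal (pmf N z) * (g z * indicator (- F) z) \<partial>count_space UNIV)"
      by (intro nn_integral_cong) (simp add: w_def indicator_def)
    also have "\<dots> = (\<integral>\<^sup>+z. (ennreal (u z) * g z) * indicator F z \<partial>count_space UNIV)
        + (\<integral>\<^sup>+z. ennreal (pmf N z) * (g z * indicator (- F) z) \<partial>count_space UNIV)"
      by (intro nn_integral_add) auto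
    also have "(\<integral>\<^sup>+z. (ennreal (u z) * g z) * indicator F z \<partial>count_space UNIV) = (\<Sum>z\<in>F. ennreal (u z) * g z)"
      using F by (simp add: nn_integral_count_space_indicator[symmetric] nn_integral_count_space_finite)
    finally show ?thesis by (simp add: nn_integral_measure_pmf)
  qed
  have "(\<integral>\<^sup>+z. ennreal (w z) \<partial>count_space UNIV) = ennreal (sum u F) + emeasure (measure_pmf N) (- F)"
    using int[of "\<lambda>_. 1"] u by (simp add: sum_ennreal)
  also have "ennreal (sum u F) = emeasure (measure_pmf N) F"
    unfolding sum using F by (simp add: emeasure_measure_pmf_finite sum_ennreal)
  also have "emeasure (measure_pmf N) F + emeasure (measure_pmf N) (- F) = emeasure (measure_pmf N) (F \<union> - F)"
    by (rule plus_emeasure) auto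
  also have "\<dots> = 1" by (simp add: measure_pmf.emeasure_space_1[simplified])
  finally have one: "(\<integral>\<^sup>+z. ennreal (w z) \<partial>count_space UNIV) = 1" .
  define M where "M = embed_pmf w"
  have M: "pmf M z = w z" for z unfolding M_def by (rule pmf_embed_pmf[OF w one])
  have "set_pmf M \<subseteq> set_pmf N" using F(2) by (auto simp: set_pmf_iff M w_def split: if_splits)
  then show ?thesis by (intro exI[of _ M]) (simp add: nn_integral_measure_pmf[of M] M int, simp add: w_def)
qed

lemma map_pmf_eqI_nn_integral:
  assumes "\<And>x. (\<integral>\<^sup>+z. indicator {x} (h z) \<partial>measure_pmf M) = (\<integral>\<^sup>+z. indicator {x} (h z) \<partial>measure_pmf N)"
  shows "map_pmf h M = map_pmf h N"
proof (rule pmf_eqI)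
  fix x
  have "ennreal (pmf (map_pmf h L) x) = (\<integral>\<^sup>+z. indicator {x} (h z) \<partial>measure_pmf L)" for L
    unfolding emeasure_pmf_single[symmetric]
    by (subst nn_integral_indicator[symmetric]) simp_all
  then show "pmf (map_pmf h M) x = pmf (map_pmf h N) x"
    using assms[of x] by (metis ennreal_inj pmf_nonneg)
qed

lemma pmf_finite_approximation:
  fixes N :: "'b pmf"
  assumes "\<epsilon> > 0"
  shows "\<exists>F. finite F \<and> F \<subseteq> set_pmf N \<and> emeasure (measure_pmf N) (- F) \<le> ennreal \<epsilon>"
proof -
  define A where "A n = {x \<in> set_pmf N. to_nat_on (set_pmf N) x < n}" for n
  have inj: "inj_on (to_nat_on (set_pmf N)) (A n)" for n
    by (rule inj_on_subset[OF inj_on_to_nat_on]) (auto simp: A_def)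
  have fin: "finite (A n)" for n
    by (rule finite_imageD[OF _ inj]) (auto simp: A_def intro: finite_subset[of _ "{..<n}"])
  have "(\<lambda>n. measure (measure_pmf N) (A n)) \<longlonglongrightarrow> measure (measure_pmf N) (\<Union>n. A n)"
    by (rule measure_pmf.finite_Lim_measure_incseq) (auto simp: incseq_def A_def)
  also have "(\<Union>n. A n) = set_pmf N" by (auto simp: A_def)
  also have "measure (measure_pmf N) (set_pmf N) = 1"
    by (simp add: measure_pmf.prob_eq_1 AE_measure_pmf)
  finally obtain n where n: "\<bar>measure (measure_pmf N) (A n) - 1\<bar> < \<epsilon>"
    using assms LIMSEQ_D[of _ 1 \<epsilon>] by fastforce
  have "measure (measure_pmf N) (- A n) = 1 - measure (measure_pmf N) (A n)"
    using measure_pmf.prob_compl[of "A n" N] by (simp add: Compl_eq_Diff_UNIV)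
  then have "measure (measure_pmf N) (- A n) \<le> \<epsilon>" using n by simp
  then show ?thesis
    using fin by (intro exI[of _ "A n"]) (auto simp: A_def measure_pmf.emeasure_eq_measure ennreal_leI)
qed

lemma ennpowr_mono: "x \<le> y \<Longrightarrow> a \<ge> 0 \<Longrightarrow> ennpowr x a \<le> ennpowr y a"
  unfolding ennpowr_def
  by (auto intro!: ennreal_leI powr_mono2 enn2real_mono simp: top.not_eq_extremum top_unique)

lemma borel_fst_snd_measurable:
  "fst \<in> restrict_space borel (A \<times> B) \<rightarrow>\<^sub>M restrict_space borel (A :: 'a::topological_space set)"
  "snd \<in> restrict_space borel (A \<times> B) \<rightarrow>\<^sub>M restrict_space borel (B :: 'b::topological_space set)"
  by (rule measurable_restrict_space3; auto intro!: borel_measurable_continuous_onI continuous_intros)+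

text \<open>A coupling of discrete measures is carried by the product of two countable sets.\<close>

lemma coupling_of_pmfs:
  fixes q0 q1 :: "'a::chilbert_space sa_hs pmf"
  assumes \<nu>: "\<nu> \<in> couplings (borel_of_pmf Pc q0) (borel_of_pmf Pc q1)"
    and q: "set_pmf q0 \<subseteq> Pc" "set_pmf q1 \<subseteq> Pc"
  shows "\<exists>N. \<nu> = borel_of_pmf (Pc \<times> Pc) N \<and> set_pmf N \<subseteq> Pc \<times> Pc \<and> map_pmf fst N = q0 \<and>
    map_pmf snd N = q1 \<and> (\<forall>(X, Y)\<in>set_pmf N. rk X = rk Y)"
proof -
  have prob: "\<nu> \<in> borel_prob (Pc \<times> Pc)" and rk: "AE (X, Y) in \<nu>. rk X = rk Y"
    and fst: "distr \<nu> (restrict_space borel Pc) fst = borel_of_pmf Pc q0"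
    and snd: "distr \<nu> (restrict_space borel Pc) snd = borel_of_pmf Pc q1"
    using \<nu> by (auto simp: couplings_def)
  have sets: "sets \<nu> = sets (restrict_space borel (Pc \<times> Pc))" using prob by (simp add: borel_prob_def)
  have m: "fst \<in> \<nu> \<rightarrow>\<^sub>M restrict_space borel Pc" "snd \<in> \<nu> \<rightarrow>\<^sub>M restrict_space borel Pc"
    using borel_fst_snd_measurable[of Pc Pc] by (simp_all add: measurable_cong_sets[OF sets refl])
  have fst_AE: "AE x in distr \<nu> (restrict_space borel Pc) fst. x \<in> set_pmf q0"
    unfolding fst AE_borel_of_pmf[OF q(1)] by blast
  have snd_AE: "AE x in distr \<nu> (restrict_space borel Pc) snd. x \<in> set_pmf q1"
    unfolding snd AE_borel_of_pmf[OF q(2)] by blast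
  have "AE z in \<nu>. z \<in> set_pmf q0 \<times> set_pmf q1"
    using AE_distrD[OF m(1) fst_AE] AE_distrD[OF m(2) snd_AE] by eventually_elim (auto simp: mem_Times_iff)
  from borel_prob_discrete[OF prob _ Sigma_mono[OF q(1) q(2)] this] obtain N
    where N: "set_pmf N \<subseteq> set_pmf q0 \<times> set_pmf q1" "\<nu> = borel_of_pmf (Pc \<times> Pc) N" by auto
  have NPc: "set_pmf N \<subseteq> Pc \<times> Pc" using N(1) Sigma_mono[OF q(1) q(2)] by (rule order_trans)
  have "map_pmf fst N = q0"
  proof (rule borel_of_pmf_inject[of Pc])
    show "borel_of_pmf Pc (map_pmf fst N) = borel_of_pmf Pc q0"
      using fst unfolding N(2) distr_borel_of_pmf[OF borel_fst_snd_measurable(1) NPc] .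
  qed (use NPc q in auto)
  moreover have "map_pmf snd N = q1"
  proof (rule borel_of_pmf_inject[of Pc])
    show "borel_of_pmf Pc (map_pmf snd N) = borel_of_pmf Pc q1"
      using snd unfolding N(2) distr_borel_of_pmf[OF borel_fst_snd_measurable(2) NPc] .
  qed (use NPc q in auto)
  moreover have "\<forall>(X, Y)\<in>set_pmf N. rk X = rk Y"
    using rk unfolding N(2) AE_borel_of_pmf[OF NPc] .
  ultimately show ?thesis using N(2) NPc by blast
qed

lemma pmf_coupling_in_couplings:
  fixes K :: "('a::chilbert_space sa_hs \<times> 'a sa_hs) pmf"
  assumes K: "set_pmf K \<subseteq> Pc \<times> Pc" and rk: "\<And>X Y. (X, Y) \<in> set_pmf K \<Longrightarrow> rk X = rk Y"
  shows "borel_of_pmf (Pc \<times> Pc) K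
    \<in> couplings (borel_of_pmf Pc (map_pmf fst K)) (borel_of_pmf Pc (map_pmf snd K))"
  using borel_of_pmf_in_borel_prob[OF K] rk
  by (auto simp: couplings_def distr_borel_of_pmf[OF borel_fst_snd_measurable(1) K]
      distr_borel_of_pmf[OF borel_fst_snd_measurable(2) K] AE_borel_of_pmf[OF K])

text \<open>A plan for projections is changed on a finite part of its support that carries almost all of the mass.
  There the bases are aligned along the new support; on the rest the lines are matched arbitrarily,
  which is cheap because distances between lines are bounded.\<close>

lemma split_plan:
  fixes N :: "('a::chilbert_space sa_hs \<times> 'a sa_hs) pmf"
  assumes N: "set_pmf N \<subseteq> (Pc - {0}) \<times> (Pc - {0})" and rk: "\<forall>(X, Y)\<in>set_pmf N. rk X = rk Y"
    and fin: "(\<integral>\<^sup>+(X, Y). ennpowr (geod_dist X Y) p \<partial>measure_pmf N) < \<infinity>" and p: "p \<ge> 0" and \<epsilon>: "\<epsilon> > 0"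
  shows "\<exists>e f K. (\<forall>X\<in>Pc. e X \<in> proj_basis X) \<and> (\<forall>Y\<in>Pc. f Y \<in> proj_basis Y)
    \<and> map_pmf fst K = split_pmf e (map_pmf fst N) \<and> map_pmf snd K = split_pmf f (map_pmf snd N)
    \<and> (\<integral>\<^sup>+(Z, W). ennpowr (geod_dist Z W) p \<partial>measure_pmf K)
      \<le> (\<integral>\<^sup>+(X, Y). ennpowr (geod_dist X Y) p \<partial>measure_pmf N) + ennpowr (ennreal (sqrt 2 * (pi / 2))) p * ennreal \<epsilon>"
proof -
  define d where "d = (\<lambda>(X::'a sa_hs, Y). ennpowr (geod_dist X Y) p)"
  define D where "D = ennpowr (ennreal (sqrt 2 * (pi / 2))) p"
  obtain F where F: "finite F" "F \<subseteq> set_pmf N" "emeasure (measure_pmf N) (- F) \<le> ennreal \<epsilon>"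
    using pmf_finite_approximation[OF \<epsilon>, of N] by blast
  have NPc: "X \<in> Pc" "Y \<in> Pc" "rk X = rk Y" "{..<rk X} \<noteq> {}" if "(X, Y) \<in> set_pmf N" for X Y
  proof -
    have "(X, Y) \<in> (Pc - {0}) \<times> (Pc - {0})" using N that by (rule subsetD)
    moreover have "rk X = rk Y" using rk that by auto
    ultimately show "X \<in> Pc" "Y \<in> Pc" "rk X = rk Y" "{..<rk X} \<noteq> {}"
      using rk_eq_0_iff[of X] by (simp_all add: lessThan_empty_iff)
  qed
  note FPc = NPc[OF subsetD[OF F(2)]]
  have sum_le: "(\<Sum>z\<in>F. ennreal (pmf N z) * d z) \<le> (\<integral>\<^sup>+z. d z \<partial>measure_pmf N)"
  proof -
    have "(\<Sum>z\<in>F. ennreal (pmf N z) * d z) = (\<integral>\<^sup>+z. d z * indicator F z \<partial>measure_pmf N)"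
      using F(1) by (subst nn_integral_measure_pmf_support[of F]) (auto simp: mult.commute intro!: sum.cong)
    then show ?thesis using nn_integral_mult_indicator_le by metis
  qed
  have finite_cost: "d z < \<infinity>" if "z \<in> F" for z
  proof -
    have "ennreal (pmf N z) * d z \<le> (\<Sum>z\<in>F. ennreal (pmf N z) * d z)"
      using F(1) that by (intro member_le_sum) auto
    also have "\<dots> < \<infinity>" using sum_le fin by (simp add: d_def order_le_less_trans)
    finally have "ennreal (pmf N z) * d z < \<infinity>" .
    moreover have "ennreal (pmf N z) \<noteq> 0" using that F(2) by (auto simp: set_pmf_iff less_le)
    ultimately show ?thesis by (auto simp: ennreal_mult_less_top)
  qed
  \<comment> \<open>The labelling needs nonempty label sets everywhere, also away from the projections.\<close>
  define B where "B X = (if X \<in> Pc then proj_basis X else UNIV)" for X :: "'a sa_hs"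
  have B: "B X \<noteq> {}" for X by (simp add: B_def proj_basis_nonempty)
  have "\<exists>u e f. labelled_plan (\<lambda>z. enn2real (d z)) B B aligned F (pmf N) u e f"
  proof (rule labelled_transport_plan[OF F(1) _ B B])
    fix X Y b assume XY: "(X, Y) \<in> F"
    show "b \<in> B X \<Longrightarrow> \<exists>f\<in>B Y. aligned X Y b f"
      using aligned_bases(1)[OF FPc(1-3)[OF XY]] FPc(1,2)[OF XY] by (simp add: B_def)
    show "b \<in> B Y \<Longrightarrow> \<exists>e\<in>B X. aligned X Y e b"
      using aligned_bases(2)[OF FPc(1-3)[OF XY]] FPc(1,2)[OF XY] by (simp add: B_def)
  qed simp
  then obtain u e f where plan: "labelled_plan (\<lambda>z. enn2real (d z)) B B aligned F (pmf N) u e f" by blast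
  have u: "\<And>z. z \<in> F \<Longrightarrow> u z \<ge> 0"
    and row: "\<And>X. (\<Sum>z | z \<in> F \<and> fst z = X. u z) = (\<Sum>z | z \<in> F \<and> fst z = X. pmf N z)"
    and col: "\<And>Y. (\<Sum>z | z \<in> F \<and> snd z = Y. u z) = (\<Sum>z | z \<in> F \<and> snd z = Y. pmf N z)"
    and cost: "(\<Sum>z\<in>F. u z * enn2real (d z)) \<le> (\<Sum>z\<in>F. pmf N z * enn2real (d z))"
    and lab: "\<And>X. e X \<in> B X" "\<And>Y. f Y \<in> B Y"
    and al: "\<And>X Y. (X, Y) \<in> F \<Longrightarrow> u (X, Y) > 0 \<Longrightarrow> aligned X Y (e X) (f Y)"
    using plan unfolding labelled_plan_def by auto
  have e: "e X \<in> proj_basis X" "f X \<in> proj_basis X" if "X \<in> Pc" for X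
    using lab[of X] that by (simp_all add: B_def)
  have total: "sum u F = sum (pmf N) F"
    using sum.image_gen[OF F(1), of u fst] sum.image_gen[OF F(1), of "pmf N" fst] by (simp add: row)
  from pmf_replace_on_finite[OF F(1,2) u total] obtain M where M: "set_pmf M \<subseteq> set_pmf N"
    "\<And>z. z \<in> F \<Longrightarrow> pmf M z = u z"
    "\<And>g. (\<integral>\<^sup>+z. g z \<partial>measure_pmf M)
      = (\<Sum>z\<in>F. ennreal (u z) * g z) + (\<integral>\<^sup>+z. g z * indicator (- F) z \<partial>measure_pmf N)" by blast
  have margin: "map_pmf h M = map_pmf h N"
    if h: "\<And>x. (\<Sum>z | z \<in> F \<and> h z = x. u z) = (\<Sum>z | z \<in> F \<and> h z = x. pmf N z)"
    for h :: "'a sa_hs \<times> 'a sa_hs \<Rightarrow> 'a sa_hs"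
  proof (rule map_pmf_eqI_nn_integral)
    fix x
    have eq: "(\<Sum>z\<in>F. ennreal (v z) * indicator {x} (h z)) = ennreal (\<Sum>z | z \<in> F \<and> h z = x. v z)"
      if "\<And>z. z \<in> F \<Longrightarrow> v z \<ge> 0" for v
    proof -
      have "(\<Sum>z\<in>F. ennreal (v z) * indicator {x} (h z)) = (\<Sum>z | z \<in> F \<and> h z = x. ennreal (v z))"
        using F(1) by (intro sum.mono_neutral_cong_right) (auto simp: indicator_def)
      also have "\<dots> = ennreal (\<Sum>z | z \<in> F \<and> h z = x. v z)"
        by (rule sum_ennreal) (use that in auto)
      finally show ?thesis .
    qed
    have "(\<integral>\<^sup>+z. indicator {x} (h z) \<partial>measure_pmf N)
      = (\<Sum>z\<in>F. ennreal (pmf N z) * indicator {x} (h z)) + (\<integral>\<^sup>+z. indicator {x} (h z) * indicator (- F) z \<partial>measure_pmf N)"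
    proof -
      have "(\<integral>\<^sup>+z. indicator {x} (h z) \<partial>measure_pmf N)
        = (\<integral>\<^sup>+z. indicator {x} (h z) * indicator F z + indicator {x} (h z) * indicator (- F) z \<partial>measure_pmf N)"
        by (intro nn_integral_cong) (simp add: indicator_def)
      also have "\<dots> = (\<integral>\<^sup>+z. indicator {x} (h z) * indicator F z \<partial>measure_pmf N)
          + (\<integral>\<^sup>+z. indicator {x} (h z) * indicator (- F) z \<partial>measure_pmf N)"
        by (intro nn_integral_add) auto
      also have "(\<integral>\<^sup>+z. indicator {x} (h z) * indicator F z \<partial>measure_pmf N)
          = (\<Sum>z\<in>F. ennreal (pmf N z) * indicator {x} (h z))"
        using F(1) by (subst nn_integral_measure_pmf_support[of F]) (auto simp: mult.commute intro!: sum.cong)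
      finally show ?thesis .
    qed
    then show "(\<integral>\<^sup>+z. indicator {x} (h z) \<partial>measure_pmf M) = (\<integral>\<^sup>+z. indicator {x} (h z) \<partial>measure_pmf N)"
      unfolding M(3) by (simp add: eq u h)
  qed
  define k where "k = (\<lambda>(X, Y). map_pmf (\<lambda>k. (line_proj (e X k), line_proj (f Y k))) (pmf_of_set {..<rk X}))"
  define K where "K = bind_pmf M k"
  note MPc = NPc[OF subsetD[OF M(1)]]
  have "map_pmf fst K = bind_pmf M (\<lambda>z. map_pmf (\<lambda>k. line_proj (e (fst z) k)) (pmf_of_set {..<rk (fst z)}))"
    unfolding K_def map_bind_pmf k_def by (simp add: case_prod_beta map_pmf_comp)
  also have "\<dots> = split_pmf e (map_pmf fst M)" by (simp add: split_pmf_def bind_map_pmf)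
  finally have K1: "map_pmf fst K = split_pmf e (map_pmf fst N)" using margin[of fst, OF row] by simp
  have "map_pmf snd K = bind_pmf M (\<lambda>z. map_pmf (\<lambda>k. line_proj (f (snd z) k)) (pmf_of_set {..<rk (snd z)}))"
    unfolding K_def map_bind_pmf k_def
    by (intro bind_pmf_cong refl) (use MPc(3) in \<open>auto simp: map_pmf_comp\<close>)
  also have "\<dots> = split_pmf f (map_pmf snd M)" by (simp add: split_pmf_def bind_map_pmf)
  finally have K2: "map_pmf snd K = split_pmf f (map_pmf snd N)" using margin[of snd, OF col] by simp
  have "(\<integral>\<^sup>+z. d z \<partial>measure_pmf K) = (\<integral>\<^sup>+z. (\<integral>\<^sup>+z'. d z' \<partial>measure_pmf (k z)) \<partial>measure_pmf M)"
    unfolding K_def by simp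
  also have "\<dots> \<le> (\<integral>\<^sup>+z. (if z \<in> F then d z else D) \<partial>measure_pmf M)"
  proof (rule nn_integral_mono_AE, subst AE_measure_pmf_iff, rule ballI)
    fix z assume z: "z \<in> set_pmf M"
    obtain X Y where XY: "z = (X, Y)" by (cases z)
    note zPc = MPc[OF z[unfolded XY]]
    have "d (line_proj (e X k), line_proj (f Y k)) \<le> (if z \<in> F then d z else D)" if k: "k < rk X" for k
    proof (cases "z \<in> F")
      case True
      have "u z \<noteq> 0" using z M(2)[OF True] by (simp add: set_pmf_iff)
      then have "aligned X Y (e X) (f Y)" using al[of X Y] u[OF True] True XY by simp
      then show ?thesis using True k XY p by (auto simp: aligned_def d_def intro!: ennpowr_mono)
    next
      case False
      have "norm (e X k) = 1" "norm (f Y k) = 1"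
        using e[OF zPc(1)] e[OF zPc(2)] k zPc(3) orthonormal_norm unfolding proj_basis_def by fastforce+
      from geod_dist_line_proj_le_diameter[OF this] False p show ?thesis
        by (auto simp: d_def D_def intro!: ennpowr_mono)
    qed
    then have "(\<integral>\<^sup>+z'. d z' \<partial>measure_pmf (k z)) \<le> (\<integral>\<^sup>+_. (if z \<in> F then d z else D) \<partial>measure_pmf (k z))"
      using zPc(4) by (intro nn_integral_mono_AE) (auto simp: AE_measure_pmf_iff XY k_def)
    then show "(\<integral>\<^sup>+z'. d z' \<partial>measure_pmf (k z)) \<le> (if z \<in> F then d z else D)"
      by (simp add: measure_pmf.emeasure_space_1[simplified])
  qed
  also have "\<dots> = (\<Sum>z\<in>F. ennreal (u z) * d z) + (\<integral>\<^sup>+z. D * indicator (- F) z \<partial>measure_pmf N)"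
    unfolding M(3) by (intro arg_cong2[where f = "(+)"] sum.cong nn_integral_cong) (auto simp: indicator_def)
  also have "\<dots> \<le> (\<integral>\<^sup>+z. d z \<partial>measure_pmf N) + D * ennreal \<epsilon>"
  proof (rule add_mono)
    have real: "(\<Sum>z\<in>F. ennreal (v z) * d z) = ennreal (\<Sum>z\<in>F. v z * enn2real (d z))"
      if "\<And>z. z \<in> F \<Longrightarrow> v z \<ge> 0" for v
    proof -
      have "(\<Sum>z\<in>F. ennreal (v z) * d z) = (\<Sum>z\<in>F. ennreal (v z * enn2real (d z)))"
        using that finite_cost by (intro sum.cong) (auto simp: ennreal_mult)
      then show ?thesis using that by (simp add: sum_ennreal)
    qed
    have "(\<Sum>z\<in>F. ennreal (u z) * d z) \<le> (\<Sum>z\<in>F. ennreal (pmf N z) * d z)"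
      using cost by (simp add: real u ennreal_leI)
    then show "(\<Sum>z\<in>F. ennreal (u z) * d z) \<le> (\<integral>\<^sup>+z. d z \<partial>measure_pmf N)" using sum_le by (rule order_trans)
    show "(\<integral>\<^sup>+z. D * indicator (- F) z \<partial>measure_pmf N) \<le> D * ennreal \<epsilon>"
      using F(3) by (simp add: nn_integral_cmult_indicator mult_left_mono)
  qed
  finally have "(\<integral>\<^sup>+z. d z \<partial>measure_pmf K) \<le> (\<integral>\<^sup>+z. d z \<partial>measure_pmf N) + D * ennreal \<epsilon>" .
  then show ?thesis using K1 K2 e unfolding d_def D_def by blast
qed

section \<open>The transport cost through pure states\<close>

lemma ennpowr_limit_from_right:
  assumes a: "a > 0" and I: "I < \<infinity>" and D: "D < \<infinity>"
    and le: "\<And>\<epsilon>. \<epsilon> > 0 \<Longrightarrow> x \<le> ennpowr (I + D * ennreal \<epsilon>) a"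
  shows "x \<le> ennpowr I a"
proof -
  obtain i \<delta> where i: "I = ennreal i" "i \<ge> 0" and \<delta>: "D = ennreal \<delta>" "\<delta> \<ge> 0"
    using I D by (cases I; cases D) auto
  have eq: "ennpowr (I + D * ennreal t) a = ennreal ((i + \<delta> * t) powr a)" if "t \<ge> 0" for t
  proof -
    have *: "I + D * ennreal t = ennreal (i + \<delta> * t)"
      using i \<delta> that by (simp add: ennreal_mult ennreal_plus)
    show ?thesis unfolding * using i \<delta> that by (simp add: ennpowr_def del: ennreal_plus)
  qed
  have "(\<lambda>n. i + \<delta> * (1 / real (Suc n))) \<longlonglongrightarrow> i + \<delta> * 0"
    using LIMSEQ_inverse_real_of_nat by (intro tendsto_intros) (simp add: inverse_eq_divide)
  then have "(\<lambda>n. (i + \<delta> * (1 / real (Suc n))) powr a) \<longlonglongrightarrow> (i + \<delta> * 0) powr a"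
    using a i \<delta> by (intro tendsto_powr2) auto
  then have lim: "(\<lambda>n. ennreal ((i + \<delta> * (1 / real (Suc n))) powr a)) \<longlonglongrightarrow> ennreal (i powr a)"
    by (intro tendsto_ennrealI) simp
  have "x \<le> ennreal ((i + \<delta> * (1 / real (Suc n))) powr a)" for n
    using le[of "1 / real (Suc n)"] eq[of "1 / real (Suc n)"] by simp
  then have "x \<le> ennreal (i powr a)" using LIMSEQ_le_const[OF lim] by blast
  then show ?thesis using eq[of 0] by simp
qed

lemma rank_one_cost_le:
  fixes \<phi> \<psi> :: "('a::chilbert_space \<Rightarrow>\<^sub>L 'a) \<Rightarrow> complex"
  assumes p: "p \<ge> 1" and \<mu>: "\<mu>0 \<in> Lambda_perp \<phi>" "\<mu>1 \<in> Lambda_perp \<psi>"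
    and \<nu>: "\<nu> \<in> couplings (tr_meas \<mu>0) (tr_meas \<mu>1)"
  shows "(INF (\<mu>0, \<mu>1) \<in> (Lambda_perp \<phi> \<inter> prob_on_Pr 1) \<times> (Lambda_perp \<psi> \<inter> prob_on_Pr 1). Wass p \<mu>0 \<mu>1)
    \<le> ennpowr (\<integral>\<^sup>+ (P, Q). ennpowr (geod_dist P Q) p \<partial>\<nu>) (1 / p)" (is "?W \<le> ennpowr ?I _")
proof (cases "?I < \<infinity>")
  case False
  then show ?thesis by (simp add: ennpowr_def top.not_eq_extremum)
next
  case fin: True
  obtain q0 q1 where q0: "orthogonal_decomposition (density_matrix \<phi>) q0" "tr_meas \<mu>0 = borel_of_pmf Pc q0"
    and q1: "orthogonal_decomposition (density_matrix \<psi>) q1" "tr_meas \<mu>1 = borel_of_pmf Pc q1"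
    using \<mu>[THEN Lambda_perp_imp_orthogonal_decomposition] by blast
  note qs = orthogonal_decompositionD(1)[OF q0(1)] orthogonal_decompositionD(1)[OF q1(1)]
  from qs coupling_of_pmfs[OF \<nu>[unfolded q0(2) q1(2)]] obtain N
    where N: "\<nu> = borel_of_pmf (Pc \<times> Pc) N" "set_pmf N \<subseteq> Pc \<times> Pc" "map_pmf fst N = q0" "map_pmf snd N = q1"
      "\<forall>(X, Y)\<in>set_pmf N. rk X = rk Y" by blast
  have N0: "set_pmf N \<subseteq> (Pc - {0}) \<times> (Pc - {0})"
  proof
    fix z assume "z \<in> set_pmf N"
    then have "fst z \<in> set_pmf q0" "snd z \<in> set_pmf q1" using N(3,4) by auto
    then show "z \<in> (Pc - {0}) \<times> (Pc - {0})" using qs by (auto simp: mem_Times_iff)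
  qed
  have I: "?I = (\<integral>\<^sup>+(X, Y). ennpowr (geod_dist X Y) p \<partial>measure_pmf N)"
    unfolding N(1) by (rule nn_integral_borel_of_pmf[OF N(2)])
  let ?D = "ennpowr (ennreal (sqrt 2 * (pi / 2))) p"
  have D: "?D < \<infinity>" by (simp add: ennpowr_def)
  show ?thesis
  proof (rule ennpowr_limit_from_right[OF _ fin D])
    fix \<epsilon> :: real assume "\<epsilon> > 0"
    from p split_plan[OF N0 N(5) fin[unfolded I] _ this]
    obtain e f K where e: "\<forall>X\<in>Pc. e X \<in> proj_basis X" and f: "\<forall>Y\<in>Pc. f Y \<in> proj_basis Y"
      and K: "map_pmf fst K = split_pmf e q0" "map_pmf snd K = split_pmf f q1"
      and cost: "(\<integral>\<^sup>+(Z, W). ennpowr (geod_dist Z W) p \<partial>measure_pmf K) \<le> ?I + ?D * ennreal \<epsilon>"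
      unfolding I N(3,4) by fastforce
    have dec0: "orthogonal_decomposition (density_matrix \<phi>) (split_pmf e q0)" "set_pmf (split_pmf e q0) \<subseteq> Pr 1"
      by (rule split_pmf_decomposition[OF q0(1)], use e qs(1) in blast)+
    have dec1: "orthogonal_decomposition (density_matrix \<psi>) (split_pmf f q1)" "set_pmf (split_pmf f q1) \<subseteq> Pr 1"
      by (rule split_pmf_decomposition[OF q1(1)], use f qs(2) in blast)+
    have KPr: "set_pmf K \<subseteq> Pr 1 \<times> Pr 1"
    proof
      fix z assume "z \<in> set_pmf K"
      then have "fst z \<in> set_pmf (split_pmf e q0)" "snd z \<in> set_pmf (split_pmf f q1)"
        unfolding K[symmetric] by simp_all
      then show "z \<in> Pr 1 \<times> Pr 1" using dec0(2) dec1(2) by (auto simp: mem_Times_iff)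
    qed
    then have KPc: "set_pmf K \<subseteq> Pc \<times> Pc" using Pr_subset_Pc by blast
    have "borel_of_pmf (Pc \<times> Pc) K
        \<in> couplings (borel_of_pmf Pc (split_pmf e q0)) (borel_of_pmf Pc (split_pmf f q1))"
      unfolding K[symmetric]
    proof (rule pmf_coupling_in_couplings[OF KPc])
      fix X Y assume "(X, Y) \<in> set_pmf K"
      then have "X \<in> Pr 1" "Y \<in> Pr 1" using KPr by blast+
      then show "rk X = rk Y" by (simp add: Pr_rk)
    qed
    then have "Wass p (borel_of_pmf Pc (split_pmf e q0)) (borel_of_pmf Pc (split_pmf f q1))
        \<le> ennpowr (\<integral>\<^sup>+(Z, W). ennpowr (geod_dist Z W) p \<partial>borel_of_pmf (Pc \<times> Pc) K) (1 / p)"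
      unfolding Wass_def by (rule INF_lower)
    also have "(\<integral>\<^sup>+(Z, W). ennpowr (geod_dist Z W) p \<partial>borel_of_pmf (Pc \<times> Pc) K)
        = (\<integral>\<^sup>+(Z, W). ennpowr (geod_dist Z W) p \<partial>measure_pmf K)"
      by (rule nn_integral_borel_of_pmf[OF KPc])
    also have "ennpowr \<dots> (1 / p) \<le> ennpowr (?I + ?D * ennreal \<epsilon>) (1 / p)"
      using cost p by (intro ennpowr_mono) auto
    finally have "Wass p (borel_of_pmf Pc (split_pmf e q0)) (borel_of_pmf Pc (split_pmf f q1))
        \<le> ennpowr (?I + ?D * ennreal \<epsilon>) (1 / p)" .
    then show "?W \<le> ennpowr (?I + ?D * ennreal \<epsilon>) (1 / p)"
      using rank_one_decomposition_in_Lambda_perp[OF dec0] rank_one_decomposition_in_Lambda_perp[OF dec1]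
      by (intro INF_lower2[of "(borel_of_pmf Pc (split_pmf e q0), borel_of_pmf Pc (split_pmf f q1))"]) auto
  qed (use p in simp)
qed

theorem proposition4p8:
  fixes p :: real
    and \<phi> \<psi> :: "('h::chilbert_space \<Rightarrow>\<^sub>L 'h) \<Rightarrow> complex"
  assumes "separable_space (euclidean :: 'h topology)"
    and "p \<ge> 1"
    and "normal_state \<phi>" and "normal_state \<psi>"
  shows "transport_cost p \<phi> \<psi> =
    (INF (\<mu>0, \<mu>1) \<in> (Lambda_perp \<phi> \<inter> prob_on_Pr 1) \<times> (Lambda_perp \<psi> \<inter> prob_on_Pr 1).
       Wass p \<mu>0 \<mu>1)"
proof (rule antisym)
  show "transport_cost p \<phi> \<psi> \<le> (INF (\<mu>0, \<mu>1) \<in> (Lambda_perp \<phi> \<inter> prob_on_Pr 1) \<times> (Lambda_perp \<psi> \<inter> prob_on_Pr 1).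
       Wass p \<mu>0 \<mu>1)"
    unfolding transport_cost_def
  proof (rule INF_greatest)
    fix z assume z: "z \<in> (Lambda_perp \<phi> \<inter> prob_on_Pr 1) \<times> (Lambda_perp \<psi> \<inter> prob_on_Pr 1)"
    then show "(INF (\<mu>0, \<mu>1) \<in> Lambda_perp \<phi> \<times> Lambda_perp \<psi>. Wass p (tr_meas \<mu>0) (tr_meas \<mu>1))
      \<le> (case z of (\<mu>0, \<mu>1) \<Rightarrow> Wass p \<mu>0 \<mu>1)"
      by (intro INF_lower2[of z]) (auto simp: tr_meas_rank_one simp del: One_nat_def)
  qed
  show "(INF (\<mu>0, \<mu>1) \<in> (Lambda_perp \<phi> \<inter> prob_on_Pr 1) \<times> (Lambda_perp \<psi> \<inter> prob_on_Pr 1). Wass p \<mu>0 \<mu>1)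
    \<le> transport_cost p \<phi> \<psi>"
    unfolding transport_cost_def
  proof (rule INF_greatest)
    fix z assume z: "z \<in> Lambda_perp \<phi> \<times> Lambda_perp \<psi>"
    obtain \<mu>0 \<mu>1 where "z = (\<mu>0, \<mu>1)" "\<mu>0 \<in> Lambda_perp \<phi>" "\<mu>1 \<in> Lambda_perp \<psi>"
      using z by blast
    then show "(INF (\<mu>0, \<mu>1) \<in> (Lambda_perp \<phi> \<inter> prob_on_Pr 1) \<times> (Lambda_perp \<psi> \<inter> prob_on_Pr 1). Wass p \<mu>0 \<mu>1)
      \<le> (case z of (\<mu>0, \<mu>1) \<Rightarrow> Wass p (tr_meas \<mu>0) (tr_meas \<mu>1))"
      using rank_one_cost_le[OF assms(2)] unfolding Wass_def[of p "tr_meas _"] by (auto intro!: INF_greatest)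
  qed
qed

end
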